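(* Let $\mathcal{H}_S$ be a Hilbert space of finite dimension $N\ge 2$ and let $A$ be a self-adjoint operator on $\mathcal{H}_S$ with non-degenerate spectrum: an orthonormal basis $\varphi_1,\dots,\varphi_N$ of eigenvectors with pairwise distinct real eigenvalues $a_1,\dots,a_N$. Put $a_0=\min\{a_k-a_l : a_k>a_l\}>0$. Let $\psi_0\in\mathcal{H}_S$, $\Psi_{Pr}\in\mathcal{H}_{Pr}=L^2(\mathbb{R},dq)$ and $\Phi_0\in\mathcal{H}_{Po}=L^2(\mathbb{R},db)$ be unit vectors. Let $\hbar>0$, $\lambda>0$, $\alpha>0$, set $\beta=2\lambda/\alpha$, and let $$U=\exp\left(-\frac{i}{\hbar}\left[\alpha\, A\otimes Q\otimes \mathbb{I}_{Po}+\beta\, \mathbb{I}_S\otimes P\otimes B\right]\right),$$ where $Q$, $P$ are the position and momentum operators on $\mathcal{H}_{Pr}$ and $B$ is multiplication by $b$ on $\mathcal{H}_{Po}$. Let $\Psi_f=U(\psi_0\otimes\Psi_{Pr}\otimes\Phi_0)$ and let $$\rho_{S\otimes M}=\mathrm{Tr}_{Pr}\left[\,|\Psi_f\rangle\langle\Psi_f|\,\right]$$ be the reduced density operator on $\mathcal{H}_S\otimes\mathcal{H}_{Po}$. Suppose that the probe wave function $\Psi_{Pr}$ is momentum limited with bound $\kappa_0>0$. If $$\alpha>\alpha_D=\frac{2\hbar\kappa_0}{a_0},$$ then $\rho_{S\otimes M}$ is exactly diagonal with respect to the eigenbasis of $A$: $$\rho_{S\otimes M}=\sum_{k=1}^N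 |\langle\varphi_k|\psi_0\rangle|^2\; |\varphi_k\rangle\langle\varphi_k|\otimes\rho_k,$$ where $$\rho_k=\int_{-\infty}^{\infty} dp\, |\langle p|\Psi_{Pr}\rangle|^2\; e^{\frac{i}{\hbar}(\lambda a_k-\beta p)B}\,|\Phi_0\rangle\langle\Phi_0|\,e^{-\frac{i}{\hbar}(\lambda a_k-\beta p)B}.$$
   Context: Inner products are linear in the second argument, and $|u\rangle\langle v|$ denotes the operator $w\mapsto\langle v|w\rangle u$. On $L^2(\mathbb{R},dq)$, $Q$ is multiplication by $q$ and $P=-i\hbar\,d/dq$, so $[Q,P]=i\hbar$. $\langle p|\Psi\rangle=(2\pi\hbar)^{-1/2}\int e^{-ipq/\hbar}\Psi(q)\,dq$ is the (unitary) momentum-space wave function of $\Psi\in L^2(\mathbb{R},dq)$. The pointer observable $B$ is a self-adjoint operator with simple spectrum equal to the whole real line and generalized eigenvectors $|b\rangle$, $b\in\mathbb{R}$; equivalently the pointer space is represented as $L^2(\mathbb{R},db)$ with $B$ acting as multiplication by $b$, and $\langle b|\Phi_0\rangle=\Phi_0(b)$. The operator in the exponent defining $U$ is the self-adjoint closure of the indicated sum, defined on the linear span of vectors $\varphi_k\otimes f$ with $f\in\mathcal{S}(\mathbb{R}^2)$ (Schwartz functions of $(q,b)$). $\mathrm{Tr}_{Pr}$ is the partial trace over $\mathcal{H}_{Pr}$, from trace-class operators on $\mathcal{H}_S\otimes\mathcal{H}_{Pr}\otimes\mathcal{H}_{Po}$ to trace-class operators on $\mathcal{H}_S\otimes\mathcal{H}_{Po}$.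 The integral defining $\rho_k$ is a trace-norm convergent (Bochner) integral of rank-one operators on $\mathcal{H}_{Po}$. A function $\psi\in L^2(\mathbb{R})$ is momentum limited with bound $\kappa_0$ ($0<\kappa_0<\infty$) if $\psi(x)=\int_{-\kappa_0}^{\kappa_0}e^{ixk}\tilde\psi(k)\,dk$ for some $\tilde\psi\in L^2(-\kappa_0,\kappa_0)$. *)

theory Defs
  imports "HOL-Analysis.Analysis"
begin

section \<open>Complex inner product spaces\<close>

text \<open>The complex inner product is linear in the second argument; its real part is the
  real inner product of the library, so that norm and topology are the library's. A finite
  dimensional complex Hilbert space is a type of sort
  \<open>{complex_inner, euclidean_space}\<close>.\<close>

class complex_inner = real_inner +
  fixes scaleC :: "complex \<Rightarrow> 'a \<Rightarrow> 'a" (infixr "*\<^sub>C" 75)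
    and cinner :: "'a \<Rightarrow> 'a \<Rightarrow> complex"
  assumes scaleC_add_right: "c *\<^sub>C (x + y) = c *\<^sub>C x + c *\<^sub>C y"
    and scaleC_add_left: "(c + d) *\<^sub>C x = c *\<^sub>C x + d *\<^sub>C x"
    and scaleC_scaleC: "c *\<^sub>C (d *\<^sub>C x) = (c * d) *\<^sub>C x"
    and scaleC_of_real: "complex_of_real r *\<^sub>C x = r *\<^sub>R x"
    and cinner_commute: "cinner x y = cnj (cinner y x)"
    and cinner_add_right: "cinner x (y + z) = cinner x y + cinner x z"
    and cinner_scaleC_right: "cinner x (c *\<^sub>C y) = c * cinner x y"
    and Re_cinner: "Re (cinner x y) = inner x y"
begin

lemma cinner_add_left: "cinner (x + y) z = cinner x z + cinner y z"
  by (metis cinner_commute cinner_add_right complex_cnj_add)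

lemma cinner_scaleC_left: "cinner (c *\<^sub>C x) y = cnj c * cinner x y"
  by (metis cinner_commute cinner_scaleC_right complex_cnj_mult)

lemma cinner_eq_inner: "cinner x y = Complex (inner x y) (inner (\<i> *\<^sub>C x) y)"
  by (simp add: complex_eq_iff Re_cinner flip: Re_cinner) (simp add: cinner_scaleC_left)

lemma cinner_same: "cinner x x = complex_of_real (inner x x)"
proof -
  have "Im (cinner x x) = - Im (cinner x x)"
    using cinner_commute[of x x] by (metis cnj.simps(2))
  thus ?thesis by (simp add: complex_eq_iff Re_cinner)
qed

end

lemma norm_scaleC: "norm (c *\<^sub>C (x::'a::complex_inner)) = cmod c * norm x"
proof -
  have "complex_of_real (inner (c *\<^sub>C x) (c *\<^sub>C x)) = (c * cnj c) * complex_of_real (inner x x)"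
    by (simp only: cinner_same[symmetric] cinner_scaleC_left cinner_scaleC_right mult.assoc mult.commute)
       (simp add: mult_ac)
  hence "inner (c *\<^sub>C x) (c *\<^sub>C x) = (cmod c)\<^sup>2 * inner x x"
    by (simp only: complex_norm_square[symmetric] of_real_mult[symmetric] of_real_eq_iff)
  thus ?thesis by (simp add: norm_eq_sqrt_inner real_sqrt_mult)
qed

lemma bounded_linear_scaleC_right: "bounded_linear (\<lambda>x::'a::complex_inner. c *\<^sub>C x)"
proof (rule bounded_linear_intro[where K = "cmod c"])
  show "c *\<^sub>C (r *\<^sub>R x) = r *\<^sub>R (c *\<^sub>C x)" for r and x :: 'a
    by (simp add: scaleC_scaleC mult.commute flip: scaleC_of_real)
qed (simp_all add: scaleC_add_right norm_scaleC mult.commute)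

lemma bounded_linear_scaleC_left: "bounded_linear (\<lambda>c. c *\<^sub>C (x::'a::complex_inner))"
proof (rule bounded_linear_intro[where K = "norm x"])
  show "(r *\<^sub>R c) *\<^sub>C x = r *\<^sub>R (c *\<^sub>C x)" for r c
    by (simp add: scaleR_conv_of_real flip: scaleC_of_real scaleC_scaleC)
qed (simp_all add: scaleC_add_left norm_scaleC)

lemma norm_cinner_le: "cmod (cinner x y) \<le> norm x * norm (y::'a::complex_inner)"
proof (cases "cinner x y = 0")
  case False
  define c where "c = sgn (cinner x y)"
  have c: "cmod c = 1" using False by (simp add: c_def norm_sgn)
  have "inner (c *\<^sub>C x) y = Re (cnj c * cinner x y)"
    by (simp add: cinner_scaleC_left flip: Re_cinner)
  also have "cnj c * cinner x y = complex_of_real (cmod (cinner x y))"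
    using False by (simp add: c_def sgn_eq field_simps complex_norm_square[symmetric] power2_eq_square)
  finally have "cmod (cinner x y) = inner (c *\<^sub>C x) y" by simp
  also have "\<dots> \<le> norm (c *\<^sub>C x) * norm y" by (rule norm_cauchy_schwarz)
  finally show ?thesis by (simp add: norm_scaleC c)
qed simp

instantiation complex :: complex_inner
begin

definition scaleC_complex :: "complex \<Rightarrow> complex \<Rightarrow> complex" where
  "scaleC_complex c x = c * x"

definition cinner_complex :: "complex \<Rightarrow> complex \<Rightarrow> complex" where
  "cinner_complex x y = cnj x * y"

instance
  by standard
    (simp_all add: scaleC_complex_def cinner_complex_def inner_complex_def algebra_simps
      scaleR_conv_of_real)

end

instantiation vec :: (complex_inner, finite) complex_inner
begin

definition scaleC_vec :: "complex \<Rightarrow> 'a ^ 'b \<Rightarrow> 'a ^ 'b" where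
  "scaleC_vec c x = (\<chi> i. c *\<^sub>C (x $ i))"

definition cinner_vec :: "'a ^ 'b \<Rightarrow> 'a ^ 'b \<Rightarrow> complex" where
  "cinner_vec x y = (\<Sum>i\<in>UNIV. cinner (x $ i) (y $ i))"

instance
proof
  fix x y :: "'a ^ 'b"
  show "cinner x y = cnj (cinner y x)"
    unfolding cinner_vec_def cnj_sum by (rule sum.cong[OF refl]) (rule cinner_commute)
qed (simp_all add: vec_eq_iff scaleC_vec_def cinner_vec_def inner_vec_def scaleC_add_right
      scaleC_add_left scaleC_scaleC scaleC_of_real cinner_add_right cinner_scaleC_right Re_cinner
      sum.distrib sum_distrib_left)

end

definition cspan :: "'h::complex_inner set \<Rightarrow> 'h set" where
  "cspan S = {\<Sum>v\<in>F. c v *\<^sub>C v | F c. finite F \<and> F \<subseteq> S}"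

definition orthonormal_on :: "'i set \<Rightarrow> ('i \<Rightarrow> 'h::complex_inner) \<Rightarrow> bool" where
  "orthonormal_on I e \<longleftrightarrow> (\<forall>i\<in>I. \<forall>j\<in>I. cinner (e i) (e j) = (if i = j then 1 else 0))"

definition orthonormal_basis :: "'h::complex_inner set \<Rightarrow> bool" where
  "orthonormal_basis S \<longleftrightarrow> orthonormal_on S (\<lambda>e. e) \<and> closure (cspan S) = UNIV"

definition self_adjoint :: "('h::complex_inner \<Rightarrow>\<^sub>L 'h) \<Rightarrow> bool" where
  "self_adjoint T \<longleftrightarrow> (\<forall>x y. cinner x (T y) = cinner (T x) y)"

definition complex_linear :: "('h::complex_inner \<Rightarrow>\<^sub>L 'k::complex_inner) \<Rightarrow> bool" where
  "complex_linear T \<longleftrightarrow> (\<forall>c x. T (c *\<^sub>C x) = c *\<^sub>C T x)"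

text \<open>\<open>ketbra u v\<close> is $|u\rangle\langle v|$.\<close>

lift_definition ketbra :: "'h::complex_inner \<Rightarrow> 'h \<Rightarrow> 'h \<Rightarrow>\<^sub>L 'h" is
  "\<lambda>u v w. cinner v w *\<^sub>C u"
proof -
  fix u v :: 'h
  have "cinner v (r *\<^sub>R w) = r *\<^sub>R cinner v w" for r w
    by (simp add: cinner_scaleC_right scaleR_conv_of_real flip: scaleC_of_real)
  hence "bounded_linear (\<lambda>w. cinner v w)"
    by (intro bounded_linear_intro[where K = "norm v"])
       (simp_all add: cinner_add_right norm_cinner_le mult.commute[of _ "norm v"])
  thus "bounded_linear (\<lambda>w. cinner v w *\<^sub>C u)"
    by (rule bounded_linear_compose[OF bounded_linear_scaleC_left])
qed


section \<open>Square-integrable functions\<close>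

text \<open>\<open>('x, 's) L2\<close> is $L^2(\mathtt{'x}, dx; \mathtt{'s})$ for Lebesgue measure on \<open>'x\<close>
  and a finite dimensional Hilbert space \<open>'s\<close>, i.e. the Hilbert space
  $\mathtt{'s} \otimes L^2(\mathtt{'x}, dx)$. Its elements are classes of functions that agree
  almost everywhere: \<open>L2_of\<close> is the class of a square-integrable function and
  \<open>L2_fun\<close> chooses a representative.\<close>

definition square_integrable :: "('x::euclidean_space \<Rightarrow> 's::{complex_inner, euclidean_space}) \<Rightarrow> bool"
  where "square_integrable f \<longleftrightarrow>
    f \<in> borel_measurable lborel \<and> integrable lborel (\<lambda>x. (norm (f x))\<^sup>2)"

definition L2_rel :: "('x::euclidean_space \<Rightarrow> 's::{complex_inner, euclidean_space}) \<Rightarrow> ('x \<Rightarrow> 's) \<Rightarrow> bool"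
  where "L2_rel f g \<longleftrightarrow>
    square_integrable f \<and> square_integrable g \<and> (AE x in lborel. f x = g x)"

lemma square_integrable_zero: "square_integrable (\<lambda>x. 0)"
  by (simp add: square_integrable_def)

lemma square_integrable_add:
  assumes "square_integrable f" "square_integrable g"
  shows "square_integrable (\<lambda>x. f x + g x)"
  unfolding square_integrable_def
proof
  show m: "(\<lambda>x. f x + g x) \<in> borel_measurable lborel"
    using assms by (auto simp: square_integrable_def)
  have "integrable lborel (\<lambda>x. 2 * (norm (f x))\<^sup>2 + 2 * (norm (g x))\<^sup>2)"
    using assms by (auto simp: square_integrable_def)
  moreover have "(norm (f x + g x))\<^sup>2 \<le> 2 * (norm (f x))\<^sup>2 + 2 * (norm (g x))\<^sup>2" for x
  proof -
    have "(norm (f x + g x))\<^sup>2 \<le> (norm (f x) + norm (g x))\<^sup>2"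
      by (intro power_mono norm_triangle_ineq) auto
    also have "\<dots> \<le> 2 * (norm (f x))\<^sup>2 + 2 * (norm (g x))\<^sup>2"
      using sum_squares_bound[of "norm (f x)" "norm (g x)"] by (simp add: power2_sum)
    finally show ?thesis .
  qed
  ultimately show "integrable lborel (\<lambda>x. (norm (f x + g x))\<^sup>2)"
    using m by (auto intro: Bochner_Integration.integrable_bound)
qed

lemma scaleC_measurable:
  assumes "f \<in> borel_measurable M"
  shows "(\<lambda>x. c *\<^sub>C (f x :: 's::{complex_inner, euclidean_space})) \<in> borel_measurable M"
proof -
  have "(\<lambda>x. c *\<^sub>C (x::'s)) \<in> borel_measurable borel"
    by (intro borel_measurable_continuous_onI bounded_linear.continuous_on[OF bounded_linear_scaleC_right]
        continuous_on_id)
  from measurable_compose[OF assms this] show ?thesis .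
qed

lemma square_integrable_scaleC:
  assumes "square_integrable f"
  shows "square_integrable (\<lambda>x. c *\<^sub>C f x)"
  using assms by (auto simp: square_integrable_def norm_scaleC power_mult_distrib scaleC_measurable)

lemma square_integrable_scaleR:
  assumes "square_integrable f"
  shows "square_integrable (\<lambda>x. r *\<^sub>R f x)"
  using square_integrable_scaleC[OF assms, of "of_real r"] by (simp add: scaleC_of_real)

lemma square_integrable_inner:
  assumes "square_integrable f" "square_integrable g"
  shows "integrable lborel (\<lambda>x. inner (f x) (g x))"
proof (rule Bochner_Integration.integrable_bound)
  show "integrable lborel (\<lambda>x. (norm (f x))\<^sup>2 + (norm (g x))\<^sup>2)"
    using assms by (auto simp: square_integrable_def)
  show "(\<lambda>x. inner (f x) (g x)) \<in> borel_measurable lborel"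
    using assms by (auto simp: square_integrable_def)
  have "norm (inner (f x) (g x)) \<le> norm ((norm (f x))\<^sup>2 + (norm (g x))\<^sup>2)" for x
  proof -
    have "norm (inner (f x) (g x)) \<le> norm (f x) * norm (g x)"
      by (simp add: Cauchy_Schwarz_ineq2)
    also have "\<dots> \<le> 2 * norm (f x) * norm (g x)" by simp
    also have "\<dots> \<le> (norm (f x))\<^sup>2 + (norm (g x))\<^sup>2"
      by (rule sum_squares_bound)
    finally show ?thesis by simp
  qed
  thus "AE x in lborel. norm (inner (f x) (g x)) \<le> norm ((norm (f x))\<^sup>2 + (norm (g x))\<^sup>2)"
    by simp
qed

lemma square_integrable_cinner:
  assumes "square_integrable f" "square_integrable g"
  shows "integrable lborel (\<lambda>x. cinner (f x) (g x))"
proof -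
  have "integrable lborel (\<lambda>x. complex_of_real (inner (f x) (g x)) + \<i> * complex_of_real (inner (\<i> *\<^sub>C f x) (g x)))"
    using assms
    by (intro Bochner_Integration.integrable_add integrable_mult_right integrable_of_real square_integrable_inner
        square_integrable_scaleC)
  thus ?thesis by (simp add: cinner_eq_inner complex_eq_cancel_iff2 Complex_eq)
qed

quotient_type (overloaded) ('x, 's) L2 =
  "'x::euclidean_space \<Rightarrow> 's::{complex_inner, euclidean_space}" / partial: L2_rel
  morphisms L2_fun L2_of
proof (rule part_equivpI)
  show "\<exists>f::'x \<Rightarrow> 's. L2_rel f f"
    by (rule exI[of _ "\<lambda>x. 0"]) (simp add: L2_rel_def square_integrable_zero)
  show "symp (L2_rel :: ('x \<Rightarrow> 's) \<Rightarrow> _)"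
    by (auto simp: symp_def L2_rel_def)
  show "transp (L2_rel :: ('x \<Rightarrow> 's) \<Rightarrow> _)"
    by (auto simp: transp_def L2_rel_def)
qed

lemma integral_inner_cong:
  assumes "L2_rel f f'" "L2_rel g g'"
  shows "(\<integral>x. inner (f x) (g x) \<partial>lborel) = (\<integral>x. inner (f' x) (g' x) \<partial>lborel)"
proof (rule integral_cong_AE)
  show "AE x in lborel. inner (f x) (g x) = inner (f' x) (g' x)"
    using assms by (auto simp: L2_rel_def)
  have *: "square_integrable f" "square_integrable g" "square_integrable f'" "square_integrable g'"
    using assms by (auto simp: L2_rel_def)
  show "(\<lambda>x. inner (f x) (g x)) \<in> borel_measurable lborel"
    by (rule borel_measurable_integrable[OF square_integrable_inner[OF *(1,2)]])
  show "(\<lambda>x. inner (f' x) (g' x)) \<in> borel_measurable lborel"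
    by (rule borel_measurable_integrable[OF square_integrable_inner[OF *(3,4)]])
qed

lemma integral_cinner_cong:
  assumes "L2_rel f f'" "L2_rel g g'"
  shows "(\<integral>x. cinner (f x) (g x) \<partial>lborel) = (\<integral>x. cinner (f' x) (g' x) \<partial>lborel)"
proof (rule integral_cong_AE)
  have *: "square_integrable f" "square_integrable g" "square_integrable f'" "square_integrable g'"
    using assms by (auto simp: L2_rel_def)
  show "(\<lambda>x. cinner (f x) (g x)) \<in> borel_measurable lborel"
    by (rule borel_measurable_integrable[OF square_integrable_cinner[OF *(1,2)]])
  show "(\<lambda>x. cinner (f' x) (g' x)) \<in> borel_measurable lborel"
    by (rule borel_measurable_integrable[OF square_integrable_cinner[OF *(3,4)]])
  show "AE x in lborel. cinner (f x) (g x) = cinner (f' x) (g' x)"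
    using assms by (auto simp: L2_rel_def)
qed

instantiation L2 :: (euclidean_space, "{complex_inner, euclidean_space}") complex_inner
begin

lift_definition zero_L2 :: "('a, 'b) L2" is "\<lambda>x. 0"
  by (simp add: L2_rel_def square_integrable_zero)

lift_definition plus_L2 :: "('a, 'b) L2 \<Rightarrow> ('a, 'b) L2 \<Rightarrow> ('a, 'b) L2" is
  "\<lambda>f g x. f x + g x"
  by (auto simp: L2_rel_def square_integrable_add)

lift_definition scaleR_L2 :: "real \<Rightarrow> ('a, 'b) L2 \<Rightarrow> ('a, 'b) L2" is "\<lambda>r f x. r *\<^sub>R f x"
  by (auto simp: L2_rel_def square_integrable_scaleR)

lift_definition scaleC_L2 :: "complex \<Rightarrow> ('a, 'b) L2 \<Rightarrow> ('a, 'b) L2" is "\<lambda>c f x. c *\<^sub>C f x"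
  by (auto simp: L2_rel_def square_integrable_scaleC)

lift_definition inner_L2 :: "('a, 'b) L2 \<Rightarrow> ('a, 'b) L2 \<Rightarrow> real" is
  "\<lambda>f g. \<integral>x. inner (f x) (g x) \<partial>lborel"
  by (rule integral_inner_cong)

lift_definition cinner_L2 :: "('a, 'b) L2 \<Rightarrow> ('a, 'b) L2 \<Rightarrow> complex" is
  "\<lambda>f g. \<integral>x. cinner (f x) (g x) \<partial>lborel"
  by (rule integral_cinner_cong)

definition uminus_L2 :: "('a, 'b) L2 \<Rightarrow> ('a, 'b) L2" where
  "uminus_L2 f = (- 1) *\<^sub>R f"

definition minus_L2 :: "('a, 'b) L2 \<Rightarrow> ('a, 'b) L2 \<Rightarrow> ('a, 'b) L2" where
  "minus_L2 f g = f + (- g)"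

definition norm_L2 :: "('a, 'b) L2 \<Rightarrow> real" where
  "norm_L2 f = sqrt (inner f f)"

definition dist_L2 :: "('a, 'b) L2 \<Rightarrow> ('a, 'b) L2 \<Rightarrow> real" where
  "dist_L2 f g = norm (f - g)"

definition sgn_L2 :: "('a, 'b) L2 \<Rightarrow> ('a, 'b) L2" where
  "sgn_L2 f = inverse (norm f) *\<^sub>R f"

definition uniformity_L2 :: "(('a, 'b) L2 \<times> ('a, 'b) L2) filter" where
  "uniformity_L2 = (INF e\<in>{0 <..}. principal {(f, g). dist f g < e})"

definition open_L2 :: "('a, 'b) L2 set \<Rightarrow> bool" where
  "open_L2 S = (\<forall>f\<in>S. \<forall>\<^sub>F (f', g) in uniformity. f' = f \<longrightarrow> g \<in> S)"

instance
proof
  fix f g h :: "('a, 'b) L2" and r s :: real and c d :: complex and S :: "('a, 'b) L2 set"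
  show "f + g + h = f + (g + h)"
    by transfer (simp add: L2_rel_def square_integrable_add add.assoc)
  show "f + g = g + f"
    by transfer (simp add: L2_rel_def square_integrable_add add.commute)
  show "0 + f = f"
    by transfer (simp add: L2_rel_def)
  show "- f + f = 0" unfolding uminus_L2_def
    by transfer (simp add: L2_rel_def square_integrable_zero)
  show "f - g = f + - g" by (simp add: minus_L2_def)
  show "r *\<^sub>R (f + g) = r *\<^sub>R f + r *\<^sub>R g"
    by transfer (simp add: L2_rel_def square_integrable_add square_integrable_scaleR scaleR_add_right)
  show "(r + s) *\<^sub>R f = r *\<^sub>R f + s *\<^sub>R f"
    by transfer (simp add: L2_rel_def square_integrable_add square_integrable_scaleR scaleR_add_left)
  show "r *\<^sub>R s *\<^sub>R f = (r * s) *\<^sub>R f"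
    by transfer (simp add: L2_rel_def square_integrable_scaleR)
  show "1 *\<^sub>R f = f"
    by transfer (simp add: L2_rel_def)
  show "sgn f = inverse (norm f) *\<^sub>R f" by (rule sgn_L2_def)
  show "dist f g = norm (f - g)" by (rule dist_L2_def)
  show "uniformity = (INF e\<in>{0 <..}. principal {(f, g :: ('a, 'b) L2). dist f g < e})"
    by (rule uniformity_L2_def)
  show "open S = (\<forall>f\<in>S. \<forall>\<^sub>F (f', g) in uniformity. f' = f \<longrightarrow> g \<in> S)"
    by (rule open_L2_def)
  show "inner f g = inner g f"
    by transfer (simp add: inner_commute)
  show "inner (f + g) h = inner f h + inner g h"
    by transfer (simp add: L2_rel_def inner_add_left square_integrable_inner)
  show "inner (r *\<^sub>R f) g = r * inner f g"
    by transfer simp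
  show "0 \<le> inner f f"
    by transfer simp
  show "inner f f = 0 \<longleftrightarrow> f = 0"
  proof transfer
    fix f :: "'a \<Rightarrow> 'b" assume "L2_rel f f"
    hence f: "square_integrable f" by (simp add: L2_rel_def)
    have "(\<integral>x. inner (f x) (f x) \<partial>lborel) = 0 \<longleftrightarrow> (AE x in lborel. inner (f x) (f x) = 0)"
      by (intro integral_nonneg_eq_0_iff_AE square_integrable_inner f) simp
    thus "(\<integral>x. inner (f x) (f x) \<partial>lborel) = 0 \<longleftrightarrow> L2_rel f (\<lambda>x. 0)"
      using f by (simp add: L2_rel_def square_integrable_zero)
  qed
  show "norm f = sqrt (inner f f)" by (rule norm_L2_def)
  show "c *\<^sub>C (f + g) = c *\<^sub>C f + c *\<^sub>C g"
    by transfer (simp add: L2_rel_def square_integrable_add square_integrable_scaleC scaleC_add_right)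
  show "(c + d) *\<^sub>C f = c *\<^sub>C f + d *\<^sub>C f"
    by transfer (simp add: L2_rel_def square_integrable_add square_integrable_scaleC scaleC_add_left)
  show "c *\<^sub>C d *\<^sub>C f = (c * d) *\<^sub>C f"
    by transfer (simp add: L2_rel_def square_integrable_scaleC scaleC_scaleC)
  show "complex_of_real r *\<^sub>C f = r *\<^sub>R f"
    by transfer (simp add: L2_rel_def square_integrable_scaleR scaleC_of_real)
  show "cinner f g = cnj (cinner g f)"
  proof transfer
    fix f g :: "'a \<Rightarrow> 'b"
    have "(\<integral>x. cinner (f x) (g x) \<partial>lborel) = (\<integral>x. cnj (cinner (g x) (f x)) \<partial>lborel)"
      by (rule Bochner_Integration.integral_cong[OF refl]) (rule cinner_commute)
    thus "(\<integral>x. cinner (f x) (g x) \<partial>lborel) = cnj (\<integral>x. cinner (g x) (f x) \<partial>lborel)"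
      by simp
  qed
  show "cinner f (g + h) = cinner f g + cinner f h"
    by transfer (simp add: L2_rel_def cinner_add_right square_integrable_cinner)
  show "cinner f (c *\<^sub>C g) = c * cinner f g"
    by transfer (simp add: cinner_scaleC_right)
  show "Re (cinner f g) = inner f g"
    by transfer (simp add: L2_rel_def square_integrable_cinner Re_cinner flip: integral_Re)
qed

end


subsection \<open>Tensor products\<close>

lemma scaleC_measurable2:
  fixes g :: "'a \<Rightarrow> 's::{complex_inner, euclidean_space}"
  assumes "f \<in> borel_measurable M" "g \<in> borel_measurable M"
  shows "(\<lambda>x. f x *\<^sub>C g x) \<in> borel_measurable M"
proof -
  have "f x *\<^sub>C g x = Re (f x) *\<^sub>R g x + Im (f x) *\<^sub>R (\<i> *\<^sub>C g x)" for x
    by (subst complex_eq[of "f x"])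
       (simp only: scaleC_add_left scaleC_of_real scaleC_scaleC[symmetric] mult.commute[of \<i>])
  moreover have "(\<lambda>x. Re (f x)) \<in> borel_measurable M" "(\<lambda>x. Im (f x)) \<in> borel_measurable M"
    using assms(1) by (simp_all add: borel_measurable_complex_iff)
  hence "(\<lambda>x. Re (f x) *\<^sub>R g x + Im (f x) *\<^sub>R (\<i> *\<^sub>C g x)) \<in> borel_measurable M"
    using assms
    by (intro borel_measurable_add borel_measurable_scaleR scaleC_measurable)
  ultimately show ?thesis by simp
qed

text \<open>$u \otimes f \in \mathtt{'s} \otimes L^2(\mathtt{'x}, dx)$\<close>

lift_definition vtensor :: "'s::{complex_inner, euclidean_space} \<Rightarrow> ('x::euclidean_space, complex) L2
    \<Rightarrow> ('x, 's) L2" (infixr "\<otimes>\<^sub>v" 70) is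
  "\<lambda>u f x. f x *\<^sub>C u"
  by (auto simp: L2_rel_def square_integrable_def norm_scaleC power_mult_distrib scaleC_measurable2)

text \<open>\<open>probe_tensor \<Psi> w\<close> inserts the probe vector \<open>\<Psi>\<close> into
  $w \in \mathcal{H}_S \otimes \mathcal{H}_{Po}$, so that
  \<open>probe_tensor \<Psi> (\<psi> \<otimes>\<^sub>v \<Phi>)\<close> is $\psi\otimes\Psi\otimes\Phi \in
  \mathcal{H}_S\otimes\mathcal{H}_{Pr}\otimes\mathcal{H}_{Po} = L^2(\mathbb{R}^2, dq\,db; \mathcal{H}_S)$.\<close>

lift_definition probe_tensor :: "(real, complex) L2 \<Rightarrow> (real, 's::{complex_inner, euclidean_space}) L2
    \<Rightarrow> (real \<times> real, 's) L2" is
  "\<lambda>\<Psi> w x. \<Psi> (fst x) *\<^sub>C w (snd x)"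
proof -
  have sq: "square_integrable (\<lambda>x. \<Psi> (fst x) *\<^sub>C w (snd x))"
    if \<Psi>: "square_integrable \<Psi>" and w: "square_integrable w"
    for \<Psi> :: "real \<Rightarrow> complex" and w :: "real \<Rightarrow> 's"
  proof -
    have [measurable]: "\<Psi> \<in> borel_measurable borel" "w \<in> borel_measurable borel"
      using \<Psi> w by (auto simp: square_integrable_def)
    have m: "(\<lambda>x. \<Psi> (fst x) *\<^sub>C w (snd x)) \<in> borel_measurable (lborel \<Otimes>\<^sub>M lborel)"
      by (intro scaleC_measurable2) measurable
    have "integrable (lborel \<Otimes>\<^sub>M lborel) (\<lambda>x. (cmod (\<Psi> (fst x)))\<^sup>2 * (norm (w (snd x)))\<^sup>2)"
    proof (rule lborel_pair.Fubini_integrable)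
      show "integrable lborel (\<lambda>x. LINT y|lborel. norm ((cmod (\<Psi> (fst (x, y))))\<^sup>2 * (norm (w (snd (x, y))))\<^sup>2))"
        using \<Psi> by (simp add: square_integrable_def)
      show "AE x in lborel. integrable lborel (\<lambda>y. (cmod (\<Psi> (fst (x, y))))\<^sup>2 * (norm (w (snd (x, y))))\<^sup>2)"
        using w by (simp add: square_integrable_def)
    qed measurable
    thus ?thesis using m
      by (simp add: square_integrable_def norm_scaleC power_mult_distrib lborel_prod)
  qed
  fix \<Psi> \<Psi>' :: "real \<Rightarrow> complex" and w w' :: "real \<Rightarrow> 's"
  assume *: "L2_rel \<Psi> \<Psi>'" "L2_rel w w'"
  have [measurable]: "\<Psi> \<in> borel_measurable borel" "\<Psi>' \<in> borel_measurable borel"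
      "w \<in> borel_measurable borel" "w' \<in> borel_measurable borel"
    using * by (auto simp: square_integrable_def L2_rel_def)
  have meas: "{x \<in> space (lborel \<Otimes>\<^sub>M lborel). \<Psi> (fst x) = \<Psi>' (fst x) \<and> w (snd x) = w' (snd x)}
      \<in> sets (lborel \<Otimes>\<^sub>M lborel)"
    by measurable
  have "AE x in lborel \<Otimes>\<^sub>M lborel. \<Psi> (fst x) = \<Psi>' (fst x) \<and> w (snd x) = w' (snd x)"
    using * by (intro lborel_pair.AE_pair_measure meas) (auto simp: L2_rel_def)
  hence "AE x in lborel. \<Psi> (fst x) = \<Psi>' (fst x) \<and> w (snd x) = w' (snd x)"
    unfolding lborel_prod .
  hence "AE x in lborel. \<Psi> (fst x) *\<^sub>C w (snd x) = \<Psi>' (fst x) *\<^sub>C w' (snd x)"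
    by (rule AE_mp) simp
  thus "L2_rel (\<lambda>x. \<Psi> (fst x) *\<^sub>C w (snd x)) (\<lambda>x. \<Psi>' (fst x) *\<^sub>C w' (snd x))"
    using * sq by (auto simp: L2_rel_def)
qed

text \<open>The operator $X \otimes R$ on $\mathcal{H}_S \otimes L^2(\mathtt{'x}, dx)$\<close>

definition op_tensor :: "('s::{complex_inner, euclidean_space} \<Rightarrow>\<^sub>L 's) \<Rightarrow>
    (('x::euclidean_space, complex) L2 \<Rightarrow>\<^sub>L ('x, complex) L2) \<Rightarrow> (('x, 's) L2 \<Rightarrow>\<^sub>L ('x, 's) L2)" where
  "op_tensor X R = (THE T :: ('x, 's) L2 \<Rightarrow>\<^sub>L ('x, 's) L2. \<forall>u f. T (u \<otimes>\<^sub>v f) = X u \<otimes>\<^sub>v R f)"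

text \<open>The partial trace over the probe, through its matrix elements
  $\langle u|\mathrm{Tr}_{Pr}[T]\,v\rangle = \sum_e \langle u\otimes e|T(v\otimes e)\rangle$, where
  $e$ runs through an orthonormal basis of $\mathcal{H}_{Pr}$\<close>

definition partial_trace :: "((real \<times> real, 's::{complex_inner, euclidean_space}) L2 \<Rightarrow>\<^sub>L (real \<times> real, 's) L2)
    \<Rightarrow> ((real, 's) L2 \<Rightarrow>\<^sub>L (real, 's) L2)" where
  "partial_trace T = (THE R :: (real, 's) L2 \<Rightarrow>\<^sub>L (real, 's) L2. \<forall>\<E> u v. orthonormal_basis \<E> \<longrightarrow>
     ((\<lambda>e. cinner (probe_tensor e u) (T (probe_tensor e v))) has_sum cinner u (R v)) \<E>)"


section \<open>Functions of a self-adjoint operator\<close>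

text \<open>Unbounded operators are represented by their graphs.\<close>

definition orthogonal_projection :: "('h::complex_inner \<Rightarrow>\<^sub>L 'h) \<Rightarrow> bool" where
  "orthogonal_projection P \<longleftrightarrow> self_adjoint P \<and> P o\<^sub>L P = P"

definition spectral_measure :: "(real set \<Rightarrow> ('h::complex_inner \<Rightarrow>\<^sub>L 'h)) \<Rightarrow> bool" where
  "spectral_measure E \<longleftrightarrow>
     (\<forall>S\<in>sets borel. orthogonal_projection (E S)) \<and> E UNIV = id_blinfun \<and>
     (\<forall>S x. range S \<subseteq> sets borel \<and> disjoint_family S \<longrightarrow>
        (\<lambda>n::nat. E (S n) x) sums E (\<Union>n. S n) x)"

text \<open>$S \mapsto \langle x|E(S)x\rangle = \|E(S)x\|^2$\<close>

definition scalar_spectral_measure :: "(real set \<Rightarrow> ('h::complex_inner \<Rightarrow>\<^sub>L 'h)) \<Rightarrow> 'h \<Rightarrow> real measure"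
  where "scalar_spectral_measure E x = measure_of UNIV (sets borel) (\<lambda>S. ennreal ((norm (E S x))\<^sup>2))"

text \<open>The graph of $\int g\,dE$: the value at $x$ is the limit of $\int s_n\,dE\,x$ for simple
  functions $s_n \to g$ in $L^2(\langle x|E(\cdot)x\rangle)$, and the domain consists of all $x$ with
  $g \in L^2(\langle x|E(\cdot)x\rangle)$.\<close>

definition spectral_integral ::
    "(real set \<Rightarrow> ('h::complex_inner \<Rightarrow>\<^sub>L 'h)) \<Rightarrow> (real \<Rightarrow> complex) \<Rightarrow> ('h \<times> 'h) set" where
  "spectral_integral E g = {(x, y). \<exists>s::nat \<Rightarrow> real \<Rightarrow> complex.
     (\<forall>n. simple_function borel (s n)) \<and>
     (\<lambda>n. \<integral>\<^sup>+t. ennreal ((cmod (s n t - g t))\<^sup>2) \<partial>scalar_spectral_measure E x) \<longlonglongrightarrow> 0 \<and>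
     (\<lambda>n. \<Sum>c\<in>range (s n). c *\<^sub>C E (s n -` {c}) x) \<longlonglongrightarrow> y}"

text \<open>\<open>U = g(H)\<close> in the functional calculus of the self-adjoint operator \<open>H\<close>, whose spectral
  measure is \<open>E\<close>\<close>

definition is_operator_function ::
    "('h::complex_inner \<times> 'h) set \<Rightarrow> (real \<Rightarrow> complex) \<Rightarrow> ('h \<Rightarrow>\<^sub>L 'h) \<Rightarrow> bool" where
  "is_operator_function H g U \<longleftrightarrow> (\<exists>E. spectral_measure E \<and>
     H = spectral_integral E complex_of_real \<and> {(x, U x) | x. True} = spectral_integral E g)"


section \<open>Trace norm\<close>

text \<open>$\|T\|_1 = \mathrm{Tr}|T| = \sup \sum_i |\langle e_i|T f_i\rangle|$ over finite orthonormal
  systems; the value is infinite if \<open>T\<close> is not trace class.\<close>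

definition trace_norm :: "('h::complex_inner \<Rightarrow>\<^sub>L 'h) \<Rightarrow> ennreal" where
  "trace_norm T = (SUP (n, e, f) \<in> {(n::nat, e, f). orthonormal_on {..<n} e \<and> orthonormal_on {..<n} f}.
     ennreal (\<Sum>i<n. cmod (cinner (e i) (T (f i)))))"

definition trace_class :: "('h::complex_inner \<Rightarrow>\<^sub>L 'h) \<Rightarrow> bool" where
  "trace_class T \<longleftrightarrow> complex_linear T \<and> trace_norm T < \<infinity>"

text \<open>The library's Bochner integral \<open>has_bochner_integral\<close>, with the operator norm replaced
  by the trace norm\<close>

definition has_trace_norm_integral ::
    "'a measure \<Rightarrow> ('a \<Rightarrow> ('h::complex_inner \<Rightarrow>\<^sub>L 'h)) \<Rightarrow> ('h \<Rightarrow>\<^sub>L 'h) \<Rightarrow> bool" where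
  "has_trace_norm_integral M f I \<longleftrightarrow> (\<exists>s::nat \<Rightarrow> 'a \<Rightarrow> ('h \<Rightarrow>\<^sub>L 'h).
     (\<forall>n. Bochner_Integration.simple_bochner_integrable M (s n) \<and> (\<forall>x\<in>space M. trace_class (s n x))) \<and>
     (AE x in M. (\<lambda>n. trace_norm (f x - s n x)) \<longlonglongrightarrow> 0) \<and>
     (\<lambda>n. \<integral>\<^sup>+x. trace_norm (f x - s n x) \<partial>M) \<longlonglongrightarrow> 0 \<and>
     (\<lambda>n. trace_norm (I - Bochner_Integration.simple_bochner_integral M (s n))) \<longlonglongrightarrow> 0)"


section \<open>Probe and pointer\<close>

text \<open>$\langle p|\Psi\rangle$; for $\Psi \in L^2$ the Fourier integral is a limit in mean.\<close>

definition momentum_wavefunction :: "real \<Rightarrow> (real, complex) L2 \<Rightarrow> (real, complex) L2" where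
  "momentum_wavefunction hbar \<Psi> = Lim at_top (\<lambda>R::real. L2_of (\<lambda>p.
     complex_of_real (1 / sqrt (2 * pi * hbar)) *
     (LINT q:{-R..R}|lborel. exp (- (\<i> * complex_of_real (p * q / hbar))) * L2_fun \<Psi> q)))"

definition momentum_limited :: "real \<Rightarrow> (real, complex) L2 \<Rightarrow> bool" where
  "momentum_limited \<kappa> \<psi> \<longleftrightarrow> 0 < \<kappa> \<and> (\<exists>g::real \<Rightarrow> complex.
     g \<in> borel_measurable lborel \<and> set_integrable lborel {-\<kappa><..<\<kappa>} (\<lambda>k. (cmod (g k))\<^sup>2) \<and>
     (AE x in lborel. L2_fun \<psi> x =
       (LINT k:{-\<kappa><..<\<kappa>}|lborel. exp (\<i> * complex_of_real (x * k)) * g k)))"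

text \<open>$e^{i\theta B}$, where $B$ is multiplication by $b$ on $L^2(\mathbb{R}, db)$\<close>

lift_definition exp_pointer_fun :: "real \<Rightarrow> (real, complex) L2 \<Rightarrow> (real, complex) L2" is
  "\<lambda>\<theta> \<Phi> b. exp (\<i> * complex_of_real (\<theta> * b)) * \<Phi> b"
  by (auto simp: L2_rel_def square_integrable_def norm_mult)

lift_definition exp_pointer :: "real \<Rightarrow> (real, complex) L2 \<Rightarrow>\<^sub>L (real, complex) L2" is exp_pointer_fun
proof (rule bounded_linear_intro[where K = 1])
  fix \<theta> r :: real and \<Phi> \<Phi>' :: "(real, complex) L2"
  have sq: "square_integrable (\<lambda>b. exp (\<i> * complex_of_real (\<theta> * b)) * f b)"
    if "square_integrable f" for \<theta> and f :: "real \<Rightarrow> complex"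
    using that by (auto simp: square_integrable_def norm_mult)
  show "exp_pointer_fun \<theta> (\<Phi> + \<Phi>') = exp_pointer_fun \<theta> \<Phi> + exp_pointer_fun \<theta> \<Phi>'"
    by transfer (simp add: L2_rel_def distrib_left square_integrable_add sq del: of_real_mult)
  show "exp_pointer_fun \<theta> (r *\<^sub>R \<Phi>) = r *\<^sub>R exp_pointer_fun \<theta> \<Phi>"
    by transfer (simp add: L2_rel_def square_integrable_scaleR sq del: of_real_mult)
  have "inner (exp_pointer_fun \<theta> \<Phi>) (exp_pointer_fun \<theta> \<Phi>) = inner \<Phi> \<Phi>"
    by transfer (simp add: dot_square_norm norm_mult)
  thus "norm (exp_pointer_fun \<theta> \<Phi>) \<le> norm \<Phi> * 1"
    by (simp add: norm_eq_sqrt_inner)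
qed


section \<open>The measurement coupling\<close>

text \<open>\<open>D i j\<close> is $\partial_q^i\partial_b^j f$.\<close>

definition schwartz :: "(real \<times> real \<Rightarrow> complex) \<Rightarrow> bool" where
  "schwartz f \<longleftrightarrow> (\<exists>D::nat \<Rightarrow> nat \<Rightarrow> real \<times> real \<Rightarrow> complex. D 0 0 = f \<and>
     (\<forall>i j x. (D i j has_derivative (\<lambda>(u, v). u *\<^sub>R D (Suc i) j x + v *\<^sub>R D i (Suc j) x)) (at x)) \<and>
     (\<forall>i j m n. bounded (range (\<lambda>(q, b). complex_of_real (q ^ m * b ^ n) * D i j (q, b)))))"

definition position_op :: "(real \<times> real \<Rightarrow> complex) \<Rightarrow> real \<times> real \<Rightarrow> complex" where
  "position_op f = (\<lambda>(q, b). complex_of_real q * f (q, b))"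

definition momentum_op :: "real \<Rightarrow> (real \<times> real \<Rightarrow> complex) \<Rightarrow> real \<times> real \<Rightarrow> complex" where
  "momentum_op hbar f = (\<lambda>(q, b). - \<i> * complex_of_real hbar * vector_derivative (\<lambda>t. f (t, b)) (at q))"

definition pointer_op :: "(real \<times> real \<Rightarrow> complex) \<Rightarrow> real \<times> real \<Rightarrow> complex" where
  "pointer_op f = (\<lambda>(q, b). complex_of_real b * f (q, b))"

text \<open>The graph of $\alpha A\otimes Q\otimes I + \beta I\otimes P\otimes B$ on the linear span of the
  vectors $\varphi_k\otimes f$ with $f$ a Schwartz function of $(q, b)$. Since the Schwartz functions
  form a vector space, that span consists of the sums $\sum_k \varphi_k\otimes f_k$.\<close>

definition coupling_graph :: "real \<Rightarrow> real \<Rightarrow> real \<Rightarrow> nat \<Rightarrow> (nat \<Rightarrow> 's::{complex_inner, euclidean_space}) \<Rightarrow>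
    ('s \<Rightarrow>\<^sub>L 's) \<Rightarrow> ((real \<times> real, 's) L2 \<times> (real \<times> real, 's) L2) set" where
  "coupling_graph hbar \<alpha> \<beta> N \<phi> A =
     {(\<Sum>k=1..N. \<phi> k \<otimes>\<^sub>v L2_of (f k),
       \<Sum>k=1..N. \<alpha> *\<^sub>R (A (\<phi> k) \<otimes>\<^sub>v L2_of (position_op (f k))) +
                 \<beta> *\<^sub>R (\<phi> k \<otimes>\<^sub>v L2_of (momentum_op hbar (pointer_op (f k))))) | f.
      \<forall>k\<in>{1..N}. schwartz (f k)}"

end

(*
  On the sector phi_k the coupling is alpha a_k Q + beta P B, whose flow is a shear in (q, b) times
  a linear phase:
    (U (phi_k (x) F)) (q, b) = phi_k (x) exp (- i (alpha a_k / hbar) (q - beta b / 2)) F (q - beta b, b).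
  For Gaussian wave packets F the flow stays inside the Schwartz core of the coupling, and a solution
  of the Schroedinger equation in the domain of a self-adjoint operator is unique; density extends
  the formula to all product states. If Psi is the inverse Fourier transform of a function g
  supported in [-kappa0, kappa0], then contracting the final state with a vector u of system and
  pointer gives a function of q that is again band-limited: its Fourier transform is a sum over k of
  terms supported in the translates of [-kappa0, kappa0] by - alpha a_k / hbar. The condition on
  alpha makes these translates disjoint, so by Plancherel's identity only the diagonal terms survive
  in the partial trace, and they are the matrix elements of rho_k.
*)
theory Submission
  imports Defs "HOL-Probability.Characteristic_Functions"
begin

section \<open>Complex inner product spaces\<close>

text \<open>The hypothesis on \<open>U\<close> only provides some spectral measure whose integrals
  are the closed coupling and its exponential; the link between \<open>U\<close> and the
  differential equation therefore has to be made spectrally, on cells of length \<delta>, with an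
  error linear in \<delta>. By its type \<open>U\<close> is bounded and real linear, and the
  argument is arranged around that: complex amplitudes sit inside the wave packets and, later,
  inside the probe vector, so that only sums and limits are pulled through \<open>U\<close>.
  \<open>partial_trace\<close> and \<open>op_tensor\<close> are definite descriptions and require
  uniqueness, the former through an explicit orthonormal basis of L^2 of the line. Fourier modes on
  the cells of a partition serve for this; on a single cell they also yield Plancherel's identity
  for functions of compact support, the only ones that are transformed. The states
  \<open>\<rho> k\<close> are first built from their matrix elements, which the partial trace
  computes, and then shown to be the trace-norm integral. The 2 in \<beta> = 2 lam / \<alpha>
  compensates the 1/2 in the phase of the sheared state.\<close>

lemma scaleC_bounded_bilinear: "bounded_bilinear (scaleC :: complex \<Rightarrow> 'a::complex_inner \<Rightarrow> 'a)"
proof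
  fix c c' :: complex and x y :: 'a and r :: real
  show "(r *\<^sub>R c) *\<^sub>C x = r *\<^sub>R (c *\<^sub>C x)"
    by (simp add: scaleR_conv_of_real flip: scaleC_of_real scaleC_scaleC)
  show "c *\<^sub>C (r *\<^sub>R x) = r *\<^sub>R (c *\<^sub>C x)"
    by (simp add: scaleC_scaleC mult.commute flip: scaleC_of_real)
  show "\<exists>K. \<forall>c (x::'a). norm (c *\<^sub>C x) \<le> norm c * norm x * K"
    by (rule exI[of _ 1]) (simp add: norm_scaleC)
qed (simp_all add: scaleC_add_right scaleC_add_left)

interpretation scaleC: bounded_bilinear "scaleC :: complex \<Rightarrow> 'a::complex_inner \<Rightarrow> 'a"
  by (rule scaleC_bounded_bilinear)

lemma cinner_bounded_bilinear:
  "bounded_bilinear (cinner :: 'a::complex_inner \<Rightarrow> 'a \<Rightarrow> complex)"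
proof
  fix x y z :: 'a and r :: real
  show "cinner (r *\<^sub>R x) y = r *\<^sub>R cinner x y"
    by (simp add: cinner_scaleC_left scaleR_conv_of_real flip: scaleC_of_real)
  show "cinner x (r *\<^sub>R y) = r *\<^sub>R cinner x y"
    by (simp add: cinner_scaleC_right scaleR_conv_of_real flip: scaleC_of_real)
  show "\<exists>K. \<forall>x y::'a. norm (cinner x y) \<le> norm x * norm y * K"
    by (rule exI[of _ 1]) (simp add: norm_cinner_le)
qed (simp_all add: cinner_add_right cinner_add_left)

interpretation cinner: bounded_bilinear "cinner :: 'a::complex_inner \<Rightarrow> 'a \<Rightarrow> complex"
  by (rule cinner_bounded_bilinear)

lemma scaleC_one [simp]: "1 *\<^sub>C (x::'a::complex_inner) = x"
  using scaleC_of_real[of 1 x] by simp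

lemma cinner_eqI:
  fixes x y :: "'a::complex_inner"
  assumes "\<And>u. cinner u x = cinner u y"
  shows "x = y"
proof -
  have "cinner (x - y) (x - y) = 0"
    using assms[of "x - y"] by (simp add: cinner.diff_right)
  thus ?thesis by (simp add: cinner_same)
qed

lemma blinfun_eq_cinnerI:
  fixes R R' :: "'a::complex_inner \<Rightarrow>\<^sub>L 'b::complex_inner"
  assumes "\<And>u v. cinner u (R v) = cinner u (R' v)"
  shows "R = R'"
  by (rule blinfun_eqI, rule cinner_eqI, rule assms)

lemma inner_eq_0_cinner: "cinner x y = 0 \<Longrightarrow> inner x (y::'a::complex_inner) = 0"
  by (simp flip: Re_cinner)

lemma norm_sum_Pythagorean_cinner:
  fixes f :: "'i \<Rightarrow> 'a::complex_inner"
  assumes "finite I" "\<And>i j. i \<in> I \<Longrightarrow> j \<in> I \<Longrightarrow> i \<noteq> j \<Longrightarrow> cinner (f i) (f j) = 0"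
  shows "(norm (\<Sum>i\<in>I. f i))\<^sup>2 = (\<Sum>i\<in>I. (norm (f i))\<^sup>2)"
  using assms
  by (intro norm_sum_Pythagorean) (auto simp: pairwise_def orthogonal_def intro: inner_eq_0_cinner)

text \<open>Pythagoras: the partial sum over \<open>F'\<close> differs from \<open>y\<close> by a
  vector orthogonal to the span of \<open>F'\<close>, and that span contains the competitor once
  \<open>c\<close> is extended by zero. Allowing \<open>F'\<close> to be larger than
  \<open>F\<close> is what a limit along the net of finite subsets requires.\<close>

lemma orthonormal_best_approximation:
  fixes y :: "'a::complex_inner"
  assumes S: "orthonormal_on S (\<lambda>e. e)" and F: "finite F'" "F' \<subseteq> S" "F \<subseteq> F'"
  shows "norm (y - (\<Sum>e\<in>F'. cinner e y *\<^sub>C e)) \<le> norm (y - (\<Sum>e\<in>F. c e *\<^sub>C e))"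
proof -
  define p where "p = (\<Sum>e\<in>F'. cinner e y *\<^sub>C e)"
  define c' where "c' e = (if e \<in> F then c e else 0)" for e
  have v: "(\<Sum>e\<in>F. c e *\<^sub>C e) = (\<Sum>e\<in>F'. c' e *\<^sub>C e)"
    using F by (intro sum.mono_neutral_cong_left) (auto simp: c'_def scaleC.zero_left)
  have orth: "cinner e (y - p) = 0" if "e \<in> F'" for e
  proof -
    have "cinner e p = (\<Sum>f\<in>F'. cinner f y * cinner e f)"
      by (simp add: p_def cinner.sum_right cinner_scaleC_right)
    also have "\<dots> = (\<Sum>f\<in>F'. if f = e then cinner e y else 0)"
      using S F that by (intro sum.cong) (auto simp: orthonormal_on_def subset_iff)
    also have "\<dots> = cinner e y" using F that by simp
    finally show ?thesis by (simp add: cinner.diff_right)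
  qed
  have "p - (\<Sum>e\<in>F'. c' e *\<^sub>C e) = (\<Sum>e\<in>F'. (cinner e y - c' e) *\<^sub>C e)"
    by (simp add: p_def scaleC.diff_left sum_subtractf)
  hence "cinner (p - (\<Sum>e\<in>F'. c' e *\<^sub>C e)) (y - p) = 0"
    by (simp add: cinner.sum_left cinner_scaleC_left orth)
  hence "orthogonal (y - p) (p - (\<Sum>e\<in>F'. c' e *\<^sub>C e))"
    by (subst orthogonal_commute) (simp add: orthogonal_def inner_eq_0_cinner)
  from norm_add_Pythagorean[OF this]
  have "(norm (y - (\<Sum>e\<in>F'. c' e *\<^sub>C e)))\<^sup>2
      = (norm (y - p))\<^sup>2 + (norm (p - (\<Sum>e\<in>F'. c' e *\<^sub>C e)))\<^sup>2"
    by simp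
  hence "(norm (y - p))\<^sup>2 \<le> (norm (y - (\<Sum>e\<in>F'. c' e *\<^sub>C e)))\<^sup>2" by simp
  thus ?thesis unfolding v p_def by (rule power2_le_imp_le) simp
qed

text \<open>Density supplies one finite combination close to \<open>y\<close>. By best approximation
  every partial sum over a larger finite set is at least as close, and Cauchy-Schwarz transfers the
  estimate to the pairing with \<open>x\<close>.\<close>

lemma parseval_has_sum:
  fixes x y :: "'a::complex_inner"
  assumes B: "orthonormal_basis B"
  shows "((\<lambda>e. cinner x e * cinner e y) has_sum cinner x y) B"
  unfolding has_sum_def tendsto_iff eventually_finite_subsets_at_top
proof (intro allI impI)
  fix \<epsilon> :: real assume "\<epsilon> > 0"
  \<comment> \<open>The added 1 keeps \<delta> meaningful for \<open>x = 0\<close> and makes the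
    final inequality strict.\<close>
  define \<delta> where "\<delta> = \<epsilon> / (norm x + 1)"
  have "\<delta> > 0" using \<open>\<epsilon> > 0\<close> by (simp add: \<delta>_def add_nonneg_pos)
  have "y \<in> closure (cspan B)" using B by (simp add: orthonormal_basis_def)
  then obtain v where "v \<in> cspan B" "dist v y < \<delta>"
    using closure_approachable \<open>\<delta> > 0\<close> by blast
  then obtain F c where F: "finite F" "F \<subseteq> B" and v: "norm (y - (\<Sum>e\<in>F. c e *\<^sub>C e)) < \<delta>"
    by (auto simp: cspan_def dist_norm norm_minus_commute)
  show "\<exists>F. finite F \<and> F \<subseteq> B \<and>
    (\<forall>Y. finite Y \<and> F \<subseteq> Y \<and> Y \<subseteq> B \<longrightarrow> dist (\<Sum>e\<in>Y. cinner x e * cinner e y) (cinner x y) < \<epsilon>)"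
  proof (intro exI[of _ F] conjI allI impI F)
    fix Y assume Y: "finite Y \<and> F \<subseteq> Y \<and> Y \<subseteq> B"
    have "dist (\<Sum>e\<in>Y. cinner x e * cinner e y) (cinner x y)
        = cmod (cinner x (y - (\<Sum>e\<in>Y. cinner e y *\<^sub>C e)))"
      by (simp add: dist_norm norm_minus_commute cinner.diff_right cinner.sum_right
          cinner_scaleC_right mult.commute)
    also have "\<dots> \<le> norm x * norm (y - (\<Sum>e\<in>Y. cinner e y *\<^sub>C e))" by (rule norm_cinner_le)
    also have "\<dots> \<le> norm x * \<delta>"
    proof (rule mult_left_mono)
      have "norm (y - (\<Sum>e\<in>Y. cinner e y *\<^sub>C e)) \<le> norm (y - (\<Sum>e\<in>F. c e *\<^sub>C e))"
        using B Y by (intro orthonormal_best_approximation[of B]) (auto simp: orthonormal_basis_def)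
      with v show "norm (y - (\<Sum>e\<in>Y. cinner e y *\<^sub>C e)) \<le> \<delta>" by simp
    qed simp
    also have "\<dots> < (norm x + 1) * \<delta>" using \<open>\<delta> > 0\<close> by simp
    also have "\<dots> = \<epsilon>"
      using norm_ge_zero[of x] unfolding \<delta>_def by (simp add: add_nonneg_eq_0_iff)
    finally show "dist (\<Sum>e\<in>Y. cinner x e * cinner e y) (cinner x y) < \<epsilon>" .
  qed
qed

section \<open>Spectral measures\<close>

text \<open>Operators are only real linear by their type; symmetry for the complex inner product
  forces complex linearity.\<close>

lemma self_adjoint_complex_linear:
  assumes "self_adjoint T"
  shows "T (c *\<^sub>C x) = c *\<^sub>C T x"
proof (rule cinner_eqI)
  fix u
  show "cinner u (T (c *\<^sub>C x)) = cinner u (c *\<^sub>C T x)"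
    using assms by (metis self_adjoint_def cinner_scaleC_right)
qed

context
  fixes E :: "real set \<Rightarrow> ('h::complex_inner \<Rightarrow>\<^sub>L 'h)"
  assumes E: "spectral_measure E"
begin

lemma spectral_self_adjoint: "S \<in> sets borel \<Longrightarrow> cinner x (E S y) = cinner (E S x) y"
  using E by (auto simp: spectral_measure_def orthogonal_projection_def self_adjoint_def)

lemma spectral_scaleC: "S \<in> sets borel \<Longrightarrow> E S (c *\<^sub>C y) = c *\<^sub>C E S y"
  using E by (auto simp: spectral_measure_def orthogonal_projection_def self_adjoint_complex_linear)

lemma spectral_idem: "S \<in> sets borel \<Longrightarrow> E S (E S x) = E S x"
  using E unfolding spectral_measure_def orthogonal_projection_def
  by (metis blinfun_apply_blinfun_compose)

lemma spectral_UNIV: "E UNIV x = x"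
  using E by (simp add: spectral_measure_def)

lemma spectral_sums:
  "range S \<subseteq> sets borel \<Longrightarrow> disjoint_family S \<Longrightarrow> (\<lambda>n::nat. E (S n) x) sums E (\<Union>n. S n) x"
  using E by (auto simp: spectral_measure_def)

lemma spectral_empty: "E {} x = 0"
proof -
  have "(\<lambda>n::nat. E {} x) sums E (\<Union>n::nat. {}) x"
    by (rule spectral_sums[of "\<lambda>_. {}"]) (auto simp: disjoint_family_on_def)
  hence "(\<lambda>n::nat. E {} x) \<longlonglongrightarrow> 0" using summable_LIMSEQ_zero sums_summable by blast
  thus ?thesis by (simp add: LIMSEQ_const_iff)
qed

lemma spectral_Un:
  assumes "S \<in> sets borel" "T \<in> sets borel" "S \<inter> T = {}"
  shows "E (S \<union> T) x = E S x + E T x"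
proof -
  define F where "F n = (if n = 0 then S else if n = 1 then T else {})" for n :: nat
  have "(\<lambda>n. E (F n) x) sums E (\<Union>n. F n) x"
    using assms by (intro spectral_sums) (auto simp: disjoint_family_on_def F_def)
  moreover have "(\<lambda>n. E (F n) x) sums (\<Sum>n\<in>{0,1}. E (F n) x)"
    by (rule sums_finite) (auto simp: F_def spectral_empty)
  moreover have "(\<Union>n. F n) = S \<union> T" by (force simp: F_def split: if_splits)
  ultimately show ?thesis by (auto simp: F_def dest: sums_unique2)
qed

text \<open>Multiplicativity of \<open>E\<close> has to be derived from additivity. Idempotence of
  the sum of the two projections makes them anticommute; applying one of them once more makes them
  commute as well, so twice their product is zero.\<close>

lemma spectral_disjoint:
  assumes "S \<in> sets borel" "T \<in> sets borel" "S \<inter> T = {}"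
  shows "E S (E T x) = 0"
proof -
  note add = spectral_Un[OF assms]
  have ac: "E S (E T z) + E T (E S z) = 0" for z
    using spectral_idem[of "S \<union> T" z] assms
    by (simp add: add blinfun.add_right spectral_idem add.commute)
  have "E S (E T x) + E S (E T (E S x)) = 0"
    using arg_cong[OF ac[of x], of "blinfun_apply (E S)"] assms
    by (simp add: blinfun.add_right blinfun.zero_right spectral_idem)
  moreover have "E S (E T (E S x)) + E T (E S x) = 0"
    using ac[of "E S x"] assms by (simp add: spectral_idem)
  ultimately have "E S (E T x) = E T (E S x)"
    by (metis add_right_cancel add.commute)
  with ac[of x] have "2 *\<^sub>R E S (E T x) = 0" by (simp add: scaleR_2)
  thus ?thesis by simp
qed

lemma spectral_Int:
  assumes "S \<in> sets borel" "T \<in> sets borel"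
  shows "E S (E T x) = E (S \<inter> T) x"
proof -
  have "E T x = E ((S \<inter> T) \<union> (T - S)) x"
    by (rule arg_cong[of _ _ "\<lambda>A. E A x"]) blast
  also have "\<dots> = E (S \<inter> T) x + E (T - S) x"
    using assms by (intro spectral_Un) auto
  finally have "E T x = E (S \<inter> T) x + E (T - S) x" .
  moreover have "E S (E (T - S) x) = 0" using assms by (intro spectral_disjoint) auto
  moreover have "E S (E (S \<inter> T) x) = E (S \<inter> T) x"
  proof -
    have "E S (E (S \<inter> T) x) = E ((S \<inter> T) \<union> (S - T)) (E (S \<inter> T) x)"
      by (rule arg_cong[of _ _ "\<lambda>A. E A (E (S \<inter> T) x)"]) blast
    also have "\<dots> = E (S \<inter> T) (E (S \<inter> T) x) + E (S - T) (E (S \<inter> T) x)"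
      using assms by (intro spectral_Un) auto
    finally have "E S (E (S \<inter> T) x) = E (S \<inter> T) (E (S \<inter> T) x) + E (S - T) (E (S \<inter> T) x)" .
    moreover have "E (S - T) (E (S \<inter> T) x) = 0" using assms by (intro spectral_disjoint) auto
    ultimately show ?thesis using assms by (simp add: spectral_idem)
  qed
  ultimately show ?thesis by (simp add: blinfun.add_right)
qed

lemma spectral_orthogonal:
  assumes "S \<in> sets borel" "T \<in> sets borel" "S \<inter> T = {}"
  shows "cinner (E S x) (E T y) = 0"
  using assms by (simp add: spectral_disjoint cinner.zero_right flip: spectral_self_adjoint)

lemma spectral_norm_sq: "S \<in> sets borel \<Longrightarrow> (norm (E S x))\<^sup>2 = inner x (E S x)"
  by (simp add: power2_norm_eq_inner flip: Re_cinner)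
     (simp add: spectral_self_adjoint[symmetric] spectral_idem)

text \<open>The squared norm equals \<open>inner x (E S x)\<close>, which is linear in
  \<open>E S x\<close>, so countable additivity passes from the vectors to the squared
  norms.\<close>

lemma spectral_norm_sums:
  assumes "range S \<subseteq> sets borel" "disjoint_family S"
  shows "(\<lambda>n::nat. (norm (E (S n) x))\<^sup>2) sums (norm (E (\<Union>n. S n) x))\<^sup>2"
proof -
  have "S n \<in> sets borel" for n using assms by auto
  moreover have "(\<lambda>n. inner x (E (S n) x)) sums inner x (E (\<Union>n. S n) x)"
    by (intro bounded_linear.sums[OF bounded_linear_inner_right] spectral_sums assms)
  ultimately show ?thesis by (simp add: spectral_norm_sq)
qed

lemma spectral_finite_Union:
  assumes "finite I" "\<And>i. i \<in> I \<Longrightarrow> S i \<in> sets borel"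
    "\<And>i j. i \<in> I \<Longrightarrow> j \<in> I \<Longrightarrow> i \<noteq> j \<Longrightarrow> S i \<inter> S j = {}"
  shows "E (\<Union>i\<in>I. S i) x = (\<Sum>i\<in>I. E (S i) x)"
  using assms
proof (induction I)
  case (insert i I)
  have "E (S i \<union> (\<Union>i\<in>I. S i)) x = E (S i) x + E (\<Union>i\<in>I. S i) x"
    using insert by (intro spectral_Un) (auto 4 3)
  with insert show ?case by simp
qed (simp add: spectral_empty)

lemma emeasure_scalar_spectral_measure:
  assumes "S \<in> sets borel"
  shows "emeasure (scalar_spectral_measure E x) S = ennreal ((norm (E S x))\<^sup>2)"
  unfolding scalar_spectral_measure_def
proof (rule emeasure_measure_of_sigma)
  show "sigma_algebra UNIV (sets (borel::real measure))"
    using sets.sigma_algebra_axioms[of "borel::real measure"] by simp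
  show "positive (sets borel) (\<lambda>S. ennreal ((norm (E S x))\<^sup>2))"
    by (simp add: positive_def spectral_empty)
  show "countably_additive (sets borel) (\<lambda>S. ennreal ((norm (E S x))\<^sup>2))"
    unfolding countably_additive_def
  proof (intro allI impI)
    fix F :: "nat \<Rightarrow> real set" assume "range F \<subseteq> sets borel" "disjoint_family F"
    from spectral_norm_sums[OF this, of x]
    show "(\<Sum>i. ennreal ((norm (E (F i) x))\<^sup>2)) = ennreal ((norm (E (\<Union> (range F)) x))\<^sup>2)"
      by (simp add: suminf_ennreal2 sums_iff)
  qed
qed (use assms in simp)

lemma sets_scalar_spectral_measure [measurable_cong]:
  "sets (scalar_spectral_measure E x) = sets borel"
  unfolding scalar_spectral_measure_def
  by (metis sets.sets_measure_of_eq space_borel)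

text \<open>The projections of \<open>x\<close> belonging to the parts of \<open>S\<close> on which
  \<open>s\<close> is constant are mutually orthogonal, so Pythagoras turns the squared norm into an
  integral over \<open>S\<close>. The constant \<open>c\<close> can be subtracted under the sum
  because these parts exhaust \<open>S\<close>.\<close>

lemma spectral_simple_integral_localized:
  assumes s: "simple_function borel s" and S: "S \<in> sets borel"
  shows "ennreal ((norm (E S (\<Sum>z\<in>range s. z *\<^sub>C E (s -` {z}) x) - c *\<^sub>C E S x))\<^sup>2)
    = (\<integral>\<^sup>+t. ennreal ((cmod (s t - c))\<^sup>2) * indicator S t \<partial>scalar_spectral_measure E x)"
proof -
  have fin: "finite (range s)" using simple_functionD(1)[OF s] by simp
  have m: "s -` {z} \<in> sets borel" for z using simple_functionD(2)[OF s, of "{z}"] by simp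
  have m': "S \<inter> s -` {z} \<in> sets borel" for z using m S by auto
  have "E S x = E (\<Union>z\<in>range s. S \<inter> s -` {z}) x"
    by (rule arg_cong[of _ _ "\<lambda>A. E A x"]) auto
  also have "\<dots> = (\<Sum>z\<in>range s. E (S \<inter> s -` {z}) x)"
    by (intro spectral_finite_Union fin m') auto
  finally have "E S (\<Sum>z\<in>range s. z *\<^sub>C E (s -` {z}) x) - c *\<^sub>C E S x
      = (\<Sum>z\<in>range s. (z - c) *\<^sub>C E (S \<inter> s -` {z}) x)"
    by (simp add: blinfun.sum_right spectral_scaleC S spectral_Int m scaleC.diff_left
        scaleC.sum_right sum_subtractf)
  hence "(norm (E S (\<Sum>z\<in>range s. z *\<^sub>C E (s -` {z}) x) - c *\<^sub>C E S x))\<^sup>2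
      = (\<Sum>z\<in>range s. (norm ((z - c) *\<^sub>C E (S \<inter> s -` {z}) x))\<^sup>2)"
    using fin m'
    by (simp only:) (intro norm_sum_Pythagorean_cinner, auto simp: cinner_scaleC_left
        cinner_scaleC_right intro!: spectral_orthogonal)
  also have "\<dots> = (\<Sum>z\<in>range s. (cmod (z - c))\<^sup>2 * (norm (E (S \<inter> s -` {z}) x))\<^sup>2)"
    by (simp add: norm_scaleC power_mult_distrib)
  also have "ennreal \<dots> = (\<Sum>z\<in>range s. ennreal ((cmod (z - c))\<^sup>2) *
      emeasure (scalar_spectral_measure E x) (S \<inter> s -` {z}))"
    by (simp add: emeasure_scalar_spectral_measure m' flip: ennreal_mult sum_ennreal)
  also have "\<dots> = (\<integral>\<^sup>+t. (\<Sum>z\<in>range s. ennreal ((cmod (z - c))\<^sup>2) * indicator (S \<inter> s -` {z}) t)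
      \<partial>scalar_spectral_measure E x)"
    using m' by (subst nn_integral_sum)
      (auto simp: nn_integral_cmult_indicator sets_scalar_spectral_measure)
  also have "\<dots> = (\<integral>\<^sup>+t. ennreal ((cmod (s t - c))\<^sup>2) * indicator S t \<partial>scalar_spectral_measure E x)"
  proof (rule nn_integral_cong)
    fix t
    have "(\<Sum>z\<in>range s. ennreal ((cmod (z - c))\<^sup>2) * indicator (S \<inter> s -` {z}) t)
        = (\<Sum>z\<in>range s. if z = s t then ennreal ((cmod (s t - c))\<^sup>2) * indicator S t else 0)"
      by (intro sum.cong) (auto simp: indicator_def)
    also have "\<dots> = ennreal ((cmod (s t - c))\<^sup>2) * indicator S t"
      using fin by simp
    finally show "(\<Sum>z\<in>range s. ennreal ((cmod (z - c))\<^sup>2) * indicator (S \<inter> s -` {z}) t)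
        = ennreal ((cmod (s t - c))\<^sup>2) * indicator S t" .
  qed
  finally show ?thesis .
qed

text \<open>On the range of \<open>E S\<close> the spectral integral of \<open>g\<close> nearly acts
  as the scalar \<open>c\<close>. The simple approximants converge to \<open>g\<close> only in the
  mean, so the bound comes from splitting |s - c|^2 into 2 |s - g|^2 + 2 d^2; the resulting factor
  sqrt 2 is rounded up to 2.\<close>

lemma spectral_integral_localized:
  assumes xy: "(x, y) \<in> spectral_integral E g" and g: "g \<in> borel_measurable borel"
    and S: "S \<in> sets borel" and d: "\<And>t. t \<in> S \<Longrightarrow> cmod (g t - c) \<le> d" and "d \<ge> 0"
  shows "norm (E S y - c *\<^sub>C E S x) \<le> 2 * d * norm (E S x)"
proof -
  let ?\<mu> = "scalar_spectral_measure E x"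
  obtain s :: "nat \<Rightarrow> real \<Rightarrow> complex" where s: "\<And>n. simple_function borel (s n)"
    and lim: "(\<lambda>n. \<integral>\<^sup>+t. ennreal ((cmod (s n t - g t))\<^sup>2) \<partial>?\<mu>) \<longlonglongrightarrow> 0"
    and y: "(\<lambda>n. \<Sum>z\<in>range (s n). z *\<^sub>C E (s n -` {z}) x) \<longlonglongrightarrow> y"
    using xy by (auto simp: spectral_integral_def)
  have [measurable]: "s n \<in> borel_measurable borel" "g \<in> borel_measurable borel"
      "S \<in> sets borel" for n
    using s g S by (auto intro: borel_measurable_simple_function)
  let ?Y = "\<lambda>n. \<Sum>z\<in>range (s n). z *\<^sub>C E (s n -` {z}) x"
  have "ennreal ((norm (E S (?Y n) - c *\<^sub>C E S x))\<^sup>2)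
      \<le> 2 * (\<integral>\<^sup>+t. ennreal ((cmod (s n t - g t))\<^sup>2) \<partial>?\<mu>)
        + ennreal (2 * d\<^sup>2) * ennreal ((norm (E S x))\<^sup>2)" for n
  proof -
    have "(\<integral>\<^sup>+t. ennreal ((cmod (s n t - c))\<^sup>2) * indicator S t \<partial>?\<mu>)
        \<le> (\<integral>\<^sup>+t. 2 * ennreal ((cmod (s n t - g t))\<^sup>2) + ennreal (2 * d\<^sup>2) * indicator S t \<partial>?\<mu>)"
    proof (rule nn_integral_mono)
      fix t
      have "(cmod (s n t - c))\<^sup>2 \<le> 2 * (cmod (s n t - g t))\<^sup>2 + 2 * d\<^sup>2" if "t \<in> S"
      proof -
        have "cmod (s n t - c) \<le> cmod (s n t - g t) + cmod (g t - c)"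
          using norm_triangle_ineq[of "s n t - g t" "g t - c"] by simp
        also have "\<dots> \<le> cmod (s n t - g t) + d" using d[OF that] by simp
        finally have "(cmod (s n t - c))\<^sup>2 \<le> (cmod (s n t - g t) + d)\<^sup>2"
          by (rule power_mono) simp
        also have "\<dots> \<le> 2 * (cmod (s n t - g t))\<^sup>2 + 2 * d\<^sup>2"
          using sum_squares_bound[of "cmod (s n t - g t)" d] by (simp add: power2_sum)
        finally show ?thesis .
      qed
      hence "t \<in> S \<Longrightarrow> ennreal ((cmod (s n t - c))\<^sup>2)
          \<le> 2 * ennreal ((cmod (s n t - g t))\<^sup>2) + ennreal (2 * d\<^sup>2)"
        by (simp add: ennreal_leI flip: ennreal_plus ennreal_mult'' ennreal_numeral)
      thus "ennreal ((cmod (s n t - c))\<^sup>2) * indicator S t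
          \<le> 2 * ennreal ((cmod (s n t - g t))\<^sup>2) + ennreal (2 * d\<^sup>2) * indicator S t"
        by (auto simp: indicator_def)
    qed
    also have "\<dots> = 2 * (\<integral>\<^sup>+t. ennreal ((cmod (s n t - g t))\<^sup>2) \<partial>?\<mu>)
        + ennreal (2 * d\<^sup>2) * ennreal ((norm (E S x))\<^sup>2)"
      using S by (simp add: nn_integral_add nn_integral_cmult nn_integral_cmult_indicator
          sets_scalar_spectral_measure emeasure_scalar_spectral_measure)
    finally show ?thesis using spectral_simple_integral_localized[OF s S] by simp
  qed
  moreover have "(\<lambda>n. ennreal ((norm (E S (?Y n) - c *\<^sub>C E S x))\<^sup>2))
      \<longlonglongrightarrow> ennreal ((norm (E S y - c *\<^sub>C E S x))\<^sup>2)"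
    by (intro tendsto_intros tendsto_ennrealI bounded_linear.tendsto[OF blinfun.bounded_linear_right] y)
  moreover have "(\<lambda>n. 2 * (\<integral>\<^sup>+t. ennreal ((cmod (s n t - g t))\<^sup>2) \<partial>?\<mu>)
        + ennreal (2 * d\<^sup>2) * ennreal ((norm (E S x))\<^sup>2))
      \<longlonglongrightarrow> 2 * 0 + ennreal (2 * d\<^sup>2) * ennreal ((norm (E S x))\<^sup>2)"
    by (intro tendsto_add tendsto_const ennreal_tendsto_cmult lim) auto
  ultimately have "ennreal ((norm (E S y - c *\<^sub>C E S x))\<^sup>2)
      \<le> 2 * 0 + ennreal (2 * d\<^sup>2) * ennreal ((norm (E S x))\<^sup>2)"
    by (intro LIMSEQ_le[of "\<lambda>n. ennreal ((norm (E S (?Y n) - c *\<^sub>C E S x))\<^sup>2)"]) auto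
  hence "(norm (E S y - c *\<^sub>C E S x))\<^sup>2 \<le> 2 * d\<^sup>2 * (norm (E S x))\<^sup>2"
    by (simp flip: ennreal_mult)
  also have "\<dots> \<le> (2 * d * norm (E S x))\<^sup>2" by (simp add: power_mult_distrib)
  finally show ?thesis by (rule power2_le_imp_le) (simp add: \<open>d \<ge> 0\<close>)
qed

text \<open>The cells partition the line, so the squared norms of the projections of a vector add up
  to its squared norm, and an estimate on each cell becomes global without loss.\<close>

lemma spectral_cells_norm_le:
  assumes "\<delta> > 0" "K \<ge> 0"
    and le: "\<And>j::int. norm (E {of_int j * \<delta>..<of_int (j + 1) * \<delta>} z)
      \<le> K * norm (E {of_int j * \<delta>..<of_int (j + 1) * \<delta>} x)"
  shows "norm z \<le> K * norm x"
proof -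
  \<comment> \<open>\<open>int_decode\<close> lists the cells as a sequence, the form in which
    countable additivity is stated.\<close>
  define S where "S n = {of_int (int_decode n) * \<delta>..<of_int (int_decode n + 1) * \<delta>}" for n :: nat
  have floor: "t \<in> S n \<longleftrightarrow> \<lfloor>t / \<delta>\<rfloor> = int_decode n" for t n
    using \<open>\<delta> > 0\<close> by (auto simp: S_def floor_eq_iff field_simps)
  have disj: "disjoint_family S"
    unfolding disjoint_family_on_def by (auto simp: floor) (metis int_decode_eq)
  have un: "(\<Union>n. S n) = UNIV"
  proof -
    have "t \<in> S (int_encode \<lfloor>t / \<delta>\<rfloor>)" for t by (simp add: floor)
    thus ?thesis by blast
  qed
  have b: "range S \<subseteq> sets borel" by (auto simp: S_def)
  have "(\<lambda>n. (norm (E (S n) v))\<^sup>2) sums (norm v)\<^sup>2" for v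
    using spectral_norm_sums[OF b disj, of v] by (simp add: un spectral_UNIV)
  from this[of z] sums_mult[OF this[of x], of "K\<^sup>2"]
  have "(norm z)\<^sup>2 \<le> K\<^sup>2 * (norm x)\<^sup>2"
  proof (rule sums_le[rotated])
    fix n
    have "(norm (E (S n) z))\<^sup>2 \<le> (K * norm (E (S n) x))\<^sup>2"
      unfolding S_def by (intro power_mono le) simp
    thus "(norm (E (S n) z))\<^sup>2 \<le> K\<^sup>2 * (norm (E (S n) x))\<^sup>2" by (simp add: power_mult_distrib)
  qed
  hence "(norm z)\<^sup>2 \<le> (K * norm x)\<^sup>2" by (simp add: power_mult_distrib)
  thus ?thesis by (rule power2_le_imp_le) (simp add: \<open>K \<ge> 0\<close>)
qed

end

section \<open>Uniqueness of the Schroedinger evolution\<close>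

lemma norm_exp_ii_diff_le: "cmod (iexp s - iexp t) \<le> \<bar>s - t\<bar>"
proof -
  have "norm (iexp s - iexp t) \<le> 1 * norm (s - t)"
  proof (rule differentiable_bound[of UNIV "\<lambda>s. iexp s"
        "\<lambda>s h. h *\<^sub>R (\<i> * iexp s)"])
    fix s :: real
    have "((\<lambda>s. iexp s) has_vector_derivative \<i> * iexp s) (at s)"
      by (rule has_vector_derivative_real_field) (auto intro!: derivative_eq_intros)
    thus "((\<lambda>s. iexp s) has_derivative
        (\<lambda>h. h *\<^sub>R (\<i> * iexp s))) (at s within UNIV)"
      by (simp add: has_vector_derivative_def)
    show "onorm (\<lambda>h. h *\<^sub>R (\<i> * iexp s)) \<le> 1"
      by (rule onorm_le) (simp add: norm_mult)
  qed auto
  thus ?thesis by simp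
qed

text \<open>On the range of the spectral projection of a short interval around \<open>c\<close>, both the
  trajectory and \<open>U\<close> differ little from multiplication by \<open>exp (- \<i> c t / hbar)\<close>. The errors are
  square summable over a partition of the line into such intervals.\<close>

lemma evolution_unique:
  fixes x y :: "real \<Rightarrow> 'h::complex_inner"
  assumes U: "is_operator_function H (\<lambda>t. exp (- (\<i> / complex_of_real hbar) * complex_of_real t)) U"
    and "hbar > 0"
    and H: "\<And>t. t \<in> {0..1} \<Longrightarrow> (x t, y t) \<in> H"
    and der: "\<And>t. t \<in> {0..1} \<Longrightarrow>
      (x has_vector_derivative (- (\<i> / complex_of_real hbar)) *\<^sub>C y t) (at t within {0..1})"
  shows "U (x 0) = x 1"
proof -
  define G where "G t = exp (- (\<i> / complex_of_real hbar) * complex_of_real t)" for t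
  obtain E where E: "spectral_measure E" and HE: "H = spectral_integral E complex_of_real"
    and UE: "{(x, U x) | x. True} = spectral_integral E G"
    using U by (auto simp: is_operator_function_def G_def[abs_def])
  have G: "G t = iexp (- t / hbar)" for t
    by (simp add: G_def field_simps)
  have G_diff: "cmod (G s - G t) \<le> \<bar>s - t\<bar> / hbar" for s t
    using norm_exp_ii_diff_le[of "- s / hbar" "- t / hbar"] \<open>hbar > 0\<close>
    by (simp add: G minus_divide_left[symmetric] diff_divide_distrib[symmetric] abs_minus_commute)
  have Gm: "G \<in> borel_measurable borel"
    unfolding G_def by measurable
  \<comment> \<open>The 6 is 2 for the distance between \<open>U\<close> and the phase
    \<open>G c\<close> plus 4 for the distance between the trajectory and that phase. The second
    condition on \<delta> serves to absorb a maximum below.\<close>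
  have small: "norm (U (x 0) - x 1) \<le> (6 * \<delta> / hbar) * norm (x 0)" if \<delta>: "\<delta> > 0" "2 * \<delta> / hbar \<le> 1 / 2" for \<delta>
  proof (rule spectral_cells_norm_le[OF E \<delta>(1)])
    show "0 \<le> 6 * \<delta> / hbar" using \<delta> \<open>hbar > 0\<close> by simp
    fix j :: int
    define c where "c = of_int j * \<delta>"
    define S where "S = {of_int j * \<delta>..<of_int (j + 1) * \<delta>}"
    have S: "S \<in> sets borel" by (simp add: S_def)
    have near: "\<bar>t - c\<bar> \<le> \<delta>" if "t \<in> S" for t
      using that by (auto simp: S_def c_def algebra_simps)
    \<comment> \<open>Interaction picture: removing the phase of the value \<open>c\<close> leaves a
      path whose derivative is of order \<delta>.\<close>
    define w where "w t = iexp (c * t / hbar) *\<^sub>C E S (x t)" for t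
    define w' where "w' t = iexp (c * t / hbar) *\<^sub>C
      ((- (\<i> / complex_of_real hbar)) *\<^sub>C (E S (y t) - complex_of_real c *\<^sub>C E S (x t)))" for t
    have wder: "(w has_vector_derivative w' t) (at t within {0..1})" if "t \<in> {0..1}" for t
    proof -
      have 1: "((\<lambda>t. iexp (c * t / hbar)) has_vector_derivative
          (\<i> * complex_of_real c / complex_of_real hbar) * iexp (c * t / hbar))
          (at t within {0..1})"
      proof (rule has_vector_derivative_at_within)
        have "((\<lambda>z. exp (\<i> * complex_of_real c * z / complex_of_real hbar)) has_field_derivative
          (\<i> * complex_of_real c / complex_of_real hbar) * exp (\<i> * complex_of_real c * complex_of_real t / complex_of_real hbar))
            (at (complex_of_real t))"
          using \<open>hbar > 0\<close> by (auto intro!: derivative_eq_intros)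
        from has_vector_derivative_real_field[OF this]
        show "((\<lambda>t. iexp (c * t / hbar)) has_vector_derivative
          (\<i> * complex_of_real c / complex_of_real hbar) * iexp (c * t / hbar)) (at t)"
          by (simp add: mult.assoc)
      qed
      have 2: "((\<lambda>t. E S (x t)) has_vector_derivative E S ((- (\<i> / complex_of_real hbar)) *\<^sub>C y t))
          (at t within {0..1})"
        by (rule bounded_linear.has_vector_derivative[OF blinfun.bounded_linear_right der[OF that]])
      from bounded_bilinear.has_vector_derivative[OF scaleC_bounded_bilinear 1 2]
      show ?thesis
        by (simp add: w_def[abs_def] w'_def spectral_scaleC[OF E S] scaleC_scaleC scaleC.diff_right
            algebra_simps scaleC.minus_left scaleC.minus_right blinfun.minus_right)
    qed
    have w'_le: "norm (w' t) \<le> (2 * \<delta> / hbar) * norm (w t)" if "t \<in> {0..1}" for t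
    proof -
      have "norm (E S (y t) - complex_of_real c *\<^sub>C E S (x t)) \<le> 2 * \<delta> * norm (E S (x t))"
        using H[OF that] near \<delta> unfolding HE
        by (intro spectral_integral_localized[OF E _ _ S, where g = complex_of_real])
           (auto simp flip: of_real_diff)
      thus ?thesis using \<open>hbar > 0\<close>
        by (simp add: w'_def w_def norm_scaleC norm_divide divide_right_mono)
    qed
    have "continuous_on {0..1} w"
      unfolding continuous_on_eq_continuous_within
      by (intro ballI has_vector_derivative_continuous[OF wder])
    hence "continuous_on {0..1} (\<lambda>t. norm (w t))" by (intro continuous_intros)
    \<comment> \<open>Comparing with the maximum of the norm of \<open>w\<close> takes the place of
      Gronwall's inequality.\<close>
    from continuous_attains_sup[OF _ _ this]
    obtain t0 where t0: "t0 \<in> {0..1}" "\<And>t. t \<in> {0..1} \<Longrightarrow> norm (w t) \<le> norm (w t0)"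
      by auto
    have diff: "norm (w t - w 0) \<le> (2 * \<delta> / hbar) * norm (w t0)" if "t \<in> {0..1}" for t
    proof -
      have "norm (w t - w 0) \<le> ((2 * \<delta> / hbar) * norm (w t0)) * norm (t - 0)"
      proof (rule differentiable_bound[of "{0..1}" w "\<lambda>s h. h *\<^sub>R w' s"])
        fix s :: real assume s: "s \<in> {0..1}"
        show "(w has_derivative (\<lambda>h. h *\<^sub>R w' s)) (at s within {0..1})"
          using wder[OF s] by (simp add: has_vector_derivative_def)
        have "norm (w' s) \<le> (2 * \<delta> / hbar) * norm (w t0)"
          using w'_le[OF s] mult_left_mono[OF t0(2)[OF s], of "2 * \<delta> / hbar"] \<delta> \<open>hbar > 0\<close>
          by simp
        thus "onorm (\<lambda>h. h *\<^sub>R w' s) \<le> (2 * \<delta> / hbar) * norm (w t0)"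
        proof (intro onorm_le)
          fix h :: real
          assume "norm (w' s) \<le> (2 * \<delta> / hbar) * norm (w t0)"
          from mult_right_mono[OF this, of "norm h"]
          show "norm (h *\<^sub>R w' s) \<le> (2 * \<delta> / hbar) * norm (w t0) * norm h"
            by (simp add: mult.commute)
        qed
      qed (use that in auto)
      also have "\<dots> \<le> ((2 * \<delta> / hbar) * norm (w t0)) * 1"
        using that \<delta> \<open>hbar > 0\<close> by (intro mult_left_mono) auto
      finally show ?thesis by simp
    qed
    have "norm (w t0) \<le> norm (w 0) + norm (w t0 - w 0)"
      using norm_triangle_ineq[of "w 0" "w t0 - w 0"] by simp
    \<comment> \<open>The smallness of \<delta> lets the maximum be absorbed into the left-hand
      side.\<close>
    also have "norm (w t0 - w 0) \<le> (1 / 2) * norm (w t0)"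
      using diff[OF t0(1)] mult_right_mono[OF \<delta>(2), of "norm (w t0)"] by simp
    finally have M: "norm (w t0) \<le> 2 * norm (w 0)" by simp
    have "norm (w 1 - w 0) \<le> (2 * \<delta> / hbar) * norm (w t0)" by (rule diff) simp
    also have "\<dots> \<le> (2 * \<delta> / hbar) * (2 * norm (w 0))"
      using M \<delta> \<open>hbar > 0\<close> by (intro mult_left_mono) auto
    finally have w10: "norm (w 1 - w 0) \<le> (4 * \<delta> / hbar) * norm (E S (x 0))"
      by (simp add: w_def)
    have "norm (E S (x 1) - G c *\<^sub>C E S (x 0)) = norm (w 1 - w 0)"
    proof -
      have "E S (x 1) - G c *\<^sub>C E S (x 0) = G c *\<^sub>C (w 1 - w 0)"
        by (simp add: w_def G scaleC.diff_right scaleC_scaleC flip: exp_add)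
      thus ?thesis by (simp add: norm_scaleC G)
    qed
    moreover have "norm (E S (U (x 0)) - G c *\<^sub>C E S (x 0)) \<le> 2 * (\<delta> / hbar) * norm (E S (x 0))"
    proof (rule spectral_integral_localized[OF E _ Gm S])
      show "(x 0, U (x 0)) \<in> spectral_integral E G" using UE by blast
      show "cmod (G t - G c) \<le> \<delta> / hbar" if "t \<in> S" for t
        using G_diff[of t c] near[OF that] \<open>hbar > 0\<close>
        by (meson divide_right_mono dual_order.trans less_imp_le)
    qed (use \<delta> \<open>hbar > 0\<close> in auto)
    moreover have "norm (E S (U (x 0) - x 1)) \<le> norm (E S (U (x 0)) - G c *\<^sub>C E S (x 0))
        + norm (E S (x 1) - G c *\<^sub>C E S (x 0))"
      using norm_triangle_ineq4[of "E S (U (x 0)) - G c *\<^sub>C E S (x 0)" "E S (x 1) - G c *\<^sub>C E S (x 0)"]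
      by (simp add: blinfun.diff_right)
    ultimately have "norm (E S (U (x 0) - x 1)) \<le>
        2 * (\<delta> / hbar) * norm (E S (x 0)) + (4 * \<delta> / hbar) * norm (E S (x 0))"
      using w10 by linarith
    thus "norm (E {of_int j * \<delta>..<of_int (j + 1) * \<delta>} (U (x 0) - x 1))
      \<le> 6 * \<delta> / hbar * norm (E {of_int j * \<delta>..<of_int (j + 1) * \<delta>} (x 0))"
      by (simp add: S_def algebra_simps add_divide_distrib)
  qed
  \<comment> \<open>The left-hand side does not depend on \<delta>, so the bound survives the limit
    at 0.\<close>
  have "norm (U (x 0) - x 1) \<le> 0"
  proof (rule tendsto_lowerbound)
    show "((\<lambda>\<delta>. (6 * \<delta> / hbar) * norm (x 0)) \<longlongrightarrow> 0) (at_right 0)"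
      using \<open>hbar > 0\<close> by (auto intro!: tendsto_eq_intros)
    have "\<forall>\<^sub>F \<delta> in at_right 0. \<delta> \<in> {0<..<hbar / 4}"
      by (rule eventually_at_right_real) (use \<open>hbar > 0\<close> in simp)
    thus "\<forall>\<^sub>F \<delta> in at_right 0. norm (U (x 0) - x 1) \<le> (6 * \<delta> / hbar) * norm (x 0)"
      by eventually_elim (use \<open>hbar > 0\<close> in \<open>intro small, auto simp: field_simps\<close>)
  qed simp
  thus ?thesis by simp
qed

section \<open>Square-integrable functions\<close>

lemma L2_rel_refl [simp]: "L2_rel f f \<longleftrightarrow> square_integrable f"
  by (simp add: L2_rel_def)

lemma square_integrable_measurable: "square_integrable f \<Longrightarrow> f \<in> borel_measurable borel"
  by (simp add: square_integrable_def)

lemma L2_rel_L2_fun: "L2_rel (L2_fun f) (L2_fun f)"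
  by (rule Quotient_rep_reflp[OF Quotient_L2])

lemma square_integrable_L2_fun [simp]: "square_integrable (L2_fun f)"
  using L2_rel_L2_fun[of f] by simp

lemma L2_fun_measurable [measurable]: "L2_fun f \<in> borel_measurable borel"
  using square_integrable_L2_fun by (rule square_integrable_measurable)

lemma L2_of_L2_fun [simp]: "L2_of (L2_fun f) = f"
  by (rule Quotient_abs_rep[OF Quotient_L2])

lemma L2_fun_L2_of:
  assumes "square_integrable f"
  shows "AE x in lborel. L2_fun (L2_of f) x = f x"
proof -
  have "L2_rel (L2_fun (L2_of f)) f"
    using Quotient_rep_abs[OF Quotient_L2, of f] assms by simp
  thus ?thesis by (simp add: L2_rel_def)
qed

lemma L2_of_eqI:
  assumes "square_integrable f" "square_integrable g" "AE x in lborel. f x = g x"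
  shows "L2_of f = L2_of g"
  using Quotient_rel_abs[OF Quotient_L2, of f g] assms by (simp add: L2_rel_def)

lemma L2_of_add:
  "square_integrable f \<Longrightarrow> square_integrable g \<Longrightarrow> L2_of f + L2_of g = L2_of (\<lambda>x. f x + g x)"
  by (rule plus_L2.abs_eq) auto

lemma L2_of_scaleC: "square_integrable f \<Longrightarrow> c *\<^sub>C L2_of f = L2_of (\<lambda>x. c *\<^sub>C f x)"
  by (rule scaleC_L2.abs_eq) auto

lemma L2_of_scaleR: "square_integrable f \<Longrightarrow> c *\<^sub>R L2_of f = L2_of (\<lambda>x. c *\<^sub>R f x)"
  by (rule scaleR_L2.abs_eq) auto

lemma square_integrable_uminus: "square_integrable f \<Longrightarrow> square_integrable (\<lambda>x. - f x)"
  by (simp add: square_integrable_def)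

lemma square_integrable_diff:
  "square_integrable f \<Longrightarrow> square_integrable g \<Longrightarrow> square_integrable (\<lambda>x. f x - g x)"
  using square_integrable_add[OF _ square_integrable_uminus] by force

lemma L2_of_uminus: "square_integrable f \<Longrightarrow> - L2_of f = L2_of (\<lambda>x. - f x)"
  using L2_of_scaleR[of f "- 1"] by simp

lemma L2_of_diff:
  "square_integrable f \<Longrightarrow> square_integrable g \<Longrightarrow> L2_of f - L2_of g = L2_of (\<lambda>x. f x - g x)"
  using L2_of_add[of f "\<lambda>x. - g x"] 
  by (simp add: diff_conv_add_uminus L2_of_uminus square_integrable_uminus
      del: add_uminus_conv_diff)

lemma square_integrable_sum:
  "(\<And>i. i \<in> I \<Longrightarrow> square_integrable (f i)) \<Longrightarrow> square_integrable (\<lambda>x. \<Sum>i\<in>I. f i x)"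
  by (induction I rule: infinite_finite_induct)
     (auto simp: square_integrable_zero intro: square_integrable_add)

lemma L2_of_sum:
  "(\<And>i. i \<in> I \<Longrightarrow> square_integrable (f i)) \<Longrightarrow> (\<Sum>i\<in>I. L2_of (f i)) = L2_of (\<lambda>x. \<Sum>i\<in>I. f i x)"
  by (induction I rule: infinite_finite_induct)
     (auto simp: L2_of_add square_integrable_sum zero_L2.abs_eq)

lemma cinner_L2_of:
  "square_integrable f \<Longrightarrow> square_integrable g \<Longrightarrow>
    cinner (L2_of f) (L2_of g) = (\<integral>x. cinner (f x) (g x) \<partial>lborel)"
  by (rule cinner_L2.abs_eq) auto

lemma cinner_L2: "cinner f g = (\<integral>x. cinner (L2_fun f x) (L2_fun g x) \<partial>lborel)"
  using cinner_L2_of[of "L2_fun f" "L2_fun g"] by simp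

lemma norm_L2_of: "square_integrable f \<Longrightarrow> (norm (L2_of f))\<^sup>2 = (\<integral>x. (norm (f x))\<^sup>2 \<partial>lborel)"
  using inner_L2.abs_eq[of f f] by (simp add: power2_norm_eq_inner)

lemma norm_L2: "(norm f)\<^sup>2 = (\<integral>x. (norm (L2_fun f x))\<^sup>2 \<partial>lborel)"
  using norm_L2_of[of "L2_fun f"] by simp

lemma square_integrable_bound:
  assumes w: "integrable lborel (\<lambda>x. (w x)\<^sup>2)" and f: "f \<in> borel_measurable borel"
    and le: "AE x in lborel. norm (f x) \<le> (w x :: real)"
  shows "square_integrable f"
  unfolding square_integrable_def
proof
  show "integrable lborel (\<lambda>x. (norm (f x))\<^sup>2)"
  proof (rule Bochner_Integration.integrable_bound[OF w])
    show "AE x in lborel. norm ((norm (f x))\<^sup>2) \<le> norm ((w x)\<^sup>2)"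
      using le by eventually_elim (simp add: power_mono)
  qed (use f in measurable)
qed (use f in simp)

text \<open>The limit inherits the square integrable majorant \<open>w\<close>, so the squared
  differences are dominated by 4 w^2 and the scalar theorem applies to them.\<close>

lemma L2_dominated_convergence:
  fixes f :: "nat \<Rightarrow> 'x::euclidean_space \<Rightarrow> 's::{complex_inner, euclidean_space}"
  assumes w: "integrable lborel (\<lambda>x. (w x)\<^sup>2)"
    and m [measurable]: "\<And>n. f n \<in> borel_measurable borel" "g \<in> borel_measurable borel"
    and le: "\<And>n. AE x in lborel. norm (f n x) \<le> (w x :: real)"
    and lim: "AE x in lborel. (\<lambda>n. f n x) \<longlonglongrightarrow> g x"
  shows "(\<lambda>n. L2_of (f n)) \<longlonglongrightarrow> L2_of g"
proof -
  have gw: "AE x in lborel. norm (g x) \<le> w x"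
  proof -
    have "AE x in lborel. \<forall>n. norm (f n x) \<le> w x" using le by (simp add: AE_all_countable)
    with lim show ?thesis
      by eventually_elim (auto intro: LIMSEQ_le_const2 tendsto_norm)
  qed
  have sqf: "square_integrable (f n)" for n by (rule square_integrable_bound[OF w m(1) le])
  have sqg: "square_integrable g" by (rule square_integrable_bound[OF w m(2) gw])
  have "(\<lambda>n. \<integral>x. (norm (f n x - g x))\<^sup>2 \<partial>lborel) \<longlonglongrightarrow> (\<integral>(x::'x). 0 \<partial>lborel)"
  proof (rule integral_dominated_convergence)
    show "integrable lborel (\<lambda>x. 4 * (w x)\<^sup>2)" using w by simp
    show "AE x in lborel. (\<lambda>n. (norm (f n x - g x))\<^sup>2) \<longlonglongrightarrow> 0"
      using lim
    proof eventually_elim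
      fix x assume "(\<lambda>n. f n x) \<longlonglongrightarrow> g x"
      hence "(\<lambda>n. (norm (f n x - g x))\<^sup>2) \<longlonglongrightarrow> (norm (g x - g x))\<^sup>2"
        by (intro tendsto_intros)
      thus "(\<lambda>n. (norm (f n x - g x))\<^sup>2) \<longlonglongrightarrow> 0" by simp
    qed
    show "AE x in lborel. norm ((norm (f n x - g x))\<^sup>2) \<le> 4 * (w x)\<^sup>2" for n
      using le[of n] gw
    proof eventually_elim
      fix x assume "norm (f n x) \<le> w x" "norm (g x) \<le> w x"
      hence "norm (f n x - g x) \<le> 2 * w x" using norm_triangle_ineq4[of "f n x" "g x"] by simp
      hence "(norm (f n x - g x))\<^sup>2 \<le> (2 * w x)\<^sup>2" by (intro power_mono) auto
      thus "norm ((norm (f n x - g x))\<^sup>2) \<le> 4 * (w x)\<^sup>2" by (simp add: power_mult_distrib)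
    qed
  qed measurable
  hence "(\<lambda>n. (norm (L2_of (f n) - L2_of g))\<^sup>2) \<longlonglongrightarrow> 0"
    by (simp add: L2_of_diff sqf sqg norm_L2_of square_integrable_diff)
  from tendsto_real_sqrt[OF this] have "(\<lambda>n. norm (L2_of (f n) - L2_of g)) \<longlonglongrightarrow> 0" by simp
  thus ?thesis
    by (simp add: LIM_zero_cancel tendsto_norm_zero_iff)
qed

lemma vtensor_L2_of: "square_integrable f \<Longrightarrow> u \<otimes>\<^sub>v L2_of f = L2_of (\<lambda>x. f x *\<^sub>C u)"
  by (rule vtensor.abs_eq) simp

lemma probe_tensor_L2_of:
  "square_integrable f \<Longrightarrow> square_integrable w \<Longrightarrow>
    probe_tensor (L2_of f) (L2_of w) = L2_of (\<lambda>x. f (fst x) *\<^sub>C w (snd x))"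
  by (rule probe_tensor.abs_eq) simp_all

lemma square_integrable_vtensor:
  "square_integrable f \<Longrightarrow> square_integrable (\<lambda>x. f x *\<^sub>C u)"
  using vtensor.rsp by (auto simp: rel_fun_def L2_rel_def)

lemma square_integrable_probe_tensor:
  "square_integrable f \<Longrightarrow> square_integrable w \<Longrightarrow>
    square_integrable (\<lambda>x::real \<times> real. f (fst x) *\<^sub>C w (snd x))"
  using rel_funD[OF rel_funD[OF probe_tensor.rsp, of f f], of w w] by simp

lemma square_integrable_indicator:
  assumes "A \<in> sets borel" "A \<subseteq> {a..b::real}"
  shows "square_integrable (indicator A :: real \<Rightarrow> complex)"
  unfolding square_integrable_def
proof
  have "emeasure lborel A \<le> emeasure lborel {a..b}"
    using assms by (intro emeasure_mono) auto
  also have "\<dots> < \<infinity>" by (rule emeasure_compact_finite[OF compact_Icc])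
  finally have "integrable lborel (indicator A :: real \<Rightarrow> real)"
    using assms by (intro integrable_real_indicator) auto
  moreover have "(cmod (indicator A x))\<^sup>2 = (indicator A x :: real)" for x
    by (simp add: indicator_def)
  ultimately show "integrable lborel (\<lambda>x. (cmod (indicator A x))\<^sup>2)" by simp
qed (use assms in measurable)

section \<open>Closed subspaces that contain the indicators of short intervals\<close>

locale closed_csubspace =
  fixes M :: "'h::complex_inner set"
  assumes closed: "closed M" and zero: "0 \<in> M"
    and add: "\<And>x y. x \<in> M \<Longrightarrow> y \<in> M \<Longrightarrow> x + y \<in> M"
    and scale: "\<And>c x. x \<in> M \<Longrightarrow> c *\<^sub>C x \<in> M"
begin

lemma diff: "x \<in> M \<Longrightarrow> y \<in> M \<Longrightarrow> x - y \<in> M"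
  using add[of x "(-1) *\<^sub>C y"] scale[of y "-1"] by (simp add: scaleC.minus_left)

lemma sum: "(\<And>i. i \<in> I \<Longrightarrow> f i \<in> M) \<Longrightarrow> (\<Sum>i\<in>I. f i) \<in> M"
  by (induction I rule: infinite_finite_induct) (auto simp: zero add)

lemma limit: "(\<And>n. f n \<in> M) \<Longrightarrow> f \<longlonglongrightarrow> x \<Longrightarrow> x \<in> M"
  using closed closed_sequentially by blast

end

text \<open>Half-open, so that for \<open>L > 0\<close> the cells partition the line and membership
  is a condition on a floor. They serve both as bounded pieces for approximation and as periods of
  Fourier series.\<close>

definition cell :: "real \<Rightarrow> int \<Rightarrow> real set" where
  "cell L m = {of_int m * L..<of_int (m + 1) * L}"

lemma cell_iff: "L > 0 \<Longrightarrow> x \<in> cell L m \<longleftrightarrow> \<lfloor>x / L\<rfloor> = m"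
  by (auto simp: cell_def floor_eq_iff field_simps)

lemma cell_measurable [measurable]: "cell L m \<in> sets borel"
  by (simp add: cell_def)

lemma cell_subset: "cell L m \<subseteq> {of_int m * L..of_int (m + 1) * L}"
  by (auto simp: cell_def)

text \<open>Dynkin's argument: half-lines generate the Borel sets and are stable under intersection,
  and a closed subspace respects complements and disjoint unions. Cutting with one cell keeps every
  indicator square integrable and supplies the majorant for countable unions.\<close>

lemma L2_of_indicator_mem:
  fixes M :: "(real, complex) L2 set"
  assumes M: "closed_csubspace M" and "L > 0"
    and int: "\<And>m a b. of_int m * L \<le> a \<Longrightarrow> a < b \<Longrightarrow> b \<le> of_int (m + 1) * L \<Longrightarrow>
      L2_of (indicator {a<..<b}) \<in> M"
    and A: "A \<in> sets borel"
  shows "L2_of (indicator (A \<inter> cell L m)) \<in> M"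
proof -
  interpret closed_csubspace M by fact
  let ?c = "cell L m"
  have sq: "square_integrable (indicator (B \<inter> ?c) :: real \<Rightarrow> complex)" if "B \<in> sets borel" for B
    using that cell_subset[of L m] by (intro square_integrable_indicator[of _ "of_int m * L" "of_int (m+1) * L"]) auto
  have lessThan: "L2_of (indicator ({..<b} \<inter> ?c)) \<in> M" for b
  proof (cases "of_int m * L < b")
    case True
    \<comment> \<open>The hypothesis concerns open intervals; the half-open trace of a half-line on
      the cell differs from one of them by a null set.\<close>
    have "L2_of (indicator ({..<b} \<inter> ?c) :: real \<Rightarrow> complex) = L2_of (indicator {of_int m * L<..<min b (of_int (m + 1) * L)})"
    proof (rule L2_of_eqI)
      show "square_integrable (indicator {of_int m * L<..<min b (of_int (m + 1) * L)} :: real \<Rightarrow> complex)"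
        by (rule square_integrable_indicator[of _ "of_int m * L" "b"]) auto
      show "AE x in lborel. indicator ({..<b} \<inter> ?c) x
          = (indicator {of_int m * L<..<min b (of_int (m + 1) * L)} x :: complex)"
        using AE_lborel_singleton[of "of_int m * L"]
        by eventually_elim (auto simp: cell_def indicator_def)
    qed (rule sq, simp)
    also have "\<dots> \<in> M" using True \<open>L > 0\<close> by (intro int) (auto simp: algebra_simps)
    finally show ?thesis .
  next
    case False
    hence "{..<b} \<inter> ?c = {}" by (auto simp: cell_def)
    hence "(indicator ({..<b} \<inter> ?c) :: real \<Rightarrow> complex) = (\<lambda>x. 0)" by auto
    thus ?thesis using zero by (simp add: zero_L2.abs_eq[symmetric])
  qed
  have cellM: "L2_of (indicator (UNIV \<inter> ?c)) \<in> M"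
  proof -
    have "{..<of_int (m + 1) * L} \<inter> ?c = UNIV \<inter> ?c" by (auto simp: cell_def)
    thus ?thesis using lessThan[of "of_int (m + 1) * L"] by simp
  qed
  have A': "A \<in> sigma_sets UNIV (range lessThan)"
    using A by (simp add: borel_Iio)
  have stable: "Int_stable (range (lessThan :: real \<Rightarrow> _))"
  proof -
    have "{..<a} \<inter> {..<b} = {..<min a b}" for a b :: real by auto
    thus ?thesis by (auto simp: Int_stable_def)
  qed
  have borelI: "B \<in> sigma_sets UNIV (range lessThan) \<Longrightarrow> B \<in> sets borel" for B :: "real set"
    by (simp add: borel_Iio)
  have "range (lessThan :: real \<Rightarrow> _) \<subseteq> Pow UNIV" by simp
  from stable this A' show ?thesis
  proof (induction rule: sigma_sets_induct_disjoint)
    case (compl B)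
    have B: "B \<in> sets borel" using compl by (intro borelI)
    have "L2_of (indicator ((UNIV - B) \<inter> ?c) :: real \<Rightarrow> complex) = L2_of (indicator (UNIV \<inter> ?c)) - L2_of (indicator (B \<inter> ?c))"
      using sq[of UNIV] sq[OF B]
      by (subst L2_of_diff) (auto simp: indicator_def intro!: arg_cong[of _ _ L2_of])
    thus ?case using diff[OF cellM] compl by simp
  next
    case (union B)
    have B: "B i \<in> sets borel" for i using union by (intro borelI) auto
    have eq: "L2_of (indicator ((\<Union>i<n. B i) \<inter> ?c) :: real \<Rightarrow> complex) = (\<Sum>i<n. L2_of (indicator (B i \<inter> ?c)))" for n
    proof -
      have "(indicator ((\<Union>i<n. B i) \<inter> ?c) x :: complex) = (\<Sum>i<n. indicator (B i \<inter> ?c) x)" for x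
      proof (cases "\<exists>i<n. x \<in> B i \<inter> ?c")
        case True
        then obtain i where i: "i < n" "x \<in> B i \<inter> ?c" by blast
        have "(\<Sum>i<n. indicator (B i \<inter> ?c) x :: complex) = (\<Sum>j<n. if j = i then 1 else 0)"
          using union(1) i by (intro sum.cong) (auto simp: indicator_def disjoint_family_on_def)
        thus ?thesis using i by (auto simp: indicator_def)
      next
        case False
        hence "indicator (B i \<inter> ?c) x = (0::complex)" if "i < n" for i
          using that by (auto simp: indicator_def)
        with False show ?thesis by (auto simp: indicator_def)
      qed
      hence "(indicator ((\<Union>i<n. B i) \<inter> ?c) :: real \<Rightarrow> complex) = (\<lambda>x. \<Sum>i<n. indicator (B i \<inter> ?c) x)" by blast
      thus ?thesis using B by (simp add: L2_of_sum sq)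
    qed
    have "(\<lambda>n. L2_of (indicator ((\<Union>i<n. B i) \<inter> ?c) :: real \<Rightarrow> complex)) \<longlonglongrightarrow> L2_of (indicator ((\<Union>i. B i) \<inter> ?c))"
    proof (rule L2_dominated_convergence)
      show "integrable lborel (\<lambda>x. (cmod (indicator (UNIV \<inter> ?c) x))\<^sup>2)"
        using sq[of UNIV] by (simp add: square_integrable_def)
      show "AE x in lborel. cmod (indicator ((\<Union>i<n. B i) \<inter> ?c) x) \<le> cmod (indicator (UNIV \<inter> ?c) x)" for n
        by (simp add: indicator_def)
      show "AE x in lborel. (\<lambda>n. indicator ((\<Union>i<n. B i) \<inter> ?c) x) \<longlonglongrightarrow> (indicator ((\<Union>i. B i) \<inter> ?c) x :: complex)"
      proof (rule AE_I2)
        fix x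
        show "(\<lambda>n. indicator ((\<Union>i<n. B i) \<inter> ?c) x) \<longlonglongrightarrow> (indicator ((\<Union>i. B i) \<inter> ?c) x :: complex)"
        proof (cases "x \<in> (\<Union>i. B i) \<inter> ?c")
          case True
          then obtain i where i: "x \<in> B i" "x \<in> ?c" by blast
          have "\<forall>\<^sub>F n in sequentially. indicator ((\<Union>i<n. B i) \<inter> ?c) x = (1::complex)"
            using eventually_gt_at_top[of i] by eventually_elim (use i in \<open>auto simp: indicator_def\<close>)
          thus ?thesis using True by (simp add: tendsto_eventually)
        next
          case False
          hence "\<forall>\<^sub>F n in sequentially. indicator ((\<Union>i<n. B i) \<inter> ?c) x = (0::complex)"
            by (intro always_eventually) (auto simp: indicator_def)
          thus ?thesis using False by (simp add: tendsto_eventually)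
        qed
      qed
    qed (use B in measurable)
    thus ?case
      by (rule limit[rotated]) (simp add: eq sum union)
  next
    case (basic B)
    thus ?case using lessThan by auto
  next
    case empty
    have "(indicator ({} \<inter> ?c) :: real \<Rightarrow> complex) = (\<lambda>x. 0)" by auto
    thus ?case using zero by (simp add: zero_L2.abs_eq[symmetric])
  qed
qed

text \<open>Simple functions that approximate \<open>f\<close> with at most twice its modulus, cut
  down to finitely many cells, lie in \<open>M\<close> and converge in the mean. The intervals in
  the hypothesis stay inside one cell because Fourier approximation works one period at a
  time.\<close>

lemma closed_csubspace_eq_UNIV:
  fixes M :: "(real, complex) L2 set"
  assumes M: "closed_csubspace M" and "L > 0"
    and int: "\<And>m a b. of_int m * L \<le> a \<Longrightarrow> a < b \<Longrightarrow> b \<le> of_int (m + 1) * L \<Longrightarrow>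
      L2_of (indicator {a<..<b}) \<in> M"
  shows "M = UNIV"
proof -
  interpret closed_csubspace M by fact
  have "f \<in> M" for f
  proof -
    obtain s where s: "\<And>i. simple_function borel (s i)"
      and s_lim: "\<And>x. (\<lambda>i. s i x) \<longlonglongrightarrow> L2_fun f x"
      and s_le: "\<And>i x. dist (s i x) 0 \<le> 2 * dist (L2_fun f x) 0"
      using borel_measurable_implies_sequence_metric[OF L2_fun_measurable[of f], of 0] by auto
    have [measurable]: "s i \<in> borel_measurable borel" for i
      by (rule borel_measurable_simple_function[OF s])
    define B where "B i = (\<Union>m\<in>{- int i..<int i}. cell L m)" for i :: nat
    define F where "F i x = s i x * indicator (B i) x" for i x
    have [measurable]: "B i \<in> sets borel" for i unfolding B_def by auto
    have B: "x \<in> B i \<longleftrightarrow> - int i \<le> \<lfloor>x / L\<rfloor> \<and> \<lfloor>x / L\<rfloor> < int i" for x i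
      using \<open>L > 0\<close> by (auto simp: B_def cell_iff)
    have FM: "L2_of (F i) \<in> M" for i
    proof -
      have fin: "finite (range (s i))" using simple_functionD(1)[OF s[of i]] by simp
      have bo: "s i -` {z} \<in> sets borel" for z using simple_functionD(2)[OF s[of i], of "{z}"] by simp
      have sq: "square_integrable (indicator (s i -` {z} \<inter> cell L m) :: real \<Rightarrow> complex)" for z m
        using bo cell_subset[of L m]
        by (intro square_integrable_indicator[of _ "of_int m * L" "of_int (m+1) * L"]) auto
      have "F i x = (\<Sum>z\<in>range (s i). \<Sum>m\<in>{- int i..<int i}. z *\<^sub>C indicator (s i -` {z} \<inter> cell L m) x)" for x
      proof -
        have 1: "(\<Sum>m\<in>{- int i..<int i}. indicator (cell L m) x) = (indicator (B i) x :: complex)"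
        proof -
          have "(\<Sum>m\<in>{- int i..<int i}. indicator (cell L m) x :: complex)
              = (\<Sum>m\<in>{- int i..<int i}. if m = \<lfloor>x / L\<rfloor> then 1 else 0)"
            using \<open>L > 0\<close> by (intro sum.cong) (auto simp: indicator_def cell_iff)
          also have "\<dots> = indicator (B i) x" using B[of x i] by (auto simp: indicator_def)
          finally show ?thesis .
        qed
        have "(\<Sum>z\<in>range (s i). \<Sum>m\<in>{- int i..<int i}. z *\<^sub>C indicator (s i -` {z} \<inter> cell L m) x)
            = (\<Sum>z\<in>range (s i). if z = s i x then z * indicator (B i) x else 0)"
          by (intro sum.cong refl)
             (auto simp: scaleC_complex_def indicator_inter_arith sum_distrib_left[symmetric] 1)
        also have "\<dots> = F i x" using fin by (simp add: F_def)
        finally show ?thesis by simp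
      qed
      hence F: "F i = (\<lambda>x. \<Sum>z\<in>range (s i). \<Sum>m\<in>{- int i..<int i}. z *\<^sub>C indicator (s i -` {z} \<inter> cell L m) x)"
        by blast
      have "L2_of (F i) = (\<Sum>z\<in>range (s i). \<Sum>m\<in>{- int i..<int i}. z *\<^sub>C L2_of (indicator (s i -` {z} \<inter> cell L m)))"
        unfolding F by (simp add: L2_of_sum L2_of_scaleC sq square_integrable_scaleC square_integrable_sum)
      also have "\<dots> \<in> M"
        by (intro sum scale L2_of_indicator_mem[OF M \<open>L > 0\<close> int bo])
      finally show ?thesis .
    qed
    have "(\<lambda>i. L2_of (F i)) \<longlonglongrightarrow> L2_of (L2_fun f)"
    proof (rule L2_dominated_convergence)
      have "integrable lborel (\<lambda>x. 4 * (cmod (L2_fun f x))\<^sup>2)"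
        using square_integrable_L2_fun[of f] by (simp add: square_integrable_def)
      thus "integrable lborel (\<lambda>x. (2 * cmod (L2_fun f x))\<^sup>2)" by (simp add: power_mult_distrib)
      show "AE x in lborel. cmod (F i x) \<le> 2 * cmod (L2_fun f x)" for i
        using s_le[of i] by (auto simp: F_def indicator_def)
      show "AE x in lborel. (\<lambda>i. F i x) \<longlonglongrightarrow> L2_fun f x"
      proof (rule AE_I2)
        fix x
        have "\<forall>\<^sub>F i in sequentially. F i x = s i x"
          using eventually_gt_at_top[of "nat (\<bar>\<lfloor>x / L\<rfloor>\<bar>)"]
          by eventually_elim (auto simp: F_def indicator_def B)
        thus "(\<lambda>i. F i x) \<longlonglongrightarrow> L2_fun f x"
          using s_lim[of x] by (rule tendsto_cong[THEN iffD2])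
      qed
    qed (auto simp: F_def[abs_def])
    from limit[OF FM this] show ?thesis by simp
  qed
  thus ?thesis by blast
qed

section \<open>Trigonometric approximation\<close>

text \<open>An inductive predicate instead of coefficient families: the closure properties below
  become inductions on how the polynomial was built.\<close>

inductive trig_poly :: "real \<Rightarrow> (real \<Rightarrow> complex) \<Rightarrow> bool" for \<omega> where
  exp: "trig_poly \<omega> (\<lambda>x. c * iexp (\<omega> * of_int n * x))"
| add: "trig_poly \<omega> f \<Longrightarrow> trig_poly \<omega> g \<Longrightarrow> trig_poly \<omega> (\<lambda>x. f x + g x)"

lemma trig_poly_const: "trig_poly \<omega> (\<lambda>x. c)"
  using trig_poly.exp[of \<omega> c 0] by simp

lemma trig_poly_mult:
  assumes "trig_poly \<omega> f" "trig_poly \<omega> g"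
  shows "trig_poly \<omega> (\<lambda>x. f x * g x)"
  using assms
proof (induction arbitrary: g)
  case (exp c n)
  from exp show ?case
  proof induction
    case (exp d m)
    have "(\<lambda>x. c * iexp (\<omega> * of_int n * x) * (d * iexp (\<omega> * of_int m * x)))
        = (\<lambda>x. (c * d) * iexp (\<omega> * of_int (n + m) * x))"
      by (simp add: fun_eq_iff algebra_simps exp_add)
    thus ?case by (metis trig_poly.exp)
  next
    case (add g h)
    thus ?case using trig_poly.add[OF add.IH] by (simp add: distrib_left)
  qed
next
  case (add f h)
  show ?case using trig_poly.add[OF add.IH(1) add.IH(2), OF add.prems add.prems]
    by (simp add: distrib_right)
qed

lemma trig_poly_shift:
  assumes "trig_poly \<omega> f"
  shows "trig_poly \<omega> (\<lambda>x. f (x - c))"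
  using assms
proof induction
  case (exp d n)
  have "(\<lambda>x. d * iexp (\<omega> * of_int n * (x - c)))
      = (\<lambda>x. (d * exp (- \<i> * complex_of_real (\<omega> * of_int n * c))) * iexp (\<omega> * of_int n * x))"
    by (simp add: fun_eq_iff algebra_simps exp_add[symmetric])
  thus ?case by (metis trig_poly.exp)
next
  case (add f g)
  show ?case by (rule trig_poly.add[OF add.IH])
qed

lemma trig_poly_periodic:
  assumes "trig_poly (2 * pi / L) f" "L > 0"
  shows "f (x + of_int m * L) = f x"
  using assms(1)
proof induction
  case (exp c n)
  have "iexp (2 * pi / L * of_int n * (x + of_int m * L))
      = iexp (2 * pi / L * of_int n * x) * iexp (2 * of_int (n * m) * pi)"
    using \<open>L > 0\<close> by (simp add: exp_add[symmetric] field_simps)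
  also have "iexp (2 * of_int (n * m) * pi) = 1"
    using exp_integer_2pi[of "of_int (n * m)"] by (simp add: mult_ac)
  finally show ?case by simp
qed simp

lemma trig_poly_continuous: "trig_poly \<omega> f \<Longrightarrow> continuous_on A f"
  by (induction rule: trig_poly.induct) (auto intro!: continuous_intros)

text \<open>The Stone-Weierstrass theorem delivers polynomials in the real coordinates of a point of
  the circle. On the exponential a real-linear functional is a combination of cosine and sine, hence
  of the frequencies 1 and -1; sums and products follow by closure.\<close>

lemma trig_poly_real_polynomial:
  fixes f :: "complex \<Rightarrow> real"
  assumes "real_polynomial_function f"
  shows "trig_poly \<omega> (\<lambda>x. complex_of_real (f (iexp (\<omega> * x))))"
  using assms
proof induction
  case (linear f)
  interpret bounded_linear f by fact
  have f: "f z = Re z * f 1 + Im z * f \<i>" for z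
  proof -
    have "f z = f (Re z *\<^sub>R 1 + Im z *\<^sub>R \<i>)"
      by (rule arg_cong[of _ _ f]) (simp add: complex_eq_iff)
    thus ?thesis by (simp add: add scaleR)
  qed
  let ?e = "\<lambda>n x. iexp (\<omega> * of_int n * x)"
  have "(\<lambda>x. complex_of_real (f (iexp (\<omega> * x))))
      = (\<lambda>x. (f 1 - \<i> * f \<i>) / 2 * ?e 1 x + (f 1 + \<i> * f \<i>) / 2 * ?e (- 1) x)"
  proof
    fix x
    have "f (iexp (\<omega> * x)) = cos (\<omega> * x) * f 1 + sin (\<omega> * x) * f \<i>"
      by (subst f) (simp add: Re_exp Im_exp)
    moreover have "?e 1 x = cos (\<omega> * x) + \<i> * sin (\<omega> * x)" "?e (- 1) x = cos (\<omega> * x) - \<i> * sin (\<omega> * x)"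
      by (simp_all add: complex_eq_iff Re_exp Im_exp)
    ultimately show "complex_of_real (f (iexp (\<omega> * x)))
      = (f 1 - \<i> * f \<i>) / 2 * ?e 1 x + (f 1 + \<i> * f \<i>) / 2 * ?e (- 1) x"
      by (simp add: complex_eq_iff field_simps)
  qed
  thus ?case
    using trig_poly.add[OF trig_poly.exp[of \<omega> "(f 1 - \<i> * f \<i>) / 2" 1]
        trig_poly.exp[of \<omega> "(f 1 + \<i> * f \<i>) / 2" "- 1"]] by simp
next
  case (const c)
  show ?case by (rule trig_poly_const)
next
  case (add f g)
  show ?case using trig_poly.add[OF add.IH] by simp
next
  case (mult f g)
  show ?case using trig_poly_mult[OF mult.IH] by simp
qed

lemma trig_poly_polynomial:
  fixes p :: "complex \<Rightarrow> complex"
  assumes "polynomial_function p"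
  shows "trig_poly \<omega> (\<lambda>x. p (iexp (\<omega> * x)))"
proof -
  let ?z = "\<lambda>x. iexp (\<omega> * x)"
  have "real_polynomial_function (Re \<circ> p)" "real_polynomial_function (Im \<circ> p)"
    using assms bounded_linear_Re bounded_linear_Im by (auto simp: polynomial_function_def)
  hence "trig_poly \<omega> (\<lambda>x. complex_of_real ((Re \<circ> p) (?z x)) + \<i> * complex_of_real ((Im \<circ> p) (?z x)))"
    by (intro trig_poly.add trig_poly_mult trig_poly_const trig_poly_real_polynomial)
  thus ?thesis by (simp flip: complex_eq)
qed

text \<open>The restriction to functions that vanish near the ends of the period makes
  \<open>f \<circ> Arg2pi\<close> continuous across the branch cut of the argument.\<close>

lemma trig_poly_approximation:
  fixes f :: "real \<Rightarrow> complex"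
  assumes f: "continuous_on UNIV f" and supp: "\<And>x. f x \<noteq> 0 \<Longrightarrow> a \<le> x \<and> x \<le> b"
    and ab: "c < a" "b < c + L" and "L > 0" "\<epsilon> > 0"
  shows "\<exists>T. trig_poly (2 * pi / L) T \<and> (\<forall>x\<in>{c..c + L}. cmod (f x - T x) < \<epsilon>)"
proof -
  define \<theta> where "\<theta> x = 2 * pi / L * (x - c)" for x
  \<comment> \<open>\<open>f\<close> transported to the unit circle, with the angle 0 at the end
    point \<open>c\<close> of the period.\<close>
  define F where "F z = f (c + L * Arg2pi z / (2 * pi))" for z
  define K where "K = (\<lambda>t. iexp t) ` {\<theta> a..\<theta> b}"
  have Arg: "Arg2pi (iexp t) = t" if "0 \<le> t" "t < 2 * pi" for t
    using Arg2pi_exp[of "\<i> * complex_of_real t"] that by simp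
  have \<theta>_mono: "\<theta> x \<le> \<theta> y \<longleftrightarrow> x \<le> y" "\<theta> x < \<theta> y \<longleftrightarrow> x < y" for x y
    using \<open>L > 0\<close> by (simp_all add: \<theta>_def mult_le_cancel_left_pos divide_le_cancel divide_less_cancel)
  have \<theta>_ends: "\<theta> c = 0" "\<theta> (c + L) = 2 * pi" using \<open>L > 0\<close> by (simp_all add: \<theta>_def)
  have F: "F (iexp (\<theta> x)) = f x" if "x \<in> {c..c + L}" for x
  proof (cases "x = c + L")
    \<comment> \<open>Both ends of the period are the point 1 of the circle, where
      \<open>Arg2pi\<close> is 0; the values match because \<open>f\<close> vanishes at both
      ends.\<close>
    case True
    have "iexp (\<theta> x) = 1" using exp_two_pi_i
      by (simp add: True \<theta>_ends mult_ac)
    moreover have "f c = 0" using supp[of c] ab by force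
    moreover have "f (c + L) = 0" using supp[of "c + L"] ab by force
    ultimately show ?thesis by (simp add: F_def Arg2pi_of_real[of 1, simplified] True)
  next
    case False
    hence "Arg2pi (iexp (\<theta> x)) = \<theta> x"
      using that \<theta>_mono \<theta>_ends by (intro Arg) (metis atLeastAtMost_iff order_less_le)+
    thus ?thesis using \<open>L > 0\<close> by (simp add: F_def \<theta>_def)
  qed
  have K0: "F z = 0" if "cmod z = 1" "z \<notin> K" for z
  proof (rule ccontr)
    assume "F z \<noteq> 0"
    from supp[OF this[unfolded F_def]] have "a \<le> c + L * Arg2pi z / (2 * pi)" "c + L * Arg2pi z / (2 * pi) \<le> b"
      by auto
    hence "Arg2pi z \<in> {\<theta> a..\<theta> b}" using \<open>L > 0\<close> by (simp add: \<theta>_def field_simps)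
    hence "iexp (Arg2pi z) \<in> K" unfolding K_def by blast
    with that complex_norm_eq_1_exp[of z] show False by simp
  qed
  have "closed K"
    unfolding K_def by (intro compact_imp_closed compact_continuous_image continuous_intros) auto
  have "continuous (at z within sphere 0 1) F" if z: "z \<in> sphere 0 1" for z
  proof (cases "z \<in> K")
    case True
    then obtain t where t: "\<theta> a \<le> t" "t \<le> \<theta> b" "z = iexp t" by (auto simp: K_def)
    have "0 < t" "t < 2 * pi"
      using t ab \<theta>_mono(2)[of c a] \<theta>_mono(2)[of b "c + L"] \<theta>_ends by auto
    hence "Arg2pi z = t" using t Arg by simp
    hence "z \<notin> \<real>\<^sub>\<ge>\<^sub>0" using Arg2pi_eq_0[of z] \<open>0 < t\<close> by (auto simp: complex_nonneg_Reals_iff complex_is_Real_iff)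
    hence "continuous (at z) Arg2pi" by (rule continuous_at_Arg2pi)
    hence "continuous (at z) (\<lambda>z. c + L * Arg2pi z / (2 * pi))" by (intro continuous_intros) auto
    moreover have "continuous (at (c + L * Arg2pi z / (2 * pi))) f"
      using f by (simp add: continuous_on_eq_continuous_at)
    ultimately have "continuous (at z) F" unfolding F_def by (rule continuous_at_compose[unfolded o_def])
    thus ?thesis by (rule continuous_at_imp_continuous_at_within)
  next
    case False
    \<comment> \<open>Off the closed arc \<open>K\<close> the function vanishes near
      \<open>z\<close> on the circle. This covers the branch cut, since \<open>K\<close> stays away
      from the angle 0.\<close>
    have "\<forall>\<^sub>F w in at z within sphere 0 1. F w = F z"
      unfolding eventually_at_topological
    proof (intro exI[of _ "- K"] conjI ballI impI)
      show "open (- K)" using \<open>closed K\<close> by auto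
      show "z \<in> - K" using False by simp
      show "F w = F z" if "w \<in> - K" "w \<noteq> z" "w \<in> sphere 0 1" for w
        using that z False K0[of w] K0[of z] by simp
    qed
    thus ?thesis by (simp add: continuous_within tendsto_eventually)
  qed
  hence "continuous_on (sphere 0 1) F" by (simp add: continuous_on_eq_continuous_within)
  from Stone_Weierstrass_polynomial_function[OF compact_sphere this \<open>\<epsilon> > 0\<close>]
  obtain p where p: "polynomial_function p" "\<And>z. z \<in> sphere 0 1 \<Longrightarrow> cmod (F z - p z) < \<epsilon>" by blast
  have "trig_poly (2 * pi / L) (\<lambda>x. p (iexp (\<theta> x)))"
    unfolding \<theta>_def by (rule trig_poly_shift[OF trig_poly_polynomial[OF p(1)]])
  moreover have "cmod (f x - p (iexp (\<theta> x))) < \<epsilon>" if "x \<in> {c..c + L}" for x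
    using p(2)[of "iexp (\<theta> x)"] F[OF that] by simp
  ultimately show ?thesis by blast
qed

text \<open>The 1 subtracted before clipping keeps the support at distance \<open>1 / n\<close> from
  both ends, as the uniform approximation requires. For \<open>n = 0\<close> the function vanishes,
  so the sequence may start there.\<close>

definition trapezoid :: "real \<Rightarrow> real \<Rightarrow> nat \<Rightarrow> real \<Rightarrow> real" where
  "trapezoid a b n x = max 0 (min 1 (real n * min (x - a) (b - x) - 1))"

lemma trapezoid_continuous: "continuous_on A (trapezoid a b n)"
  unfolding trapezoid_def by (intro continuous_intros)

lemma trapezoid_measurable [measurable]: "trapezoid a b n \<in> borel_measurable borel"
  by (intro borel_measurable_continuous_onI trapezoid_continuous)

lemma trapezoid_range: "0 \<le> trapezoid a b n x" "trapezoid a b n x \<le> 1"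
  by (auto simp: trapezoid_def)

lemma trapezoid_support:
  assumes "trapezoid a b n x \<noteq> 0"
  shows "n > 0 \<and> a + 1 / real n \<le> x \<and> x \<le> b - 1 / real n"
proof -
  have *: "real n * min (x - a) (b - x) > 1" using assms by (auto simp: trapezoid_def max_def min_def split: if_splits)
  hence n: "n > 0" by (cases n) auto
  have "real n * (x - a) > 1" "real n * (b - x) > 1"
    using * n by (auto simp: min_def split: if_splits) (smt (verit) mult_left_mono of_nat_0_le_iff)+
  thus ?thesis using n by (auto simp: field_simps)
qed

lemma trapezoid_tendsto:
  "(\<lambda>n. trapezoid a b n x) \<longlonglongrightarrow> indicator {a<..<b} x"
proof (cases "x \<in> {a<..<b}")
  case True
  define d where "d = min (x - a) (b - x)"
  have "d > 0" using True by (simp add: d_def)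
  obtain N where N: "real N > 2 / d" using reals_Archimedean2 by blast
  have "\<forall>\<^sub>F n in sequentially. trapezoid a b n x = 1"
    using eventually_ge_at_top[of N]
  proof eventually_elim
    fix n assume "N \<le> n"
    have "2 < real N * d" using N \<open>d > 0\<close> by (simp add: pos_divide_less_eq)
    also have "\<dots> \<le> real n * d" using \<open>N \<le> n\<close> \<open>d > 0\<close> by (intro mult_right_mono) auto
    finally show "trapezoid a b n x = 1" unfolding trapezoid_def d_def[symmetric] by simp
  qed
  thus ?thesis using True by (simp add: tendsto_eventually)
next
  case False
  have "trapezoid a b n x = 0" for n
  proof (rule ccontr)
    assume "trapezoid a b n x \<noteq> 0"
    from trapezoid_support[OF this] have n: "n > 0" "a + 1 / real n \<le> x" "x \<le> b - 1 / real n" by auto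
    hence "1 / real n > 0" by simp
    with n False show False by auto
  qed
  thus ?thesis using False by simp
qed

lemma indicator_mem_if_trapezoids:
  assumes M: "closed_csubspace M" and "a < b"
    and trap: "\<And>n. L2_of (\<lambda>x. complex_of_real (trapezoid a b n x)) \<in> M"
  shows "L2_of (indicator {a<..<b}) \<in> (M :: (real, complex) L2 set)"
proof -
  interpret closed_csubspace M by fact
  have "(\<lambda>n. L2_of (\<lambda>x. complex_of_real (trapezoid a b n x))) \<longlonglongrightarrow> L2_of (indicator {a<..<b})"
  proof (rule L2_dominated_convergence)
    show "integrable lborel (\<lambda>x. (cmod (indicator {a..b} x))\<^sup>2)"
      using square_integrable_indicator[of "{a..b}" a b] by (simp add: square_integrable_def)
    show "AE x in lborel. cmod (complex_of_real (trapezoid a b n x)) \<le> cmod (indicator {a..b} x)" for n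
    proof (rule AE_I2)
      fix x
      have "x \<in> {a..b}" if "trapezoid a b n x \<noteq> 0"
        using trapezoid_support[OF that] by auto (smt (verit) divide_nonneg_nonneg of_nat_0_le_iff)+
      thus "cmod (complex_of_real (trapezoid a b n x)) \<le> cmod (indicator {a..b} x)"
        using trapezoid_range[of a b n x] by (cases "x \<in> {a..b}") auto
    qed
    have "(\<lambda>n. complex_of_real (trapezoid a b n x)) \<longlonglongrightarrow> complex_of_real (indicator {a<..<b} x)" for x
      by (intro tendsto_of_real trapezoid_tendsto)
    moreover have "complex_of_real (indicator {a<..<b} x) = indicator {a<..<b} x" for x
      by (simp add: indicator_def)
    ultimately show "AE x in lborel. (\<lambda>n. complex_of_real (trapezoid a b n x)) \<longlonglongrightarrow> indicator {a<..<b} x"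
      by simp
  qed measurable
  thus ?thesis by (rule limit[rotated]) (rule trap)
qed

section \<open>The Fourier basis\<close>

lemma closed_csubspace_closure:
  assumes "0 \<in> S" "\<And>x y. x \<in> S \<Longrightarrow> y \<in> S \<Longrightarrow> x + y \<in> S" "\<And>c x. x \<in> S \<Longrightarrow> c *\<^sub>C x \<in> S"
  shows "closed_csubspace (closure S)"
proof
  show "0 \<in> closure S" using assms(1) closure_subset by blast
  show "x + y \<in> closure S" if xy: "x \<in> closure S" "y \<in> closure S" for x y
  proof -
    obtain f where "\<forall>n. f n \<in> S" "f \<longlonglongrightarrow> x"
      using xy(1) unfolding closure_sequential by blast
    moreover obtain g where "\<forall>n. g n \<in> S" "g \<longlonglongrightarrow> y"
      using xy(2) unfolding closure_sequential by blast
    ultimately show ?thesis unfolding closure_sequential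
      by (intro exI[of _ "\<lambda>n. f n + g n"]) (simp add: assms(2) tendsto_add)
  qed
  show "c *\<^sub>C x \<in> closure S" if x: "x \<in> closure S" for c x
  proof -
    obtain f where "\<forall>n. f n \<in> S" "f \<longlonglongrightarrow> x"
      using x unfolding closure_sequential by blast
    thus ?thesis unfolding closure_sequential
      by (intro exI[of _ "\<lambda>n. c *\<^sub>C f n"]) (simp add: assms(3) scaleC.tendsto)
  qed
qed simp

lemma cspan_zero: "0 \<in> cspan S"
  unfolding cspan_def by (intro CollectI exI[of _ "{}"]) auto

lemma cspan_add: "x \<in> cspan S \<Longrightarrow> y \<in> cspan S \<Longrightarrow> x + y \<in> cspan S"
proof -
  assume "x \<in> cspan S" "y \<in> cspan S"
  then obtain F c G d where F: "finite F" "F \<subseteq> S" "x = (\<Sum>v\<in>F. c v *\<^sub>C v)"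
    and G: "finite G" "G \<subseteq> S" "y = (\<Sum>v\<in>G. d v *\<^sub>C v)" by (auto simp: cspan_def)
  define c' where "c' v = (if v \<in> F then c v else 0)" for v
  define d' where "d' v = (if v \<in> G then d v else 0)" for v
  have "x = (\<Sum>v\<in>F \<union> G. c' v *\<^sub>C v)"
    unfolding F using F G by (intro sum.mono_neutral_cong_left) (auto simp: c'_def scaleC.zero_left)
  moreover have "y = (\<Sum>v\<in>F \<union> G. d' v *\<^sub>C v)"
    unfolding G using F G by (intro sum.mono_neutral_cong_left) (auto simp: d'_def scaleC.zero_left)
  ultimately have "x + y = (\<Sum>v\<in>F \<union> G. (c' v + d' v) *\<^sub>C v)"
    by (simp add: scaleC_add_left sum.distrib)
  thus ?thesis using F G unfolding cspan_def by (intro CollectI exI[of _ "F \<union> G"] exI[of _ "\<lambda>v. c' v + d' v"]) auto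
qed

lemma cspan_scaleC: "x \<in> cspan S \<Longrightarrow> c *\<^sub>C x \<in> cspan S"
proof -
  assume "x \<in> cspan S"
  then obtain F d where "finite F" "F \<subseteq> S" "x = (\<Sum>v\<in>F. d v *\<^sub>C v)" by (auto simp: cspan_def)
  thus ?thesis unfolding cspan_def
    by (intro CollectI exI[of _ F] exI[of _ "\<lambda>v. c * d v"]) (simp add: scaleC.sum_right scaleC_scaleC)
qed

lemma cspan_base: "x \<in> S \<Longrightarrow> x \<in> cspan S"
  unfolding cspan_def by (intro CollectI exI[of _ "{x}"] exI[of _ "\<lambda>_. 1"]) auto

text \<open>Normalised Fourier modes of one cell. L^2 of the line is the orthogonal sum of the L^2
  spaces of the cells, so all \<open>m\<close> and \<open>n\<close> together form a discrete basis,
  available before any Plancherel identity.\<close>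

definition fourier_fun :: "real \<Rightarrow> int \<Rightarrow> int \<Rightarrow> real \<Rightarrow> complex" where
  "fourier_fun L m n x = indicator (cell L m) x *
    (complex_of_real (1 / sqrt L) * iexp (2 * pi / L * of_int n * x))"

definition fourier_basis :: "real \<Rightarrow> (real, complex) L2 set" where
  "fourier_basis L = {L2_of (fourier_fun L m n) | m n. True}"

lemma fourier_fun_measurable [measurable]: "fourier_fun L m n \<in> borel_measurable borel"
  unfolding fourier_fun_def by measurable

lemma square_integrable_cell_bounded:
  fixes f :: "real \<Rightarrow> complex"
  assumes "f \<in> borel_measurable borel" "\<And>x. x \<in> cell L m \<Longrightarrow> cmod (f x) \<le> B"
  shows "square_integrable (\<lambda>x. indicator (cell L m) x * f x)"
proof (rule square_integrable_bound)
  have "square_integrable (indicator (cell L m) :: real \<Rightarrow> complex)"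
    using cell_subset by (intro square_integrable_indicator) auto
  hence "integrable lborel (\<lambda>x. B\<^sup>2 * (cmod (indicator (cell L m) x))\<^sup>2)"
    by (simp add: square_integrable_def)
  thus "integrable lborel (\<lambda>x. (B * cmod (indicator (cell L m) x))\<^sup>2)" by (simp add: power_mult_distrib)
  show "AE x in lborel. cmod (indicator (cell L m) x * f x) \<le> B * cmod (indicator (cell L m) x)"
    using assms(2) by (auto simp: indicator_def)
qed (use assms(1) in measurable)

lemma square_integrable_fourier_fun: "square_integrable (fourier_fun L m n)"
  unfolding fourier_fun_def
  by (rule square_integrable_cell_bounded[where B = "\<bar>1 / sqrt L\<bar>"]) (auto simp: norm_mult norm_divide)

lemma integral_exp_cell:
  assumes "L > 0"
  shows "(\<integral>x. indicator (cell L m) x * iexp (2 * pi / L * of_int k * x) \<partial>lborel)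
    = (if k = 0 then complex_of_real L else 0)"
proof -
  let ?a = "of_int m * L" and ?b = "of_int (m + 1) * L"
  let ?f = "\<lambda>x. iexp (2 * pi / L * of_int k * x)"
  have ab: "?a \<le> ?b" using assms by (simp add: algebra_simps)
  have "(\<integral>x. indicator (cell L m) x * ?f x \<partial>lborel) = (\<integral>x. indicator {?a..?b} x *\<^sub>R ?f x \<partial>lborel)"
  proof (rule integral_cong_AE)
    show "AE x in lborel. indicator (cell L m) x * ?f x = indicator {?a..?b} x *\<^sub>R ?f x"
      using AE_lborel_singleton[of ?b] by eventually_elim (auto simp: cell_def indicator_def)
  qed measurable
  also have "\<dots> = (if k = 0 then complex_of_real L else 0)"
  proof (cases "k = 0")
    case True
    have "(\<integral>x. indicator {?a..?b} x *\<^sub>R (1::complex) \<partial>lborel) = complex_of_real ?b - complex_of_real ?a"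
      by (rule integral_FTC_Icc[OF ab]) (auto intro!: derivative_eq_intros continuous_intros)
    thus ?thesis using True by (simp add: algebra_simps)
  next
    case False
    let ?w = "\<i> * complex_of_real (2 * pi / L * of_int k)"
    have w: "?w \<noteq> 0" using False assms by simp
    have "(\<integral>x. indicator {?a..?b} x *\<^sub>R ?f x \<partial>lborel) = ?f ?b / ?w - ?f ?a / ?w"
    proof (rule integral_FTC_Icc[OF ab])
      fix x
      have "((\<lambda>z. exp (?w * z) / ?w) has_field_derivative exp (?w * complex_of_real x)) (at (complex_of_real x))"
        using w by (auto intro!: derivative_eq_intros)
      from has_vector_derivative_real_field[OF this]
      have "((\<lambda>x. ?f x / ?w) has_vector_derivative ?f x) (at x)"
        by (simp add: mult.assoc)
      thus "((\<lambda>x. ?f x / ?w) has_vector_derivative ?f x) (at x within {?a..?b})"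
        by (rule has_vector_derivative_at_within)
    qed (intro continuous_intros)
    moreover have "?f ?b = ?f ?a"
      using trig_poly_periodic[OF trig_poly.exp[of _ 1 k] assms, of ?a 1] by (simp add: algebra_simps)
    ultimately show ?thesis using False by simp
  qed
  finally show ?thesis .
qed

lemma cinner_fourier:
  assumes "L > 0"
  shows "cinner (L2_of (fourier_fun L m n)) (L2_of (fourier_fun L m' n')) = (if m = m' \<and> n = n' then 1 else 0)"
proof -
  have eq: "cinner (fourier_fun L m n x) (fourier_fun L m' n' x)
      = (if m = m' then (1 / L) * (indicator (cell L m) x * iexp (2 * pi / L * of_int (n' - n) * x)) else 0)" for x
  proof (cases "x \<in> cell L m \<and> m = m'")
    case True
    have "cnj (iexp (2 * pi / L * of_int n * x)) * iexp (2 * pi / L * of_int n' * x)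
        = iexp (2 * pi / L * of_int (n' - n) * x)"
      by (simp add: exp_cnj exp_add[symmetric] algebra_simps diff_divide_distrib)
    moreover have "complex_of_real (1 / sqrt L) * complex_of_real (1 / sqrt L) = complex_of_real (1 / L)"
      using assms by (simp flip: of_real_mult)
    moreover have "cinner (fourier_fun L m n x) (fourier_fun L m' n' x)
        = (complex_of_real (1 / sqrt L) * complex_of_real (1 / sqrt L)) *
          (cnj (iexp (2 * pi / L * of_int n * x)) * iexp (2 * pi / L * of_int n' * x))"
      using True by (auto simp: fourier_fun_def cinner_complex_def simp del: of_real_mult)
    ultimately have "cinner (fourier_fun L m n x) (fourier_fun L m' n' x)
        = complex_of_real (1 / L) * iexp (2 * pi / L * of_int (n' - n) * x)"
      by (simp only:)
    thus ?thesis using True by auto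
  next
    case False
    thus ?thesis using assms by (auto simp: fourier_fun_def cinner_complex_def indicator_def cell_iff)
  qed
  have "cinner (L2_of (fourier_fun L m n)) (L2_of (fourier_fun L m' n'))
      = (\<integral>x. (if m = m' then (1 / L) * (indicator (cell L m) x * iexp (2 * pi / L * of_int (n' - n) * x)) else 0) \<partial>lborel)"
    by (simp only: cinner_L2_of square_integrable_fourier_fun eq)
  also have "\<dots> = (if m = m' then (1 / L) * (if n' - n = 0 then complex_of_real L else 0) else 0)"
    unfolding integral_exp_cell[OF assms, of m "n' - n", symmetric]
    by (cases "m = m'") (simp_all only: simp_thms if_True if_False integral_mult_right_zero Bochner_Integration.integral_zero)
  finally show ?thesis using assms by auto
qed

text \<open>For completeness, a trapezoid inside a cell is a uniform limit of trigonometric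
  polynomials there, and on a bounded cell uniform convergence implies convergence in the mean. The
  same basis later makes \<open>partial_trace\<close> well defined.\<close>

lemma orthonormal_basis_fourier:
  assumes "L > 0"
  shows "orthonormal_basis (fourier_basis L)"
  unfolding orthonormal_basis_def
proof
  show "orthonormal_on (fourier_basis L) (\<lambda>e. e)"
    unfolding orthonormal_on_def fourier_basis_def by (auto simp: cinner_fourier assms)
  interpret closed_csubspace "closure (cspan (fourier_basis L))"
    by (intro closed_csubspace_closure cspan_zero cspan_add cspan_scaleC)
  have T: "L2_of (\<lambda>x. indicator (cell L m) x * T x) \<in> cspan (fourier_basis L)
      \<and> square_integrable (\<lambda>x. indicator (cell L m) x * T x)"
    if "trig_poly (2 * pi / L) T" for m T
    using that
  proof induction
    case (exp c n)
    have eq: "(\<lambda>x. indicator (cell L m) x * (c * iexp (2 * pi / L * of_int n * x)))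
        = (\<lambda>x. (c * complex_of_real (sqrt L)) *\<^sub>C fourier_fun L m n x)"
      using assms by (simp add: fun_eq_iff fourier_fun_def scaleC_complex_def)
    have "(c * complex_of_real (sqrt L)) *\<^sub>C L2_of (fourier_fun L m n) \<in> cspan (fourier_basis L)"
      by (intro cspan_scaleC cspan_base) (auto simp: fourier_basis_def)
    thus ?case
      unfolding eq by (simp only: square_integrable_fourier_fun square_integrable_scaleC L2_of_scaleC)
  next
    case (add f g)
    thus ?case by (simp add: distrib_left square_integrable_add cspan_add flip: L2_of_add)
  qed
  show "closure (cspan (fourier_basis L)) = UNIV"
  proof (rule closed_csubspace_eq_UNIV[OF closed_csubspace_axioms assms])
    fix m a b assume ab: "of_int m * L \<le> a" "a < b" "b \<le> of_int (m + 1) * L"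
    show "L2_of (indicator {a<..<b}) \<in> closure (cspan (fourier_basis L))"
    proof (rule indicator_mem_if_trapezoids[OF closed_csubspace_axioms ab(2)])
      fix n
      let ?f = "\<lambda>x. complex_of_real (trapezoid a b n x)"
      show "L2_of ?f \<in> closure (cspan (fourier_basis L))"
      \<comment> \<open>For \<open>n = 0\<close> the margin \<open>1 / n\<close> is 0 and the
        approximation lemma does not apply, but the trapezoid vanishes.\<close>
      proof (cases "n = 0")
        case True
        hence "?f = (\<lambda>x. 0)" by (simp add: trapezoid_def fun_eq_iff)
        thus ?thesis using zero by (simp add: zero_L2.abs_eq[symmetric])
      next
        case False
        have "\<exists>T. trig_poly (2 * pi / L) T \<and>
            (\<forall>x\<in>{of_int m * L..of_int m * L + L}. cmod (?f x - T x) < 1 / real (Suc k))" for k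
        proof (rule trig_poly_approximation)
          show "continuous_on UNIV ?f" by (intro continuous_intros trapezoid_continuous)
          show "?f x \<noteq> 0 \<Longrightarrow> a + 1 / real n \<le> x \<and> x \<le> b - 1 / real n" for x
            using trapezoid_support[of a b n x] by auto
          have "1 / real n > 0" using False by simp
          moreover have "of_int (m + 1) * L = of_int m * L + L" by (simp add: algebra_simps)
          ultimately show "of_int m * L < a + 1 / real n" "b - 1 / real n < of_int m * L + L"
            using ab by linarith+
        qed (use assms in auto)
        then obtain T where T': "\<And>k. trig_poly (2 * pi / L) (T k)"
          "\<And>k x. x \<in> {of_int m * L..of_int m * L + L} \<Longrightarrow> cmod (?f x - T k x) < 1 / real (Suc k)" by metis
        have Tm: "T k \<in> borel_measurable borel" for k
          by (intro borel_measurable_continuous_onI trig_poly_continuous[OF T'(1)])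
        have cl: "x \<in> {of_int m * L..of_int m * L + L}" if "x \<in> cell L m" for x
          using that by (auto simp: cell_def algebra_simps)
        have f0: "?f x = 0" if "x \<notin> cell L m" for x
        proof (rule ccontr)
          assume "?f x \<noteq> 0"
          hence "a + 1 / real n \<le> x" "x \<le> b - 1 / real n" using trapezoid_support[of a b n x] by auto
          moreover have "1 / real n > 0" using False by simp
          ultimately have "a < x" "x < b" by linarith+
          hence "x \<in> cell L m" unfolding cell_def atLeastLessThan_iff using ab by linarith
          with that show False by simp
        qed
        have "(\<lambda>k. L2_of (\<lambda>x. indicator (cell L m) x * T k x)) \<longlonglongrightarrow> L2_of ?f"
        proof (rule L2_dominated_convergence)
          have "square_integrable (indicator (cell L m) :: real \<Rightarrow> complex)"
            using cell_subset by (intro square_integrable_indicator) auto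
          hence "integrable lborel (\<lambda>x. 4 * (cmod (indicator (cell L m) x))\<^sup>2)"
            by (simp add: square_integrable_def)
          thus "integrable lborel (\<lambda>x. (2 * cmod (indicator (cell L m) x))\<^sup>2)"
            by (simp add: power_mult_distrib)
          show "AE x in lborel. cmod (indicator (cell L m) x * T k x) \<le> 2 * cmod (indicator (cell L m) x)" for k
          proof (rule AE_I2)
            fix x
            have "cmod (T k x) \<le> 2" if "x \<in> cell L m"
            proof -
              have "cmod (T k x) \<le> cmod (?f x) + cmod (?f x - T k x)"
                by (metis norm_minus_commute norm_triangle_sub)
              also have "cmod (?f x) \<le> 1" using trapezoid_range[of a b n x] by simp
              also have "cmod (?f x - T k x) \<le> 1"
                using T'(2)[OF cl[OF that], of k] by (smt (verit) divide_le_eq_1 of_nat_0_le_iff of_nat_Suc)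
              finally show ?thesis by simp
            qed
            thus "cmod (indicator (cell L m) x * T k x) \<le> 2 * cmod (indicator (cell L m) x)"
              by (auto simp: indicator_def)
          qed
          show "AE x in lborel. (\<lambda>k. indicator (cell L m) x * T k x) \<longlonglongrightarrow> ?f x"
          proof (rule AE_I2)
            fix x
            show "(\<lambda>k. indicator (cell L m) x * T k x) \<longlonglongrightarrow> ?f x"
            proof (cases "x \<in> cell L m")
              case True
              have "(\<lambda>k. T k x - ?f x) \<longlonglongrightarrow> 0"
              proof (rule Lim_null_comparison)
                show "\<forall>\<^sub>F k in sequentially. cmod (T k x - ?f x) \<le> 1 / real (Suc k)"
                  using T'(2)[OF cl[OF True]] by (intro always_eventually allI) (simp add: norm_minus_commute less_imp_le)
              qed (rule LIMSEQ_Suc[OF lim_1_over_n])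
              thus ?thesis using True by (simp add: LIM_zero_cancel)
            next
              case False
              thus ?thesis using f0 by simp
            qed
          qed
        qed (use Tm in measurable)
        thus ?thesis
          by (rule limit[rotated]) (use T[OF T'(1)] closure_subset in blast)
      qed
    qed
  qed
qed

section \<open>Density of the Gaussian wave packets\<close>

lemma integrable_exp_neg_sq:
  assumes "(c::real) > 0"
  shows "integrable lborel (\<lambda>x. exp (- (c * x\<^sup>2)))"
proof -
  define \<sigma> where "\<sigma> = 1 / sqrt (2 * c)"
  have \<sigma>: "\<sigma>\<^sup>2 = 1 / (2 * c)" using assms by (simp add: \<sigma>_def power_divide)
  have "\<sigma> > 0" using assms by (simp add: \<sigma>_def)
  hence "integrable lborel (\<lambda>x. sqrt (2 * pi * \<sigma>\<^sup>2) * normal_density 0 \<sigma> x)"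
    by (intro integrable_mult_right integrable_normal_density)
  moreover have "sqrt (2 * pi * \<sigma>\<^sup>2) * normal_density 0 \<sigma> x = exp (- (c * x\<^sup>2))" for x
    using assms by (simp add: normal_density_def \<sigma> mult.commute)
  ultimately show ?thesis by simp
qed

text \<open>Width and centre are fixed and only the frequency varies: this family is already total,
  and apart from the shear of the argument the flow acts on it by changing frequencies. The complex
  amplitude is a parameter so that spans are generated by sums alone, which fits the real linearity
  that \<open>U\<close> has by its type.\<close>

definition gauss_fun :: "complex \<Rightarrow> real \<Rightarrow> real \<Rightarrow> complex" where
  "gauss_fun c u x = c * exp (complex_of_real (- (x\<^sup>2 / 2)) + \<i> * complex_of_real (u * x))"

lemma gauss_fun_measurable [measurable]: "gauss_fun c u \<in> borel_measurable borel"
  unfolding gauss_fun_def by measurable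

lemma norm_gauss_fun: "cmod (gauss_fun c u x) = cmod c * exp (- (x\<^sup>2 / 2))"
  by (simp add: gauss_fun_def norm_mult)

lemma square_integrable_gauss_fun: "square_integrable (gauss_fun c u)"
proof (rule square_integrable_bound)
  have "integrable lborel (\<lambda>x. (cmod c)\<^sup>2 * exp (- (1 * x\<^sup>2)))"
    by (intro integrable_mult_right integrable_exp_neg_sq) simp
  thus "integrable lborel (\<lambda>x. (cmod c * exp (- (x\<^sup>2 / 2)))\<^sup>2)"
    by (simp add: power_mult_distrib flip: exp_double)
qed (simp_all add: norm_gauss_fun)

inductive gauss_span :: "(real \<Rightarrow> complex) \<Rightarrow> bool" where
  gauss: "gauss_span (gauss_fun c u)"
| add: "gauss_span f \<Longrightarrow> gauss_span g \<Longrightarrow> gauss_span (\<lambda>x. f x + g x)"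

lemma square_integrable_gauss_span: "gauss_span f \<Longrightarrow> square_integrable f"
  by (induction rule: gauss_span.induct) (auto simp: square_integrable_gauss_fun square_integrable_add)

lemma gauss_span_scale: "gauss_span f \<Longrightarrow> gauss_span (\<lambda>x. d * f x)"
proof (induction rule: gauss_span.induct)
  case (gauss c u)
  have "(\<lambda>x. d * gauss_fun c u x) = gauss_fun (d * c) u" by (simp add: gauss_fun_def fun_eq_iff)
  thus ?case using gauss_span.gauss by metis
next
  case (add f g)
  show ?case using gauss_span.add[OF add.IH] by (simp add: distrib_left)
qed

lemma gauss_span_trig_poly:
  assumes "trig_poly \<omega> T"
  shows "gauss_span (\<lambda>x. T x * complex_of_real (exp (- (x\<^sup>2 / 2))))"
  using assms
proof induction
  case (exp c n)
  have eq: "(\<lambda>x. c * iexp (\<omega> * of_int n * x) * complex_of_real (exp (- (x\<^sup>2 / 2))))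
      = gauss_fun c (\<omega> * of_int n)"
    by (rule ext) (simp only: gauss_fun_def exp_add exp_of_real mult_ac)
  show ?case unfolding eq by (rule gauss_span.gauss)
next
  case (add f g)
  show ?case using gauss_span.add[OF add.IH] by (simp add: distrib_right)
qed

text \<open>The period of the approximating trigonometric polynomials grows with the accuracy; away from
  the support of \<open>f\<close> periodicity keeps them bounded, so that the Gaussian weight dominates.\<close>

lemma closure_gauss_span: "closure (L2_of ` Collect gauss_span) = UNIV"
proof -
  let ?G = "L2_of ` Collect gauss_span"
  interpret closed_csubspace "closure ?G"
  proof (rule closed_csubspace_closure)
    have "gauss_fun 0 0 = (\<lambda>x. 0)" by (simp add: gauss_fun_def fun_eq_iff)
    thus "0 \<in> ?G" using gauss_span.gauss[of 0 0] by (auto simp: zero_L2.abs_eq)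
    show "x + y \<in> ?G" if "x \<in> ?G" "y \<in> ?G" for x y
      using that by (auto simp: L2_of_add square_integrable_gauss_span intro!: imageI gauss_span.add)
    show "c *\<^sub>C x \<in> ?G" if "x \<in> ?G" for c x
      using that
      by (auto simp: L2_of_scaleC square_integrable_gauss_span scaleC_complex_def intro!: imageI gauss_span_scale)
  qed
  show ?thesis
  proof (rule closed_csubspace_eq_UNIV[OF closed_csubspace_axioms zero_less_one])
    fix m :: int and a b :: real assume ab: "a < b"
    show "L2_of (indicator {a<..<b}) \<in> closure ?G"
    proof (rule indicator_mem_if_trapezoids[OF closed_csubspace_axioms ab])
      fix n
      let ?e = "\<lambda>x::real. exp (x\<^sup>2 / 2)" and ?e' = "\<lambda>x::real. exp (- (x\<^sup>2 / 2))"
      let ?f = "\<lambda>x. complex_of_real (trapezoid a b n x)"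
      \<comment> \<open>The trapezoid divided by the Gaussian weight; it is still continuous with
        compact support.\<close>
      define F where "F x = complex_of_real (trapezoid a b n x * ?e x)" for x
      \<comment> \<open>Larger than both end points in modulus, so that the support is interior to
        the period [-(k + R), k + R] for every \<open>k\<close>.\<close>
      define R where "R = \<bar>a\<bar> + \<bar>b\<bar> + 1"
      have supp: "a \<le> x \<and> x \<le> b" if "F x \<noteq> 0" for x
        using trapezoid_support[of a b n x] that by (auto simp: F_def) (smt (verit) divide_nonneg_nonneg of_nat_0_le_iff)+
      have F: "continuous_on A F" for A
        unfolding F_def by (intro continuous_intros trapezoid_continuous) auto
      have "compact (F ` {a..b})" by (intro compact_continuous_image F compact_Icc)
      then obtain B0 where B0: "\<And>x. x \<in> {a..b} \<Longrightarrow> cmod (F x) \<le> B0"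
        using compact_imp_bounded bounded_iff by (metis imageI)
      define B where "B = max B0 0"
      have B: "cmod (F x) \<le> B" for x
        using B0[of x] supp[of x] by (cases "F x = 0") (auto simp: B_def)
      have "\<exists>T. trig_poly (2 * pi / (2 * (real k + R))) T \<and>
          (\<forall>x\<in>{- (real k + R)..- (real k + R) + 2 * (real k + R)}. cmod (F x - T x) < 1 / real (Suc k))" for k
        by (rule trig_poly_approximation[OF F supp]) (auto simp: R_def)
      then obtain T where T: "\<And>k. trig_poly (2 * pi / (2 * (real k + R))) (T k)"
        "\<And>k x. x \<in> {- (real k + R)..- (real k + R) + 2 * (real k + R)} \<Longrightarrow> cmod (F x - T k x) < 1 / real (Suc k)"
        by metis
      have Tm: "T k \<in> borel_measurable borel" for k
        by (intro borel_measurable_continuous_onI trig_poly_continuous[OF T(1)])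
      \<comment> \<open>Periodicity moves \<open>x\<close> into the period on which the
        approximation is controlled, which makes the bound uniform in both \<open>k\<close> and
        \<open>x\<close>.\<close>
      have T_le: "cmod (T k x) \<le> B + 1" for k x
      proof -
        define L where "L = 2 * (real k + R)"
        have L: "L > 0" and L2: "L / 2 = real k + R" by (simp_all add: L_def R_def)
        define y where "y = x + of_int (- \<lfloor>(x + L / 2) / L\<rfloor>) * L"
        define z where "z = of_int \<lfloor>(x + L / 2) / L\<rfloor> * L"
        have "z \<le> x + L / 2" "x + L / 2 \<le> z + L"
          unfolding z_def using floor_divide_lower[OF L, of "x + L / 2"] floor_divide_upper[OF L, of "x + L / 2"]
          by (auto simp: algebra_simps)
        hence "z \<le> x + (real k + R)" "x + (real k + R) \<le> z + (2 * real k + 2 * R)"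
          unfolding L2 by (simp_all add: L_def)
        hence "- (real k + R) \<le> x - z" "x - z \<le> real k + R" by linarith+
        hence "y \<in> {- (real k + R)..- (real k + R) + 2 * (real k + R)}"
          unfolding y_def z_def by simp
        from T(2)[OF this] have "cmod (F y - T k y) \<le> 1" by (smt (verit) divide_le_eq_1 of_nat_0_le_iff of_nat_Suc)
        moreover have "T k y = T k x" unfolding y_def
          by (rule trig_poly_periodic[OF _ L]) (use T(1)[of k] in \<open>simp add: L_def\<close>)
        moreover have "cmod (T k y) \<le> cmod (F y) + cmod (F y - T k y)"
          by (metis norm_minus_commute norm_triangle_sub)
        ultimately show ?thesis using B[of y] by simp
      qed
      have "(\<lambda>k. L2_of (\<lambda>x. T k x * complex_of_real (?e' x))) \<longlonglongrightarrow> L2_of ?f"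
      proof (rule L2_dominated_convergence)
        show "integrable lborel (\<lambda>x. (cmod (gauss_fun (complex_of_real (B + 1)) 0 x))\<^sup>2)"
          using square_integrable_gauss_fun[of "complex_of_real (B + 1)" 0] by (simp add: square_integrable_def)
        have "B + 1 \<ge> 0" by (simp add: B_def)
        thus "AE x in lborel. cmod (T k x * complex_of_real (?e' x)) \<le> cmod (gauss_fun (complex_of_real (B + 1)) 0 x)" for k
          using T_le by (intro AE_I2) (auto simp: norm_mult norm_gauss_fun simp del: of_real_add)
        show "AE x in lborel. (\<lambda>k. T k x * complex_of_real (?e' x)) \<longlonglongrightarrow> ?f x"
        proof (rule AE_I2)
          fix x
          have "(\<lambda>k. T k x - F x) \<longlonglongrightarrow> 0"
          proof (rule Lim_null_comparison)
            obtain N where N: "real N \<ge> \<bar>x\<bar>" using real_arch_simple by blast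
            show "\<forall>\<^sub>F k in sequentially. cmod (T k x - F x) \<le> 1 / real (Suc k)"
              using eventually_ge_at_top[of N]
            proof eventually_elim
              fix k assume "N \<le> k"
              hence "\<bar>x\<bar> \<le> real k" using N by linarith
              hence "x \<in> {- (real k + R)..- (real k + R) + 2 * (real k + R)}" by (auto simp: R_def)
              from T(2)[OF this] show "cmod (T k x - F x) \<le> 1 / real (Suc k)"
                by (simp add: norm_minus_commute)
            qed
          qed (rule LIMSEQ_Suc[OF lim_1_over_n])
          hence "(\<lambda>k. T k x) \<longlonglongrightarrow> F x" by (rule LIM_zero_cancel)
          hence "(\<lambda>k. T k x * complex_of_real (?e' x)) \<longlonglongrightarrow> F x * complex_of_real (?e' x)"
            by (intro tendsto_intros)
          also have "F x * complex_of_real (?e' x) = ?f x"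
            by (simp add: F_def exp_minus)
          finally show "(\<lambda>k. T k x * complex_of_real (?e' x)) \<longlonglongrightarrow> ?f x" .
        qed
      qed (use Tm in measurable)
      moreover have "L2_of (\<lambda>x. T k x * complex_of_real (?e' x)) \<in> closure ?G" for k
        by (intro subsetD[OF closure_subset] imageI CollectI gauss_span_trig_poly[OF T(1)])
      ultimately show "L2_of ?f \<in> closure ?G" by (rule limit[rotated])
    qed
  qed
qed

section \<open>Band-limited functions\<close>

text \<open>Sign and normalisation are those of \<open>momentum_limited\<close>, so that the probe
  wave function is a \<open>fourier_integral\<close> as it stands; in exchange Plancherel's identity
  carries the factor 2 pi.\<close>

definition fourier_integral :: "(real \<Rightarrow> complex) \<Rightarrow> real \<Rightarrow> complex" where
  "fourier_integral g x = (\<integral>k. iexp (x * k) * g k \<partial>lborel)"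

text \<open>The vanishing is pointwise, for a chosen representative, so that disjointness of shifted
  supports can be read off point by point.\<close>

definition band_fun :: "real \<Rightarrow> (real \<Rightarrow> complex) \<Rightarrow> bool" where
  "band_fun \<kappa> g \<longleftrightarrow> square_integrable g \<and> (\<forall>k. \<kappa> \<le> \<bar>k\<bar> \<longrightarrow> g k = 0)"

lemma square_integrable_compact_support_integrable:
  assumes g: "square_integrable g" and z: "\<And>k. k \<notin> {a..b} \<Longrightarrow> g k = 0"
  shows "integrable lborel (g :: real \<Rightarrow> complex)"
proof -
  have "integrable lborel (\<lambda>k. cinner (indicator {a..b} k) (g k))"
    by (intro square_integrable_cinner square_integrable_indicator[of _ a b] g) auto
  moreover have "cinner (indicator {a..b} k) (g k) = g k" for k
    using z[of k] by (auto simp: cinner_complex_def indicator_def)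
  ultimately show ?thesis by simp
qed

lemma band_fun_integrable: "band_fun \<kappa> g \<Longrightarrow> integrable lborel g"
  by (rule square_integrable_compact_support_integrable[of g "- \<kappa>" \<kappa>]) (auto simp: band_fun_def)

lemma band_fun_measurable: "band_fun \<kappa> g \<Longrightarrow> g \<in> borel_measurable borel"
  by (simp add: band_fun_def square_integrable_measurable)

lemma fourier_integral_measurable [measurable]:
  assumes [measurable]: "g \<in> borel_measurable borel"
  shows "fourier_integral g \<in> borel_measurable borel"
  unfolding fourier_integral_def by measurable

lemma integrable_exp_mult:
  assumes "integrable lborel (g :: real \<Rightarrow> complex)"
  shows "integrable lborel (\<lambda>k. iexp (x * k) * g k)"
proof (rule Bochner_Integration.integrable_bound[OF assms])
  show "(\<lambda>k. iexp (x * k) * g k) \<in> borel_measurable lborel"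
    using borel_measurable_integrable[OF assms] by measurable
qed (simp add: norm_mult)

section \<open>Translation, periodisation and Plancherel's identity\<close>

lemma fourier_integral_add:
  "integrable lborel f \<Longrightarrow> integrable lborel g \<Longrightarrow>
    fourier_integral (\<lambda>k. f k + g k) x = fourier_integral f x + fourier_integral g x"
  by (simp add: fourier_integral_def distrib_left integrable_exp_mult del: of_real_mult)

lemma fourier_integral_mult: "fourier_integral (\<lambda>k. c * g k) x = c * fourier_integral g x"
  by (simp add: fourier_integral_def mult.left_commute[of _ c] del: of_real_mult)

lemma fourier_integral_shift:
  "fourier_integral (\<lambda>k. g (k - c)) x = iexp (x * c) * fourier_integral g x"
proof -
  have "fourier_integral (\<lambda>k. g (k - c)) x
      = (\<integral>k. iexp (x * (c + 1 * k)) * g (c + 1 * k - c) \<partial>lborel)"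
    unfolding fourier_integral_def
    using lborel_integral_real_affine[of 1 "\<lambda>k. iexp (x * k) * g (k - c)" c]
    by (simp del: of_real_mult)
  also have "\<dots> = (\<integral>k. iexp (x * c) * (iexp (x * k) * g k) \<partial>lborel)"
    by (simp add: distrib_left exp_add mult.assoc)
  finally show ?thesis by (simp add: fourier_integral_def del: of_real_mult)
qed

text \<open>Folds the line onto one period. The sign in \<open>cell P (- int_decode i)\<close> makes
  the translates appear as x - n P, the points at which the Fourier integral is sampled
  below.\<close>

lemma nn_integral_cells:
  fixes f :: "real \<Rightarrow> ennreal"
  assumes "P > 0" and [measurable]: "f \<in> borel_measurable borel"
  shows "(\<integral>\<^sup>+x. f x \<partial>lborel)
    = (\<integral>\<^sup>+x. (\<Sum>i::nat. f (x - of_int (int_decode i) * P)) * indicator (cell P 0) x \<partial>lborel)"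
proof -
  have part: "(\<Sum>i::nat. f x * indicator (cell P (- int_decode i)) x) = f x" for x
  proof -
    define j where "j = int_encode (- \<lfloor>x / P\<rfloor>)"
    have "(\<Sum>i::nat. f x * indicator (cell P (- int_decode i)) x) = (\<Sum>i\<in>{j}. f x * indicator (cell P (- int_decode i)) x)"
    proof (rule suminf_finite)
      fix i assume "i \<notin> {j}"
      hence "int_decode i \<noteq> - \<lfloor>x / P\<rfloor>" unfolding j_def by (metis int_decode_inverse singletonI)
      hence "x \<notin> cell P (- int_decode i)" using cell_iff[OF \<open>P > 0\<close>] by auto
      thus "f x * indicator (cell P (- int_decode i)) x = 0" by simp
    qed simp
    thus ?thesis using cell_iff[OF \<open>P > 0\<close>] by (simp add: j_def)
  qed
  have shift: "(\<integral>\<^sup>+x. f x * indicator (cell P (- m)) x \<partial>lborel)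
      = (\<integral>\<^sup>+x. f (x - of_int m * P) * indicator (cell P 0) x \<partial>lborel)" for m
  proof -
    have "(\<integral>\<^sup>+x. f x * indicator (cell P (- m)) x \<partial>lborel)
      = (\<integral>\<^sup>+x. f (- of_int m * P + 1 * x) * indicator (cell P (- m)) (- of_int m * P + 1 * x) \<partial>lborel)"
      by (subst nn_integral_real_affine[of _ 1 "- of_int m * P"]) auto
    also have "\<dots> = (\<integral>\<^sup>+x. f (x - of_int m * P) * indicator (cell P 0) x \<partial>lborel)"
      by (intro nn_integral_cong) (auto simp: indicator_def cell_def algebra_simps)
    finally show ?thesis .
  qed
  have "(\<integral>\<^sup>+x. f x \<partial>lborel) = (\<integral>\<^sup>+x. (\<Sum>i::nat. f x * indicator (cell P (- int_decode i)) x) \<partial>lborel)"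
    by (simp only: part)
  also have "\<dots> = (\<Sum>i::nat. \<integral>\<^sup>+x. f x * indicator (cell P (- int_decode i)) x \<partial>lborel)"
    by (rule nn_integral_suminf) measurable
  also have "\<dots> = (\<Sum>i::nat. \<integral>\<^sup>+x. f (x - of_int (int_decode i) * P) * indicator (cell P 0) x \<partial>lborel)"
    by (simp only: shift)
  also have "\<dots> = (\<integral>\<^sup>+x. (\<Sum>i::nat. f (x - of_int (int_decode i) * P) * indicator (cell P 0) x) \<partial>lborel)"
    by (rule nn_integral_suminf[symmetric]) measurable
  finally show ?thesis by (simp add: ennreal_suminf_multc)
qed

text \<open>For a function supported in one period, the Fourier coefficients of e^(isk) h(k) are, up
  to \<open>1 / sqrt L\<close>, the samples of the Fourier integral on a grid through
  \<open>s\<close>. The identity is Parseval for the Fourier basis.\<close>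

lemma fourier_samples_has_sum:
  assumes h: "square_integrable h" and supp: "\<And>k. k \<notin> cell L 0 \<Longrightarrow> h k = 0" and "L > 0"
  shows "((\<lambda>n::int. (cmod (fourier_integral h (s - of_int n * (2 * pi / L))))\<^sup>2)
    has_sum L * (norm (L2_of h))\<^sup>2) UNIV"
proof -
  define hs where "hs k = iexp (s * k) * h k" for k
  have sq: "square_integrable hs"
    using h by (auto simp: square_integrable_def hs_def[abs_def] norm_mult simp del: of_real_mult)
  let ?e = "\<lambda>(m, n). L2_of (fourier_fun L m n)"
  \<comment> \<open>Parseval sums over a set of vectors; injectivity turns this into a sum over
    pairs of indices.\<close>
  have inj: "inj ?e"
  proof (rule injI, clarify)
    fix m n m' n' assume "L2_of (fourier_fun L m n) = L2_of (fourier_fun L m' n')"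
    hence "cinner (L2_of (fourier_fun L m n)) (L2_of (fourier_fun L m' n')) = 1"
      by (simp add: cinner_fourier \<open>L > 0\<close>)
    thus "m = m' \<and> n = n'" by (simp add: cinner_fourier \<open>L > 0\<close> split: if_splits)
  qed
  have coeff: "cinner (L2_of (fourier_fun L m n)) (L2_of hs)
      = (if m = 0 then complex_of_real (1 / sqrt L) * fourier_integral h (s - of_int n * (2 * pi / L)) else 0)" for m n
  proof -
    have eq: "cinner (fourier_fun L m n k) (hs k) = (if m = 0 then complex_of_real (1 / sqrt L) *
        (iexp ((s - of_int n * (2 * pi / L)) * k) * h k) else 0)" for k
    proof (cases "k \<in> cell L 0 \<and> m = 0")
      case True
      have "cnj (iexp (2 * pi / L * of_int n * k)) * iexp (s * k)
          = iexp ((s - of_int n * (2 * pi / L)) * k)"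
        by (simp add: exp_cnj exp_add[symmetric] algebra_simps)
      moreover have "cinner (fourier_fun L m n k) (hs k) = complex_of_real (1 / sqrt L) *
          ((cnj (iexp (2 * pi / L * of_int n * k)) * iexp (s * k)) * h k)"
        using True by (auto simp: fourier_fun_def cinner_complex_def hs_def simp del: of_real_mult)
      ultimately show ?thesis using True by auto
    next
      case False
      thus ?thesis using supp[of k] \<open>L > 0\<close>
        by (auto simp: fourier_fun_def cinner_complex_def hs_def indicator_def cell_iff)
    qed
    show ?thesis
      unfolding cinner_L2_of[OF square_integrable_fourier_fun sq] eq fourier_integral_def
      by (cases "m = 0") (simp_all only: simp_thms if_True if_False integral_mult_right_zero Bochner_Integration.integral_zero)
  qed
  have "((\<lambda>e. cinner (L2_of hs) e * cinner e (L2_of hs)) has_sum cinner (L2_of hs) (L2_of hs)) (fourier_basis L)"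
    by (rule parseval_has_sum[OF orthonormal_basis_fourier[OF \<open>L > 0\<close>]])
  also have "fourier_basis L = range ?e" by (auto simp: fourier_basis_def)
  finally have "((\<lambda>e. cinner (L2_of hs) e * cinner e (L2_of hs)) \<circ> ?e has_sum cinner (L2_of hs) (L2_of hs)) UNIV"
    using has_sum_reindex[OF inj] by blast
  also have "?this \<longleftrightarrow> ((\<lambda>(m::int, n). if m = 0 then complex_of_real
      ((1 / L) * (cmod (fourier_integral h (s - of_int n * (2 * pi / L))))\<^sup>2) else 0) has_sum cinner (L2_of hs) (L2_of hs)) UNIV"
  proof (intro has_sum_cong)
    fix p :: "int \<times> int"
    obtain m n where p: "p = (m, n)" by fastforce
    define z where "z = fourier_integral h (s - of_int n * (2 * pi / L))"
    have sL: "complex_of_real (1 / sqrt L) * complex_of_real (1 / sqrt L) = complex_of_real (1 / L)"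
      using \<open>L > 0\<close> by (simp flip: of_real_mult)
    have "cnj (complex_of_real (1 / sqrt L) * z) * (complex_of_real (1 / sqrt L) * z)
        = (complex_of_real (1 / sqrt L) * complex_of_real (1 / sqrt L)) * (z * cnj z)"
      by (simp only: complex_cnj_mult complex_cnj_complex_of_real mult_ac)
    also have "\<dots> = complex_of_real ((1 / L) * (cmod z)\<^sup>2)"
      unfolding sL complex_norm_square[symmetric] by simp
    finally have fact: "cnj (complex_of_real (1 / sqrt L) * z) * (complex_of_real (1 / sqrt L) * z)
        = complex_of_real ((1 / L) * (cmod z)\<^sup>2)" .
    show "((\<lambda>e. cinner (L2_of hs) e * cinner e (L2_of hs)) \<circ> ?e) p
      = (case p of (m, n) \<Rightarrow> if m = 0 then complex_of_real
      ((1 / L) * (cmod (fourier_integral h (s - of_int n * (2 * pi / L))))\<^sup>2) else 0)"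
      by (simp only: p o_apply prod.case cinner_commute[of "L2_of hs" "L2_of (fourier_fun L m n)"] coeff
          z_def[symmetric] fact if_distrib[of cnj] if_distrib[of "\<lambda>u. _ * u"] if_distrib[of "\<lambda>u. u * _"])
         (cases "m = 0", simp_all only: fact simp_thms if_True if_False mult_zero_left mult_zero_right)
  qed
  \<comment> \<open>Only the cell with \<open>m = 0\<close> meets the support of
    \<open>h\<close>.\<close>
  also have "\<dots> \<longleftrightarrow> ((\<lambda>(m::int, n). complex_of_real ((1 / L) * (cmod (fourier_integral h (s - of_int n * (2 * pi / L))))\<^sup>2))
      has_sum cinner (L2_of hs) (L2_of hs)) (range (Pair (0::int)))"
    by (rule has_sum_cong_neutral) auto
  also have "\<dots> \<longleftrightarrow> ((\<lambda>n. complex_of_real ((1 / L) * (cmod (fourier_integral h (s - of_int n * (2 * pi / L))))\<^sup>2))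
      has_sum cinner (L2_of hs) (L2_of hs)) UNIV"
    by (subst has_sum_reindex) (auto simp: inj_on_def o_def)
  finally have "((\<lambda>n. complex_of_real ((1 / L) * (cmod (fourier_integral h (s - of_int n * (2 * pi / L))))\<^sup>2))
      has_sum complex_of_real ((norm (L2_of hs))\<^sup>2)) UNIV"
    by (simp add: cinner_same power2_norm_eq_inner)
  hence "((\<lambda>n. (1 / L) * (cmod (fourier_integral h (s - of_int n * (2 * pi / L))))\<^sup>2)
      has_sum (norm (L2_of hs))\<^sup>2) UNIV"
    by (simp only: has_sum_of_real_iff)
  from has_sum_cmult_right[OF this, of L] show ?thesis
    using \<open>L > 0\<close> h sq by (simp add: norm_L2_of) (simp add: hs_def norm_mult)
qed

text \<open>By Parseval's identity for Fourier series, \<open>L * \<parallel>h\<parallel>\<^sup>2\<close> is the sum of the squared samples of the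
  Fourier transform on each translate of \<open>(2 * pi / L) \<int>\<close>; averaging over the translates
  gives Plancherel's identity.\<close>

lemma plancherel_cell:
  assumes h: "square_integrable h" and supp: "\<And>k. k \<notin> cell L 0 \<Longrightarrow> h k = 0" and "L > 0"
  shows "(\<integral>\<^sup>+x. ennreal ((cmod (fourier_integral h x))\<^sup>2) \<partial>lborel) = ennreal (2 * pi * (norm (L2_of h))\<^sup>2)"
proof -
  define P where "P = 2 * pi / L"
  have "P > 0" using \<open>L > 0\<close> by (simp add: P_def)
  have [measurable]: "h \<in> borel_measurable borel" using h by (rule square_integrable_measurable)
  have sum: "(\<Sum>i::nat. ennreal ((cmod (fourier_integral h (s - of_int (int_decode i) * P)))\<^sup>2))
      = ennreal (L * (norm (L2_of h))\<^sup>2)" for s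
  proof -
    have "((\<lambda>n::int. (cmod (fourier_integral h (s - of_int n * P)))\<^sup>2) has_sum L * (norm (L2_of h))\<^sup>2) (range int_decode)"
      using fourier_samples_has_sum[OF assms, of s] by (simp add: P_def surj_int_decode)
    hence "((\<lambda>i. (cmod (fourier_integral h (s - of_int (int_decode i) * P)))\<^sup>2) has_sum L * (norm (L2_of h))\<^sup>2) UNIV"
      by (subst (asm) has_sum_reindex) (auto simp: inj_int_decode o_def)
    from has_sum_imp_sums[OF this] show ?thesis
      by (simp add: suminf_ennreal2 sums_iff)
  qed
  have "(\<integral>\<^sup>+x. ennreal ((cmod (fourier_integral h x))\<^sup>2) \<partial>lborel)
      = (\<integral>\<^sup>+x. ennreal (L * (norm (L2_of h))\<^sup>2) * indicator (cell P 0) x \<partial>lborel)"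
    by (subst nn_integral_cells[OF \<open>P > 0\<close>]) (simp_all add: sum)
  also have "\<dots> = ennreal (L * (norm (L2_of h))\<^sup>2) * ennreal P"
    using \<open>P > 0\<close> by (subst nn_integral_cmult_indicator) (simp_all add: cell_def)
  also have "\<dots> = ennreal (2 * pi * (norm (L2_of h))\<^sup>2)"
    using \<open>L > 0\<close> \<open>P > 0\<close> by (subst ennreal_mult[symmetric]) (auto simp: P_def)
  finally show ?thesis .
qed

text \<open>A translation by \<open>\<kappa>'\<close> moves the symmetric band into a single cell
  starting at 0 and changes the Fourier integral only by a phase. The maximum with 1 keeps the
  period positive for every \<kappa>. Square integrability comes out of the finite nonnegative
  integral.\<close>

lemma
  assumes g: "band_fun \<kappa> g"
  shows square_integrable_fourier_integral: "square_integrable (fourier_integral g)"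
    and plancherel_band: "(norm (L2_of (fourier_integral g)))\<^sup>2 = 2 * pi * (norm (L2_of g))\<^sup>2"
proof -
  define \<kappa>' where "\<kappa>' = max \<kappa> 1"
  define h where "h k = g (k - \<kappa>')" for k
  have sq: "square_integrable g" and gz: "\<And>k. \<kappa>' \<le> \<bar>k\<bar> \<Longrightarrow> g k = 0"
    using g by (auto simp: band_fun_def \<kappa>'_def)
  have [measurable]: "g \<in> borel_measurable borel" using sq by (rule square_integrable_measurable)
  have "integrable lborel (\<lambda>k. (\<lambda>k. (cmod (g k))\<^sup>2) (- \<kappa>' + 1 * k))"
    using sq by (intro lborel_integrable_real_affine) (auto simp: square_integrable_def)
  hence sqh: "square_integrable h" by (simp add: square_integrable_def h_def[abs_def])
  have normh: "(norm (L2_of h))\<^sup>2 = (norm (L2_of g))\<^sup>2"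
    unfolding norm_L2_of[OF sq] norm_L2_of[OF sqh]
    using lborel_integral_real_affine[of 1 "\<lambda>k. (cmod (g k))\<^sup>2" "- \<kappa>'"] by (simp add: h_def)
  have "h k = 0" if "k \<notin> cell (2 * \<kappa>') 0" for k
    using that gz[of "k - \<kappa>'"] by (auto simp: h_def cell_def abs_if)
  from plancherel_cell[OF sqh this]
  have "(\<integral>\<^sup>+x. ennreal ((cmod (fourier_integral h x))\<^sup>2) \<partial>lborel) = ennreal (2 * pi * (norm (L2_of h))\<^sup>2)"
    by (auto simp: \<kappa>'_def)
  also have "(\<lambda>x. (cmod (fourier_integral h x))\<^sup>2) = (\<lambda>x. (cmod (fourier_integral g x))\<^sup>2)"
    unfolding h_def fourier_integral_shift by (simp add: norm_mult)
  finally have nn: "(\<integral>\<^sup>+x. ennreal ((cmod (fourier_integral g x))\<^sup>2) \<partial>lborel) = ennreal (2 * pi * (norm (L2_of g))\<^sup>2)"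
    by (simp add: normh)
  have int: "integrable lborel (\<lambda>x. (cmod (fourier_integral g x))\<^sup>2)"
    using nn by (intro integrableI_bounded) simp_all
  thus sqf: "square_integrable (fourier_integral g)" by (simp add: square_integrable_def)
  have "ennreal (\<integral>x. (cmod (fourier_integral g x))\<^sup>2 \<partial>lborel) = ennreal (2 * pi * (norm (L2_of g))\<^sup>2)"
    using nn_integral_eq_integral[OF int] nn by simp
  thus "(norm (L2_of (fourier_integral g)))\<^sup>2 = 2 * pi * (norm (L2_of g))\<^sup>2"
    unfolding norm_L2_of[OF sqf] by (subst (asm) ennreal_inj) auto
qed

lemma band_fun_add: "band_fun \<kappa> f \<Longrightarrow> band_fun \<kappa> g \<Longrightarrow> band_fun \<kappa> (\<lambda>k. f k + g k)"
  by (auto simp: band_fun_def square_integrable_add)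

lemma band_fun_mult: "band_fun \<kappa> f \<Longrightarrow> band_fun \<kappa> (\<lambda>k. c * f k)"
  using square_integrable_scaleC[of f c] by (auto simp: band_fun_def scaleC_complex_def)

lemma fourier_integral_L2_add:
  assumes "band_fun \<kappa> f" "band_fun \<kappa> g"
  shows "L2_of (fourier_integral (\<lambda>k. f k + g k)) = L2_of (fourier_integral f) + L2_of (fourier_integral g)"
proof -
  have "fourier_integral (\<lambda>k. f k + g k) = (\<lambda>x. fourier_integral f x + fourier_integral g x)"
    using assms by (simp add: fun_eq_iff fourier_integral_add band_fun_integrable)
  thus ?thesis using assms by (simp add: L2_of_add square_integrable_fourier_integral)
qed

text \<open>Polarisation over the reals gives the real part. As \<open>cinner\<close> is determined
  by \<open>inner\<close> and multiplication by \<i>, the imaginary part is the same identity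
  applied to \<i> f.\<close>

lemma plancherel_band_cinner:
  assumes f: "band_fun \<kappa> f" and g: "band_fun \<kappa> g"
  shows "cinner (L2_of (fourier_integral f)) (L2_of (fourier_integral g)) = 2 * pi * cinner (L2_of f) (L2_of g)"
proof -
  have sq: "square_integrable f" "square_integrable g" using f g by (auto simp: band_fun_def)
  have inner: "inner (L2_of (fourier_integral f)) (L2_of (fourier_integral g)) = 2 * pi * inner (L2_of f) (L2_of g)"
    if f: "band_fun \<kappa> f" for f
  proof -
    have sqf: "square_integrable f" using f by (auto simp: band_fun_def)
    show ?thesis
      unfolding dot_norm fourier_integral_L2_add[OF f g, symmetric] plancherel_band[OF f] plancherel_band[OF g]
        plancherel_band[OF band_fun_add[OF f g]] L2_of_add[OF sqf sq(2)] by (simp add: field_simps)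
  qed
  have "\<i> *\<^sub>C L2_of (fourier_integral f) = L2_of (fourier_integral (\<lambda>k. \<i> * f k))"
    using square_integrable_fourier_integral[OF f]
    by (simp add: L2_of_scaleC fourier_integral_mult[abs_def] scaleC_complex_def)
  moreover have "\<i> *\<^sub>C L2_of f = L2_of (\<lambda>k. \<i> * f k)"
    using sq by (simp add: L2_of_scaleC scaleC_complex_def)
  ultimately show ?thesis
    by (simp add: cinner_eq_inner inner[OF f] inner[OF band_fun_mult[OF f]] complex_eq_iff)
qed

text \<open>Covers the exchanges of integrals below: there \<open>e\<close> is a phase of modulus
  one and the other two factors depend on one variable each, so the modulus is a product of
  integrable functions.\<close>

lemma integrable_pair_mult_bounded:
  fixes f g :: "real \<Rightarrow> complex"
  assumes f: "integrable lborel f" and g: "integrable lborel g"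
    and [measurable]: "e \<in> borel_measurable (borel \<Otimes>\<^sub>M borel)" and e: "\<And>x y. cmod (e (x, y)) \<le> 1"
  shows "integrable (lborel \<Otimes>\<^sub>M lborel) (\<lambda>(x, y). e (x, y) * (f x * g y))"
proof -
  have [measurable]: "f \<in> borel_measurable borel" "g \<in> borel_measurable borel"
    using f g by (auto dest: borel_measurable_integrable)
  have "integrable (lborel \<Otimes>\<^sub>M lborel) (\<lambda>p. f (fst p) * g (snd p))"
  proof (rule lborel_pair.Fubini_integrable)
    show "integrable lborel (\<lambda>x. LINT y|lborel. norm (f (fst (x, y)) * g (snd (x, y))))"
      using f by (simp add: norm_mult)
    show "AE x in lborel. integrable lborel (\<lambda>y. f (fst (x, y)) * g (snd (x, y)))"
      using g by simp
  qed measurable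
  thus ?thesis
  proof (rule Bochner_Integration.integrable_bound)
    have "cmod (e (x, y)) * (cmod (f x) * cmod (g y)) \<le> 1 * (cmod (f x) * cmod (g y))" for x y
      by (intro mult_right_mono e) simp
    thus "AE p in lborel \<Otimes>\<^sub>M lborel. norm (case p of (x, y) \<Rightarrow> e (x, y) * (f x * g y)) \<le> norm (f (fst p) * g (snd p))"
      by (intro AE_I2) (auto simp: norm_mult split: prod.split)
  qed measurable
qed


text \<open>Expand the square: Plancherel's identity applies to both \<open>T\<close> and \<open>g\<close>, and by Fubini the
  cross term is \<open>\<parallel>T\<parallel>\<^sup>2\<close>.\<close>

lemma fourier_inversion_error:
  fixes g T :: "real \<Rightarrow> complex"
  assumes g: "band_fun \<kappa> g"
    and T: "T = (\<lambda>q. indicator {-R..R} q * fourier_integral g q)" and "R \<ge> 0"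
  shows "square_integrable T" "square_integrable (\<lambda>k. fourier_integral T (- k) - 2 * pi * g k)"
    "(norm (L2_of (\<lambda>k. fourier_integral T (- k) - 2 * pi * g k)))\<^sup>2
      = 4 * pi\<^sup>2 * (norm (L2_of g))\<^sup>2 - 2 * pi * (norm (L2_of T))\<^sup>2"
proof -
  have sqg: "square_integrable g" using g by (simp add: band_fun_def)
  have [measurable]: "g \<in> borel_measurable borel" using sqg by (rule square_integrable_measurable)
  have sqF: "square_integrable (fourier_integral g)" by (rule square_integrable_fourier_integral[OF g])
  have Tm [measurable]: "T \<in> borel_measurable borel" unfolding T by measurable
  show sqT: "square_integrable T"
  proof (rule square_integrable_bound)
    show "integrable lborel (\<lambda>q. (cmod (fourier_integral g q))\<^sup>2)"
      using sqF by (simp add: square_integrable_def)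
  qed (auto simp: T indicator_def)
  \<comment> \<open>\<open>T\<close> lives on the closed interval [-R, R], while a band function has
    to vanish at its bound; hence \<open>R + 1\<close>.\<close>
  have bT: "band_fun (R + 1) T" using sqT \<open>R \<ge> 0\<close> by (auto simp: band_fun_def T indicator_def)
  let ?F = "\<lambda>k. fourier_integral T (- k)"
  have FT: "square_integrable (fourier_integral T)" by (rule square_integrable_fourier_integral[OF bT])
  have "integrable lborel (\<lambda>k. (\<lambda>k. (cmod (fourier_integral T k))\<^sup>2) (0 + - 1 * k))"
    using FT by (intro lborel_integrable_real_affine) (auto simp: square_integrable_def)
  hence sqF': "square_integrable ?F" by (simp add: square_integrable_def)
  have nF: "(norm (L2_of ?F))\<^sup>2 = 2 * pi * (norm (L2_of T))\<^sup>2"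
    unfolding plancherel_band[OF bT, symmetric] norm_L2_of[OF sqF'] norm_L2_of[OF FT]
    using lborel_integral_real_affine[of "- 1" "\<lambda>k. (cmod (fourier_integral T k))\<^sup>2" 0] by simp
  have sqg2: "square_integrable (\<lambda>k. 2 * pi * g k)"
    using square_integrable_scaleC[OF sqg, of "2 * pi"] by (simp add: scaleC_complex_def)
  show "square_integrable (\<lambda>k. ?F k - 2 * pi * g k)"
    by (rule square_integrable_diff[OF sqF' sqg2])
  have "cinner (L2_of g) (L2_of ?F) = (\<integral>k. cnj (g k) * ?F k \<partial>lborel)"
    by (simp add: cinner_L2_of sqg sqF' cinner_complex_def)
  also have "\<dots> = (\<integral>k. (\<integral>q. iexp (- k * q) * (cnj (g k) * T q) \<partial>lborel) \<partial>lborel)"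
    unfolding fourier_integral_def by (subst integral_mult_right_zero[symmetric]) (simp add: mult_ac)
  also have "\<dots> = (\<integral>q. (\<integral>k. iexp (- k * q) * (cnj (g k) * T q) \<partial>lborel) \<partial>lborel)"
  proof (rule lborel_pair.Fubini_integral[symmetric])
    have "integrable (lborel \<Otimes>\<^sub>M lborel) (\<lambda>(k, q). (\<lambda>(k, q). iexp (- k * q)) (k, q) * (cnj (g k) * T q))"
      by (rule integrable_pair_mult_bounded)
         (use band_fun_integrable[OF g] band_fun_integrable[OF bT] in \<open>auto simp del: of_real_mult\<close>)
    thus "integrable (lborel \<Otimes>\<^sub>M lborel) (\<lambda>(k, q). iexp (- k * q) * (cnj (g k) * T q))"
      by simp
  qed
  also have "\<dots> = (\<integral>q. cnj (fourier_integral g q) * T q \<partial>lborel)"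
  proof (rule Bochner_Integration.integral_cong[OF refl])
    fix q
    have "(\<integral>k. iexp (- k * q) * (cnj (g k) * T q) \<partial>lborel)
        = (\<integral>k. cnj (iexp (q * k) * g k) * T q \<partial>lborel)"
      by (intro Bochner_Integration.integral_cong refl) (simp add: exp_cnj mult_ac)
    also have "\<dots> = (\<integral>k. cnj (iexp (q * k) * g k) \<partial>lborel) * T q"
      by (rule integral_mult_left_zero)
    also have "(\<integral>k. cnj (iexp (q * k) * g k) \<partial>lborel) = cnj (fourier_integral g q)"
      unfolding fourier_integral_def by (rule Bochner_Integration.integral_cnj)
    finally show "(\<integral>k. iexp (- k * q) * (cnj (g k) * T q) \<partial>lborel)
      = cnj (fourier_integral g q) * T q" .
  qed
  also have "\<dots> = (\<integral>q. cnj (T q) * T q \<partial>lborel)"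
    by (intro Bochner_Integration.integral_cong refl) (auto simp: T indicator_def)
  also have "\<dots> = cinner (L2_of T) (L2_of T)"
    by (simp add: cinner_L2_of sqT cinner_complex_def)
  finally have "Re (cinner (L2_of g) (L2_of ?F)) = (norm (L2_of T))\<^sup>2"
    by (simp add: cinner_same power2_norm_eq_inner)
  hence in1: "inner (L2_of ?F) (L2_of g) = (norm (L2_of T))\<^sup>2" by (simp add: Re_cinner inner_commute)
  have "L2_of (\<lambda>k. ?F k - 2 * pi * g k) = L2_of ?F - (2 * pi) *\<^sub>R L2_of g"
    using L2_of_diff[OF sqF' sqg2] by (simp add: L2_of_scaleR sqg scaleR_conv_of_real)
  moreover have "(norm (X - r *\<^sub>R Y))\<^sup>2 = (norm X)\<^sup>2 - 2 * r * inner X Y + r\<^sup>2 * (norm Y)\<^sup>2"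
    for X Y :: "(real, complex) L2" and r
    unfolding power2_norm_eq_inner
    by (simp add: inner_diff_left inner_diff_right inner_commute[of Y X] power2_eq_square[of r] algebra_simps)
  ultimately show "(norm (L2_of (\<lambda>k. ?F k - 2 * pi * g k)))\<^sup>2
      = 4 * pi\<^sup>2 * (norm (L2_of g))\<^sup>2 - 2 * pi * (norm (L2_of T))\<^sup>2"
    using nF in1 by (simp add: power_mult_distrib)
qed

text \<open>The definition is a limit in mean over truncations, so the candidate is tested against
  the explicit error of \<open>fourier_inversion_error\<close>, which tends to a multiple of 4 pi^2
  |g|^2 - 2 pi (2 pi |g|^2) = 0 by Plancherel. The factor sqrt (2 pi / hbar) is the normalisation (2
  pi hbar)^(-1/2) times the 2 pi of the inversion.\<close>

lemma momentum_wavefunction_band: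
  assumes "hbar > 0" and g: "band_fun \<kappa> g"
    and \<Psi>: "AE x in lborel. L2_fun \<Psi> x = fourier_integral g x"
  shows "square_integrable (\<lambda>p. complex_of_real (sqrt (2 * pi / hbar)) * g (p / hbar))" (is "square_integrable ?G")
    and "momentum_wavefunction hbar \<Psi> = L2_of (\<lambda>p. complex_of_real (sqrt (2 * pi / hbar)) * g (p / hbar))"
proof -
  define c where "c = 1 / sqrt (2 * pi * hbar)"
  have c2: "c\<^sup>2 * hbar = 1 / (2 * pi)" using \<open>hbar > 0\<close> by (simp add: c_def power_divide)
  have c': "sqrt (2 * pi / hbar) = c * (2 * pi)"
    using \<open>hbar > 0\<close> by (simp add: c_def real_sqrt_divide real_sqrt_mult field_simps)
  have sqF: "square_integrable (fourier_integral g)" by (rule square_integrable_fourier_integral[OF g])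
  have sqg: "square_integrable g" using g by (simp add: band_fun_def)
  have [measurable]: "g \<in> borel_measurable borel" using sqg by (rule square_integrable_measurable)
  \<comment> \<open>The substitution p = hbar k contributes a factor hbar, which together with the
    square of \<open>c\<close> leaves 1 / (2 pi).\<close>
  have dil: "square_integrable (\<lambda>p. complex_of_real c * f (p / hbar)) \<and>
      (norm (L2_of (\<lambda>p. complex_of_real c * f (p / hbar))))\<^sup>2 = (1 / (2 * pi)) * (norm (L2_of f))\<^sup>2"
    if f: "square_integrable f" for f
  proof
    have [measurable]: "f \<in> borel_measurable borel" using f by (rule square_integrable_measurable)
    have "integrable lborel (\<lambda>p. c\<^sup>2 * (\<lambda>k. (cmod (f k))\<^sup>2) (0 + (1 / hbar) * p))"
      using f \<open>hbar > 0\<close> by (intro integrable_mult_right lborel_integrable_real_affine) (auto simp: square_integrable_def)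
    thus sq: "square_integrable (\<lambda>p. complex_of_real c * f (p / hbar))"
      by (simp add: square_integrable_def norm_mult power_mult_distrib)
    have "(\<integral>p. (cmod (f (0 + (1 / hbar) * p)))\<^sup>2 \<partial>lborel) = hbar * (\<integral>k. (cmod (f k))\<^sup>2 \<partial>lborel)"
      using lborel_integral_real_affine[of "1 / hbar" "\<lambda>k. (cmod (f k))\<^sup>2" 0] \<open>hbar > 0\<close>
      by (simp add: field_simps)
    thus "(norm (L2_of (\<lambda>p. complex_of_real c * f (p / hbar))))\<^sup>2 = (1 / (2 * pi)) * (norm (L2_of f))\<^sup>2"
      unfolding norm_L2_of[OF sq] norm_L2_of[OF f] c2[symmetric] by (simp add: norm_mult power_mult_distrib)
  qed
  have G: "?G = (\<lambda>p. complex_of_real c * (\<lambda>k. 2 * pi * g k) (p / hbar))"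
    unfolding c' by (simp add: mult_ac)
  have sqg2: "square_integrable (\<lambda>k. 2 * pi * g k)"
    using square_integrable_scaleC[OF sqg, of "2 * pi"] by (simp add: scaleC_complex_def)
  show sqG: "square_integrable ?G" unfolding G using dil[OF sqg2] by blast
  define T where "T R = (\<lambda>q. indicator {-R..R} q * fourier_integral g q)" for R :: real
  define W where "W R = L2_of (\<lambda>p. complex_of_real (1 / sqrt (2 * pi * hbar)) *
     (LINT q:{-R..R}|lborel. exp (- (\<i> * complex_of_real (p * q / hbar))) * L2_fun \<Psi> q))" for R
  have W: "W R = L2_of (\<lambda>p. complex_of_real c * (\<lambda>k. fourier_integral (T R) (- k)) (p / hbar))" for R
  proof -
    have "(LINT q:{-R..R}|lborel. exp (- (\<i> * complex_of_real (p * q / hbar))) * L2_fun \<Psi> q)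
        = fourier_integral (T R) (- (p / hbar))" for p
      unfolding set_lebesgue_integral_def fourier_integral_def
    proof (rule integral_cong_AE)
      show "AE q in lborel. indicat_real {-R..R} q *\<^sub>R (exp (- (\<i> * complex_of_real (p * q / hbar))) * L2_fun \<Psi> q)
          = iexp (- (p / hbar) * q) * T R q"
        using \<Psi> by eventually_elim (auto simp: T_def indicator_def)
    qed (auto simp: T_def)
    thus ?thesis by (simp add: W_def c_def)
  qed
  have err: "(norm (W R - L2_of ?G))\<^sup>2 = (1 / (2 * pi)) * (4 * pi\<^sup>2 * (norm (L2_of g))\<^sup>2 - 2 * pi * (norm (L2_of (T R)))\<^sup>2)"
    if "R \<ge> 0" for R
  proof -
    note inv = fourier_inversion_error[OF g T_def that]
    let ?F = "\<lambda>k. fourier_integral (T R) (- k)"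
    have sq1: "square_integrable ?F"
      using square_integrable_add[OF inv(2) sqg2] by simp
    have "W R - L2_of ?G = L2_of (\<lambda>p. complex_of_real c * (\<lambda>k. ?F k - 2 * pi * g k) (p / hbar))"
      unfolding W G using dil[OF sq1] dil[OF sqg2] by (subst L2_of_diff) (auto simp: right_diff_distrib)
    thus ?thesis using dil[OF inv(2)] inv(3) by simp
  qed
  have "((\<lambda>R. (norm (L2_of (T R)))\<^sup>2) \<longlongrightarrow> (norm (L2_of (fourier_integral g)))\<^sup>2) at_top"
  proof -
    have "((\<lambda>R. \<integral>q. (cmod (T R q))\<^sup>2 \<partial>lborel) \<longlongrightarrow> (\<integral>q. (cmod (fourier_integral g q))\<^sup>2 \<partial>lborel)) at_top"
    proof (rule integral_dominated_convergence_at_top)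
      show "integrable lborel (\<lambda>q. (cmod (fourier_integral g q))\<^sup>2)" using sqF by (simp add: square_integrable_def)
      show "\<forall>\<^sub>F R in at_top. AE q in lborel. norm ((cmod (T R q))\<^sup>2) \<le> (cmod (fourier_integral g q))\<^sup>2"
        by (intro always_eventually allI AE_I2) (auto simp: T_def indicator_def)
      show "AE q in lborel. ((\<lambda>R. (cmod (T R q))\<^sup>2) \<longlongrightarrow> (cmod (fourier_integral g q))\<^sup>2) at_top"
      proof (rule AE_I2, rule tendsto_eventually)
        fix q :: real
        show "\<forall>\<^sub>F R in at_top. (cmod (T R q))\<^sup>2 = (cmod (fourier_integral g q))\<^sup>2"
          using eventually_ge_at_top[of "\<bar>q\<bar>"] by eventually_elim (auto simp: T_def indicator_def)
      qed
    qed (auto simp: T_def)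
    moreover have "\<forall>\<^sub>F R in at_top. (\<integral>q. (cmod (T R q))\<^sup>2 \<partial>lborel) = (norm (L2_of (T R)))\<^sup>2"
      using eventually_ge_at_top[of 0] by eventually_elim (simp add: norm_L2_of fourier_inversion_error(1)[OF g T_def])
    ultimately show ?thesis unfolding norm_L2_of[OF sqF] by (rule Lim_transform_eventually)
  qed
  hence "((\<lambda>R. (1 / (2 * pi)) * (4 * pi\<^sup>2 * (norm (L2_of g))\<^sup>2 - 2 * pi * (norm (L2_of (T R)))\<^sup>2)) \<longlongrightarrow>
      (1 / (2 * pi)) * (4 * pi\<^sup>2 * (norm (L2_of g))\<^sup>2 - 2 * pi * (norm (L2_of (fourier_integral g)))\<^sup>2)) at_top"
    by (intro tendsto_mult tendsto_diff tendsto_const)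
  also have "(1 / (2 * pi)) * (4 * pi\<^sup>2 * (norm (L2_of g))\<^sup>2 - 2 * pi * (norm (L2_of (fourier_integral g)))\<^sup>2) = 0"
    unfolding plancherel_band[OF g] by (simp add: power2_eq_square)
  finally have "((\<lambda>R. (norm (W R - L2_of ?G))\<^sup>2) \<longlongrightarrow> 0) at_top"
    by (rule Lim_transform_eventually) (use err in \<open>auto intro: eventually_at_top_linorderI[of 0]\<close>)
  from tendsto_real_sqrt[OF this] have "((\<lambda>R. norm (W R - L2_of ?G)) \<longlongrightarrow> 0) at_top" by simp
  hence "(W \<longlongrightarrow> L2_of ?G) at_top" by (simp add: LIM_zero_cancel tendsto_norm_zero_iff)
  thus "momentum_wavefunction hbar \<Psi> = L2_of ?G"
    unfolding momentum_wavefunction_def W_def[symmetric] by (intro tendsto_Lim) auto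
qed

lemma momentum_limitedE:
  assumes "momentum_limited \<kappa> \<Psi>"
  obtains g where "band_fun \<kappa> g" "AE x in lborel. L2_fun \<Psi> x = fourier_integral g x"
proof -
  obtain g where g: "g \<in> borel_measurable lborel" "set_integrable lborel {-\<kappa><..<\<kappa>} (\<lambda>k. (cmod (g k))\<^sup>2)"
    and \<Psi>: "AE x in lborel. L2_fun \<Psi> x = (LINT k:{-\<kappa><..<\<kappa>}|lborel. iexp (x * k) * g k)"
    using assms by (auto simp: momentum_limited_def)
  define h where "h k = indicator {-\<kappa><..<\<kappa>} k * g k" for k
  have "square_integrable h"
    unfolding square_integrable_def
  proof
    have "(\<lambda>k. (cmod (h k))\<^sup>2) = (\<lambda>k. indicator {-\<kappa><..<\<kappa>} k *\<^sub>R (cmod (g k))\<^sup>2)"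
      by (auto simp: h_def indicator_def)
    thus "integrable lborel (\<lambda>k. (cmod (h k))\<^sup>2)" using g(2) by (simp add: set_integrable_def)
  qed (use g(1) in \<open>simp add: h_def[abs_def]\<close>)
  hence "band_fun \<kappa> h" by (auto simp: band_fun_def h_def indicator_def)
  moreover have "(LINT k:{-\<kappa><..<\<kappa>}|lborel. iexp (x * k) * g k) = fourier_integral h x" for x
    unfolding set_lebesgue_integral_def fourier_integral_def
    by (intro Bochner_Integration.integral_cong) (auto simp: h_def indicator_def)
  ultimately show thesis using that \<Psi> by simp
qed

section \<open>Sheared products of Schwartz functions\<close>

text \<open>The j-th derivative in b of G1^(i)(q - \<tau> b) G2^(m)(b), where \<open>G1\<close> and
  \<open>G2\<close> are sequences of successive derivatives. The indices \<open>i\<close> and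
  \<open>m\<close> are carried along because each derivative in b raises one of them, and a
  derivative in q raises \<open>i\<close>.\<close>

fun sheared_deriv :: "(nat \<Rightarrow> real \<Rightarrow> complex) \<Rightarrow> (nat \<Rightarrow> real \<Rightarrow> complex) \<Rightarrow> real \<Rightarrow>
    nat \<Rightarrow> nat \<Rightarrow> nat \<Rightarrow> real \<times> real \<Rightarrow> complex" where
  "sheared_deriv G1 G2 \<tau> 0 i m = (\<lambda>x. G1 i (fst x - \<tau> * snd x) * G2 m (snd x))"
| "sheared_deriv G1 G2 \<tau> (Suc j) i m =
    (\<lambda>x. (- \<tau>) *\<^sub>R sheared_deriv G1 G2 \<tau> j (Suc i) m x + sheared_deriv G1 G2 \<tau> j i (Suc m) x)"

lemma sheared_deriv_has_derivative:
  assumes d1: "\<And>i x. (G1 i has_vector_derivative G1 (Suc i) x) (at x)"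
    and d2: "\<And>i x. (G2 i has_vector_derivative G2 (Suc i) x) (at x)"
  shows "(sheared_deriv G1 G2 \<tau> j i m has_derivative
    (\<lambda>(u, v). u *\<^sub>R sheared_deriv G1 G2 \<tau> j (Suc i) m x + v *\<^sub>R sheared_deriv G1 G2 \<tau> (Suc j) i m x)) (at x)"
proof (induction j arbitrary: i m)
  case 0
  have l1: "((\<lambda>x::real \<times> real. fst x - \<tau> * snd x) has_derivative (\<lambda>h. fst h - \<tau> * snd h)) (at x)"
    by (auto intro!: derivative_eq_intros)
  have l2: "((\<lambda>x::real \<times> real. snd x) has_derivative snd) (at x)"
    by (auto intro!: derivative_eq_intros)
  have 1: "((\<lambda>x. G1 i (fst x - \<tau> * snd x)) has_derivative
      (\<lambda>h. (fst h - \<tau> * snd h) *\<^sub>R G1 (Suc i) (fst x - \<tau> * snd x))) (at x)"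
    using has_derivative_compose[OF l1 d1[of i, unfolded has_vector_derivative_def]] .
  have 2: "((\<lambda>x. G2 m (snd x)) has_derivative (\<lambda>h. snd h *\<^sub>R G2 (Suc m) (snd x))) (at x)"
    using has_derivative_compose[OF l2 d2[of m, unfolded has_vector_derivative_def]] .
  show ?case
    by (rule has_derivative_eq_rhs[OF has_derivative_mult[OF 1 2, folded sheared_deriv.simps(1)]])
       (auto simp: fun_eq_iff scaleR_conv_of_real algebra_simps)
next
  case (Suc j)
  show ?case
    unfolding sheared_deriv.simps(2)[of G1 G2 \<tau> j i m]
    by (rule has_derivative_eq_rhs[OF has_derivative_add[OF has_derivative_scaleR_right[OF Suc.IH] Suc.IH]])
       (auto simp: fun_eq_iff scaleR_conv_of_real algebra_simps)
qed

lemma bounded_range_add: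
  fixes f g :: "'a \<Rightarrow> 'b::real_normed_vector"
  assumes "bounded (range f)" "bounded (range g)"
  shows "bounded (range (\<lambda>x. f x + g x))"
proof -
  obtain B C where "\<And>x. norm (f x) \<le> B" "\<And>x. norm (g x) \<le> C"
    using assms unfolding bounded_iff by blast
  hence "norm (f x + g x) \<le> B + C" for x by (meson add_mono norm_triangle_ineq order_trans)
  thus ?thesis unfolding bounded_iff by blast
qed

lemma bounded_range_scaleR:
  fixes f :: "'a \<Rightarrow> 'b::real_normed_vector"
  assumes "bounded (range f)"
  shows "bounded (range (\<lambda>x. r *\<^sub>R f x))"
  using bounded_scaling[OF assms, of r] by (simp add: image_image)

text \<open>A power of q is removed through q = (q - \<tau> b) + \<tau> b, which trades it for a
  power of the argument of \<open>G1\<close> or of \<open>G2\<close>; the exponent \<open>d\<close>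
  of the inner induction records the former.\<close>

lemma sheared_deriv_bounded:
  assumes b1: "\<And>i d. bounded (range (\<lambda>y. complex_of_real (y ^ d) * G1 i y))"
    and b2: "\<And>i d. bounded (range (\<lambda>y. complex_of_real (y ^ d) * G2 i y))"
  shows "bounded (range (\<lambda>x. complex_of_real (fst x ^ n * snd x ^ l) * sheared_deriv G1 G2 \<tau> j i m x))"
proof (induction j arbitrary: i m)
  case 0
  have "bounded (range (\<lambda>x. complex_of_real ((fst x - \<tau> * snd x) ^ d * fst x ^ n * snd x ^ l)
      * (G1 i (fst x - \<tau> * snd x) * G2 m (snd x))))" for d l
  proof (induction n arbitrary: d l)
    case 0
    obtain B1 where B1: "\<And>y. cmod (complex_of_real (y ^ d) * G1 i y) \<le> B1"
      using b1[of d i] unfolding bounded_iff by blast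
    obtain B2 where B2: "\<And>y. cmod (complex_of_real (y ^ l) * G2 m y) \<le> B2"
      using b2[of l m] unfolding bounded_iff by blast
    have "cmod (complex_of_real ((fst x - \<tau> * snd x) ^ d * fst x ^ 0 * snd x ^ l)
      * (G1 i (fst x - \<tau> * snd x) * G2 m (snd x))) \<le> B1 * B2" for x
    proof -
      have "cmod (complex_of_real ((fst x - \<tau> * snd x) ^ d * fst x ^ 0 * snd x ^ l)
          * (G1 i (fst x - \<tau> * snd x) * G2 m (snd x)))
          = cmod (complex_of_real ((fst x - \<tau> * snd x) ^ d) * G1 i (fst x - \<tau> * snd x))
            * cmod (complex_of_real (snd x ^ l) * G2 m (snd x))"
        by (simp only: norm_mult[symmetric] of_real_mult power_0 of_real_1 mult_1_left mult_1_right mult_ac)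
      also have "\<dots> \<le> B1 * B2"
        by (intro mult_mono B1 B2 norm_ge_zero order_trans[OF norm_ge_zero B1])
      finally show ?thesis .
    qed
    thus ?case unfolding bounded_iff by blast
  next
    case (Suc n)
    have eq: "(\<lambda>x. complex_of_real ((fst x - \<tau> * snd x) ^ d * fst x ^ Suc n * snd x ^ l)
      * (G1 i (fst x - \<tau> * snd x) * G2 m (snd x)))
      = (\<lambda>x. complex_of_real ((fst x - \<tau> * snd x) ^ Suc d * fst x ^ n * snd x ^ l)
      * (G1 i (fst x - \<tau> * snd x) * G2 m (snd x)) + \<tau> *\<^sub>R (complex_of_real ((fst x - \<tau> * snd x) ^ d * fst x ^ n * snd x ^ Suc l)
      * (G1 i (fst x - \<tau> * snd x) * G2 m (snd x))))"
      by (simp add: fun_eq_iff scaleR_conv_of_real algebra_simps)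
    show ?case unfolding eq by (rule bounded_range_add[OF Suc bounded_range_scaleR[OF Suc]])
  qed
  from this[of 0] show ?case by simp
next
  case (Suc j)
  show ?case
    unfolding sheared_deriv.simps(2) distrib_left mult_scaleR_right
    by (rule bounded_range_add[OF bounded_range_scaleR[OF Suc.IH] Suc.IH])
qed

lemma schwartz_sheared:
  assumes "\<And>i x. (G1 i has_vector_derivative G1 (Suc i) x) (at x)"
    and "\<And>i x. (G2 i has_vector_derivative G2 (Suc i) x) (at x)"
    and "\<And>i d. bounded (range (\<lambda>y. complex_of_real (y ^ d) * G1 i y))"
    and "\<And>i d. bounded (range (\<lambda>y. complex_of_real (y ^ d) * G2 i y))"
  shows "schwartz (\<lambda>x. G1 0 (fst x - \<tau> * snd x) * G2 0 (snd x))"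
  unfolding schwartz_def
proof (intro exI[of _ "\<lambda>i j. sheared_deriv G1 G2 \<tau> j i 0"] conjI allI)
  show "(sheared_deriv G1 G2 \<tau> j i 0 has_derivative
    (\<lambda>(u, v). u *\<^sub>R sheared_deriv G1 G2 \<tau> j (Suc i) 0 x + v *\<^sub>R sheared_deriv G1 G2 \<tau> (Suc j) i 0 x)) (at x)" for i j x
    by (rule sheared_deriv_has_derivative[of G1 G2, OF assms(1,2)])
  show "bounded (range (\<lambda>(q, b). complex_of_real (q ^ m * b ^ n) * sheared_deriv G1 G2 \<tau> j i 0 (q, b)))" for i j m n
    using sheared_deriv_bounded[of G1 G2, OF assms(3,4), of m n \<tau> j i 0]
    by (simp add: case_prod_beta')
qed simp

lemma schwartz_zero: "schwartz (\<lambda>x. 0)"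
  unfolding schwartz_def
  by (intro exI[of _ "\<lambda>i j x. 0"]) (auto intro!: derivative_eq_intros simp: bounded_iff)

text \<open>Up to the sign (-1)^i these are the probabilists' Hermite polynomials, evaluated at x -
  \<i> u.\<close>

fun gauss_poly :: "real \<Rightarrow> nat \<Rightarrow> complex poly" where
  "gauss_poly u 0 = 1"
| "gauss_poly u (Suc i) = pderiv (gauss_poly u i) + gauss_poly u i * [:\<i> * complex_of_real u, - 1:]"

definition gauss_deriv :: "complex \<Rightarrow> real \<Rightarrow> nat \<Rightarrow> real \<Rightarrow> complex" where
  "gauss_deriv c u i x = poly (gauss_poly u i) (complex_of_real x) * gauss_fun c u x"

lemma gauss_deriv_0 [simp]: "gauss_deriv c u 0 = gauss_fun c u"
  by (simp add: gauss_deriv_def fun_eq_iff)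

lemma gauss_deriv_has_vector_derivative:
  "(gauss_deriv c u i has_vector_derivative gauss_deriv c u (Suc i) x) (at x)"
proof -
  define p where "p = gauss_poly u i"
  have "((\<lambda>z. poly p z * (c * exp (- (z\<^sup>2 / 2) + \<i> * complex_of_real u * z))) has_field_derivative
     poly (pderiv p + p * [:\<i> * complex_of_real u, - 1:]) (complex_of_real x) *
      (c * exp (- ((complex_of_real x)\<^sup>2 / 2) + \<i> * complex_of_real u * complex_of_real x))) (at (complex_of_real x))"
    by (auto intro!: derivative_eq_intros poly_DERIV simp: algebra_simps)
  from has_vector_derivative_real_field[OF this]
  show ?thesis
    by (simp add: gauss_deriv_def[abs_def] gauss_fun_def[abs_def] p_def mult.assoc)
qed

text \<open>This is (1 + y / n)^n \<le> e^y with y = x^2 / 2, after pulling out a factor 2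
  n.\<close>

lemma one_plus_square_power_le: "(1 + x\<^sup>2) ^ n \<le> real (2 * n) ^ n * exp (x\<^sup>2 / 2)"
proof (cases "n = 0")
  case False
  have "(1 + x\<^sup>2) ^ n \<le> (real (2 * n) * (1 + (x\<^sup>2 / 2) / real n)) ^ n"
    using False by (intro power_mono) (auto simp: field_simps intro!: add_mono)
  also have "\<dots> = real (2 * n) ^ n * (1 + (x\<^sup>2 / 2) / real n) ^ n" by (rule power_mult_distrib)
  also have "\<dots> \<le> real (2 * n) ^ n * exp (x\<^sup>2 / 2)"
    using False by (intro mult_left_mono exp_ge_one_plus_x_over_n_power_n) (auto intro: order_trans[of _ 0])
  finally show ?thesis .
qed simp

lemma abs_le_one_plus_square: "\<bar>x::real\<bar> \<le> 1 + x\<^sup>2"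
proof -
  have "0 \<le> (\<bar>x\<bar> - 1)\<^sup>2" by simp
  hence "2 * \<bar>x\<bar> \<le> 1 + x\<^sup>2" by (simp add: power2_diff)
  thus ?thesis by simp
qed

lemma poly_growth: "\<exists>K n. K \<ge> 0 \<and> (\<forall>x. cmod (poly p (complex_of_real x)) \<le> K * (1 + x\<^sup>2) ^ n)"
proof (induction p)
  case 0
  show ?case by (intro exI[of _ 0]) auto
next
  case (pCons a p)
  then obtain K n where K: "K \<ge> 0" "\<And>x. cmod (poly p (complex_of_real x)) \<le> K * (1 + x\<^sup>2) ^ n" by blast
  have "cmod (poly (pCons a p) (complex_of_real x)) \<le> (cmod a + K) * (1 + x\<^sup>2) ^ Suc n" for x
  proof -
    have "cmod (poly (pCons a p) (complex_of_real x)) \<le> cmod a + \<bar>x\<bar> * cmod (poly p (complex_of_real x))"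
      using norm_triangle_ineq[of a "complex_of_real x * poly p (complex_of_real x)"] by (simp add: norm_mult)
    also have "\<dots> \<le> cmod a * (1 + x\<^sup>2) ^ Suc n + (1 + x\<^sup>2) * (K * (1 + x\<^sup>2) ^ n)"
    proof (intro add_mono mult_mono abs_le_one_plus_square K)
      have "(1::real) \<le> (1 + x\<^sup>2) ^ Suc n" by (rule one_le_power) simp
      thus "cmod a \<le> cmod a * (1 + x\<^sup>2) ^ Suc n" using mult_left_mono[of 1 _ "cmod a"] by fastforce
    qed auto
    also have "\<dots> = (cmod a + K) * (1 + x\<^sup>2) ^ Suc n" by (simp add: algebra_simps)
    finally show ?thesis .
  qed
  thus ?case using K by (intro exI[of _ "cmod a + K"] exI[of _ "Suc n"]) auto
qed

lemma gauss_deriv_bounded: "bounded (range (\<lambda>y. complex_of_real (y ^ d) * gauss_deriv c u i y))"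
proof -
  obtain K n where K: "K \<ge> 0" "\<And>x. cmod (poly (monom 1 d * gauss_poly u i) (complex_of_real x)) \<le> K * (1 + x\<^sup>2) ^ n"
    using poly_growth by blast
  have "cmod (complex_of_real (y ^ d) * gauss_deriv c u i y) \<le> K * real (2 * n) ^ n * cmod c" for y
  proof -
    have "cmod (complex_of_real (y ^ d) * gauss_deriv c u i y)
        = cmod (poly (monom 1 d * gauss_poly u i) (complex_of_real y)) * (cmod c * exp (- (y\<^sup>2 / 2)))"
      by (simp add: gauss_deriv_def norm_mult norm_gauss_fun poly_monom norm_power)
    also have "\<dots> \<le> (K * (real (2 * n) ^ n * exp (y\<^sup>2 / 2))) * (cmod c * exp (- (y\<^sup>2 / 2)))"
    proof (rule mult_right_mono)
      show "cmod (poly (monom 1 d * gauss_poly u i) (complex_of_real y)) \<le> K * (real (2 * n) ^ n * exp (y\<^sup>2 / 2))"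
        using K(2)[of y] mult_left_mono[OF one_plus_square_power_le[of y n] K(1)] by linarith
    qed simp
    also have "\<dots> = K * real (2 * n) ^ n * cmod c"
      by (simp add: exp_minus field_simps)
    finally show ?thesis .
  qed
  thus ?thesis unfolding bounded_iff by blast
qed

section \<open>Dominated differentiation\<close>

text \<open>By the mean value inequality the normalised remainder is bounded by 2 w, uniformly in
  the increment, and it tends to 0 pointwise; dominated convergence in L^2 gives the strong
  derivative. The limit is expressed by sequences because that convergence theorem is about
  sequences.\<close>

lemma L2_has_vector_derivative:
  fixes f f' :: "real \<Rightarrow> 'x::euclidean_space \<Rightarrow> 's::{complex_inner, euclidean_space}"
  assumes t: "t \<in> {a..b}"
    and f: "\<And>s. s \<in> {a..b} \<Longrightarrow> square_integrable (f s)" and f': "square_integrable (f' t)"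
    and der: "\<And>s x. s \<in> {a..b} \<Longrightarrow> ((\<lambda>s. f s x) has_vector_derivative f' s x) (at s within {a..b})"
    and bound: "\<And>s x. s \<in> {a..b} \<Longrightarrow> norm (f' s x) \<le> w x"
    and w: "integrable lborel (\<lambda>x. (w x)\<^sup>2)"
  shows "((\<lambda>s. L2_of (f s)) has_vector_derivative L2_of (f' t)) (at t within {a..b})"
  unfolding has_vector_derivative_def has_derivative_within tendsto_at_iff_sequentially
proof (intro conjI allI impI)
  show "bounded_linear (\<lambda>x. x *\<^sub>R L2_of (f' t))" by (rule bounded_linear_scaleR_left)
  fix X :: "nat \<Rightarrow> real" assume X: "\<forall>i. X i \<in> {a..b} - {t}" "X \<longlonglongrightarrow> t"
  define r where "r n x = (1 / norm (X n - t)) *\<^sub>R (f (X n) x - (f t x + (X n - t) *\<^sub>R f' t x))" for n x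
  have Xab: "X n \<in> {a..b}" "X n \<noteq> t" for n using X by auto
  have sq1: "square_integrable (\<lambda>x. f t x + (X n - t) *\<^sub>R f' t x)" for n
    by (intro square_integrable_add square_integrable_scaleR f f' t)
  have sqr: "square_integrable (r n)" for n
    unfolding r_def by (intro square_integrable_scaleR square_integrable_diff sq1 f Xab)
  have eq: "(1 / norm (X n - t)) *\<^sub>R (L2_of (f (X n)) - (L2_of (f t) + (X n - t) *\<^sub>R L2_of (f' t))) = L2_of (r n)" for n
    unfolding r_def using f[OF Xab(1)[of n]] f[OF t] f' sq1[of n]
    by (simp only: L2_of_scaleR L2_of_add square_integrable_scaleR L2_of_diff square_integrable_diff)
  have "(\<lambda>n. L2_of (r n)) \<longlonglongrightarrow> L2_of (\<lambda>x. 0)"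
  proof (rule L2_dominated_convergence)
    show "integrable lborel (\<lambda>x. (2 * w x)\<^sup>2)" using w by (simp add: power_mult_distrib)
    show "r n \<in> borel_measurable borel" for n by (rule square_integrable_measurable[OF sqr])
    show "AE x in lborel. norm (r n x) \<le> 2 * w x" for n
    proof (rule AE_I2)
      fix x
      have "norm (f (X n) x - f t x) \<le> w x * norm (X n - t)"
      proof (rule differentiable_bound[of "{a..b}" "\<lambda>s. f s x" "\<lambda>s h. h *\<^sub>R f' s x"])
        fix s assume s: "s \<in> {a..b}"
        show "((\<lambda>s. f s x) has_derivative (\<lambda>h. h *\<^sub>R f' s x)) (at s within {a..b})"
          using der[OF s] by (simp add: has_vector_derivative_def)
        show "onorm (\<lambda>h. h *\<^sub>R f' s x) \<le> w x"
        proof (rule onorm_le)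
          fix h :: real
          show "norm (h *\<^sub>R f' s x) \<le> w x * norm h"
            using mult_right_mono[OF bound[OF s, of x], of "norm h"] by (simp add: mult.commute)
        qed
      qed (use t Xab in auto)
      moreover have "norm ((X n - t) *\<^sub>R f' t x) \<le> w x * norm (X n - t)"
        using mult_right_mono[OF bound[OF t, of x], of "norm (X n - t)"] by (simp add: mult.commute)
      ultimately have "norm (f (X n) x - f t x - (X n - t) *\<^sub>R f' t x) \<le> (2 * w x) * norm (X n - t)"
        using norm_triangle_ineq4[of "f (X n) x - f t x" "(X n - t) *\<^sub>R f' t x"] by linarith
      hence "norm (f (X n) x - (f t x + (X n - t) *\<^sub>R f' t x)) / norm (X n - t) \<le> 2 * w x"
        using Xab(2)[of n] by (simp only: diff_diff_eq) (simp add: pos_divide_le_eq)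
      thus "norm (r n x) \<le> 2 * w x" by (simp add: r_def)
    qed
    show "AE x in lborel. (\<lambda>n. r n x) \<longlonglongrightarrow> 0"
    proof (rule AE_I2)
      fix x
      from der[OF t, of x, unfolded has_vector_derivative_def has_derivative_within tendsto_at_iff_sequentially]
      have "((\<lambda>y. (1 / norm (y - t)) *\<^sub>R (f y x - (f t x + (y - t) *\<^sub>R f' t x))) \<circ> X) \<longlonglongrightarrow> 0"
        using X by blast
      thus "(\<lambda>n. r n x) \<longlonglongrightarrow> 0" by (simp add: r_def o_def)
    qed
  qed simp
  moreover have "L2_of (\<lambda>x. 0) = (0 :: ('x, 's) L2)" by (simp add: zero_L2.abs_eq)
  ultimately show "((\<lambda>y. (1 / norm (y - t)) *\<^sub>R (L2_of (f y) - (L2_of (f t) + (y - t) *\<^sub>R L2_of (f' t)))) \<circ> X) \<longlonglongrightarrow> 0"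
    unfolding o_def eq by simp
qed

text \<open>A majorant for all shears with |\<tau>| \<le> T at once, with the width chosen for the
  worst case; the constants come from \<open>le_gauss_envelope\<close>.\<close>

definition gauss_envelope :: "real \<Rightarrow> real \<Rightarrow> real \<times> real \<Rightarrow> real" where
  "gauss_envelope K T x = K * (exp (- ((fst x)\<^sup>2 / (4 * (3 + 2 * T\<^sup>2)))) * exp (- ((snd x)\<^sup>2 / (4 * (3 + 2 * T\<^sup>2)))))"

lemma gauss_envelope_integrable: "integrable lborel (\<lambda>x. (gauss_envelope K T x)\<^sup>2)"
proof -
  define e where "e = 1 / (4 * (3 + 2 * T\<^sup>2))"
  have "e > 0" by (simp add: e_def add_pos_nonneg)
  let ?g = "\<lambda>y::real. complex_of_real (exp (- (e * y\<^sup>2)))"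
  have "integrable lborel (\<lambda>y. exp (- (2 * e * y\<^sup>2)))"
    using \<open>e > 0\<close> by (intro integrable_exp_neg_sq) simp
  hence sq: "square_integrable ?g"
    by (simp add: square_integrable_def mult.assoc flip: exp_double)
  have "integrable lborel (\<lambda>x. K\<^sup>2 * (cmod (?g (fst x) *\<^sub>C ?g (snd x)))\<^sup>2)"
    using square_integrable_probe_tensor[OF sq sq] by (simp add: square_integrable_def)
  moreover have "(gauss_envelope K T x)\<^sup>2 = K\<^sup>2 * (cmod (?g (fst x) *\<^sub>C ?g (snd x)))\<^sup>2" for x
    by (simp add: gauss_envelope_def scaleC_complex_def norm_mult power_mult_distrib e_def)
  ultimately show ?thesis by simp
qed

text \<open>Half of each Gaussian pays for the polynomial: 1 + z^2 \<le> 4 e^(z^2 / 4), used twice,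
  gives the 16. The other half is rewritten in the unsheared coordinates through q^2 + b^2 \<le> (3
  + 2 T^2) (y^2 + b^2).\<close>

lemma le_gauss_envelope:
  assumes "\<bar>\<tau>\<bar> \<le> T" "K \<ge> 0"
  shows "K * (1 + (q - \<tau> * b)\<^sup>2) * (1 + b\<^sup>2) * (exp (- ((q - \<tau> * b)\<^sup>2 / 2)) * exp (- (b\<^sup>2 / 2)))
    \<le> gauss_envelope (16 * K) T (q, b)"
proof -
  define y where "y = q - \<tau> * b"
  define D where "D = 3 + 2 * T\<^sup>2"
  have D: "D > 0" by (simp add: D_def add_pos_nonneg)
  have poly: "1 + z\<^sup>2 \<le> 4 * exp (z\<^sup>2 / 4)" for z :: real
    using exp_ge_add_one_self[of "z\<^sup>2 / 4"] by linarith
  have "q\<^sup>2 \<le> 2 * y\<^sup>2 + 2 * (\<tau> * b)\<^sup>2"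
    using sum_squares_bound[of y "\<tau> * b"] by (simp add: y_def power2_eq_square algebra_simps)
  also have "(\<tau> * b)\<^sup>2 \<le> T\<^sup>2 * b\<^sup>2"
    using power_mono[OF assms(1), of 2] by (simp add: power_mult_distrib mult_right_mono)
  finally have "q\<^sup>2 + b\<^sup>2 \<le> 2 * y\<^sup>2 + 2 * (T\<^sup>2 * b\<^sup>2) + b\<^sup>2" by simp
  also have "\<dots> \<le> D * (y\<^sup>2 + b\<^sup>2)"
    unfolding D_def by (simp add: algebra_simps)
  finally have "q\<^sup>2 / (4 * D) + b\<^sup>2 / (4 * D) \<le> y\<^sup>2 / 4 + b\<^sup>2 / 4"
    using D by (simp add: field_simps)
  hence e: "exp (- (y\<^sup>2 / 4)) * exp (- (b\<^sup>2 / 4)) \<le> exp (- (q\<^sup>2 / (4 * D))) * exp (- (b\<^sup>2 / (4 * D)))"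
    unfolding exp_add[symmetric] exp_le_cancel_iff by linarith
  have half: "exp (z\<^sup>2 / 4) * exp (- (z\<^sup>2 / 2)) = exp (- (z\<^sup>2 / 4))" for z :: real
    by (simp add: exp_add[symmetric])
  have "K * (1 + y\<^sup>2) * (1 + b\<^sup>2) * (exp (- (y\<^sup>2 / 2)) * exp (- (b\<^sup>2 / 2)))
      \<le> K * (4 * exp (y\<^sup>2 / 4)) * (4 * exp (b\<^sup>2 / 4)) * (exp (- (y\<^sup>2 / 2)) * exp (- (b\<^sup>2 / 2)))"
    using assms(2) by (intro mult_right_mono mult_mono mult_left_mono poly) auto
  also have "\<dots> = 16 * K * ((exp (y\<^sup>2 / 4) * exp (- (y\<^sup>2 / 2))) * (exp (b\<^sup>2 / 4) * exp (- (b\<^sup>2 / 2))))" by simp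
  also have "\<dots> = 16 * K * (exp (- (y\<^sup>2 / 4)) * exp (- (b\<^sup>2 / 4)))" by (simp only: half)
  also have "\<dots> \<le> 16 * K * (exp (- (q\<^sup>2 / (4 * D))) * exp (- (b\<^sup>2 / (4 * D))))"
    using assms(2) by (intro mult_left_mono e) auto
  finally show ?thesis by (simp add: gauss_envelope_def y_def D_def)
qed

section \<open>Tensor products\<close>

lemma vtensor_add_right: "u \<otimes>\<^sub>v (f + g) = u \<otimes>\<^sub>v f + u \<otimes>\<^sub>v g"
  by transfer (auto simp: L2_rel_def scaleC_add_left square_integrable_vtensor square_integrable_add)

lemma square_integrable_vtensor_mult:
  "square_integrable f \<Longrightarrow> square_integrable (\<lambda>x. (c * f x) *\<^sub>C u)"
  using square_integrable_scaleC[OF square_integrable_vtensor, of f c u] by (simp add: scaleC_scaleC)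

lemma vtensor_scaleC_right: "u \<otimes>\<^sub>v (c *\<^sub>C f) = c *\<^sub>C (u \<otimes>\<^sub>v f)"
  by transfer (auto simp: L2_rel_def scaleC_scaleC scaleC_complex_def square_integrable_vtensor_mult)

lemma vtensor_scaleC_left: "(c *\<^sub>C u) \<otimes>\<^sub>v f = c *\<^sub>C (u \<otimes>\<^sub>v f)"
  by transfer (auto simp: L2_rel_def scaleC_scaleC mult.commute square_integrable_vtensor_mult)

lemma vtensor_add_left: "(u + v) \<otimes>\<^sub>v f = u \<otimes>\<^sub>v f + v \<otimes>\<^sub>v f"
  by transfer (auto simp: L2_rel_def scaleC_add_right square_integrable_vtensor square_integrable_add)

lemma norm_vtensor: "norm (u \<otimes>\<^sub>v f) = norm u * norm f"
proof -
  have "(norm (u \<otimes>\<^sub>v L2_of (L2_fun f)))\<^sup>2 = (norm u * norm (L2_of (L2_fun f)))\<^sup>2"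
    by (subst vtensor_L2_of)
       (simp_all only: square_integrable_L2_fun norm_L2_of square_integrable_vtensor norm_scaleC
         power_mult_distrib integral_mult_left_zero mult.commute[of "(norm u)\<^sup>2"])
  thus ?thesis by (simp add: power2_eq_iff_nonneg)
qed

lemma bounded_bilinear_vtensor:
  "bounded_bilinear (vtensor :: 's \<Rightarrow> _ \<Rightarrow> ('x::euclidean_space, 's::{complex_inner, euclidean_space}) L2)"
proof
  fix u :: 's and f :: "('x, complex) L2" and r :: real
  show "(r *\<^sub>R u) \<otimes>\<^sub>v f = r *\<^sub>R (u \<otimes>\<^sub>v f)" "u \<otimes>\<^sub>v (r *\<^sub>R f) = r *\<^sub>R (u \<otimes>\<^sub>v f)"
    by (simp_all add: vtensor_scaleC_right vtensor_scaleC_left flip: scaleC_of_real)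
  show "\<exists>K. \<forall>(u :: 's) (f :: ('x, complex) L2). norm (u \<otimes>\<^sub>v f) \<le> norm u * norm f * K"
    by (rule exI[of _ 1]) (simp add: norm_vtensor)
qed (simp_all add: vtensor_add_right vtensor_add_left)

interpretation vtensor_bl: bounded_bilinear "vtensor :: 's \<Rightarrow> _ \<Rightarrow> ('x::euclidean_space, 's::{complex_inner, euclidean_space}) L2"
  by (rule bounded_bilinear_vtensor)

lemma probe_tensor_add_left: "probe_tensor (f + g) w = probe_tensor f w + probe_tensor g w"
  by transfer (auto simp: L2_rel_def scaleC_add_left square_integrable_probe_tensor square_integrable_add)

lemma probe_tensor_add_right: "probe_tensor f (v + w) = probe_tensor f v + probe_tensor f w"
  by transfer (auto simp: L2_rel_def scaleC_add_right square_integrable_probe_tensor square_integrable_add)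

lemma square_integrable_probe_tensor_mult:
  "square_integrable f \<Longrightarrow> square_integrable w \<Longrightarrow>
    square_integrable (\<lambda>x::real \<times> real. (c * f (fst x)) *\<^sub>C w (snd x))"
  using square_integrable_scaleC[OF square_integrable_probe_tensor, of f w c] by (simp add: scaleC_scaleC)

lemma probe_tensor_scaleC_left: "probe_tensor (c *\<^sub>C f) w = c *\<^sub>C probe_tensor f w"
  by transfer (auto simp: L2_rel_def scaleC_scaleC scaleC_complex_def square_integrable_probe_tensor_mult)

lemma probe_tensor_scaleC_right: "probe_tensor f (c *\<^sub>C w) = c *\<^sub>C probe_tensor f w"
  by transfer (auto simp: L2_rel_def scaleC_scaleC mult.commute square_integrable_probe_tensor_mult)

lemma probe_tensor_vtensor: "probe_tensor f (u \<otimes>\<^sub>v g) = u \<otimes>\<^sub>v probe_tensor f g"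
proof transfer
  fix f g :: "real \<Rightarrow> complex" and u :: 'a
  assume "L2_rel f f" "L2_rel g g"
  hence "square_integrable (\<lambda>x::real \<times> real. f (fst x) *\<^sub>C (g (snd x) *\<^sub>C u))"
    by (intro square_integrable_probe_tensor square_integrable_vtensor) auto
  thus "L2_rel (\<lambda>x::real \<times> real. f (fst x) *\<^sub>C (g (snd x) *\<^sub>C u)) (\<lambda>x. (f (fst x) *\<^sub>C g (snd x)) *\<^sub>C u)"
    by (simp add: scaleC_scaleC scaleC_complex_def)
qed

lemma norm_probe_tensor: "norm (probe_tensor f w) = norm f * norm w"
proof -
  define F where "F = L2_fun f" define W where "W = L2_fun w"
  have sq: "square_integrable F" "square_integrable W" by (simp_all add: F_def W_def)
  have [measurable]: "F \<in> borel_measurable borel" "W \<in> borel_measurable borel"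
    using sq by (auto intro: square_integrable_measurable)
  have "(norm (probe_tensor (L2_of F) (L2_of W)))\<^sup>2 = (\<integral>x. (cmod (F (fst x)))\<^sup>2 * (norm (W (snd x)))\<^sup>2 \<partial>lborel)"
    by (simp only: sq probe_tensor_L2_of norm_L2_of square_integrable_probe_tensor norm_scaleC power_mult_distrib)
  also have "\<dots> = (\<integral>x. (\<integral>y. (cmod (F (fst (x, y))))\<^sup>2 * (norm (W (snd (x, y))))\<^sup>2 \<partial>lborel) \<partial>lborel)"
    unfolding lborel_prod[symmetric]
  proof (rule lborel_pair.integral_fst'[symmetric])
    show "integrable (lborel \<Otimes>\<^sub>M lborel) (\<lambda>x. (cmod (F (fst x)))\<^sup>2 * (norm (W (snd x)))\<^sup>2)"
      using square_integrable_probe_tensor[OF sq]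
      by (simp add: square_integrable_def lborel_prod norm_scaleC power_mult_distrib)
  qed
  also have "\<dots> = (norm (L2_of F))\<^sup>2 * (norm (L2_of W))\<^sup>2"
    by (simp add: norm_L2_of sq)
  finally have "(norm (probe_tensor f w))\<^sup>2 = (norm f * norm w)\<^sup>2"
    by (simp add: F_def W_def power_mult_distrib)
  thus ?thesis by (simp add: power2_eq_iff_nonneg)
qed

lemma bounded_bilinear_probe_tensor:
  "bounded_bilinear (probe_tensor :: _ \<Rightarrow> (real, 's::{complex_inner, euclidean_space}) L2 \<Rightarrow> _)"
proof
  show "probe_tensor (r *\<^sub>R f) w = r *\<^sub>R probe_tensor f w" for r f and w :: "(real, 's) L2"
    by (simp add: probe_tensor_scaleC_left flip: scaleC_of_real)
  show "probe_tensor f (r *\<^sub>R w) = r *\<^sub>R probe_tensor f w" for r f and w :: "(real, 's) L2"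
    by (simp add: probe_tensor_scaleC_right flip: scaleC_of_real)
  show "\<exists>K. \<forall>f (w :: (real, 's) L2). norm (probe_tensor f w) \<le> norm f * norm w * K"
    by (rule exI[of _ 1]) (simp add: norm_probe_tensor)
qed (simp_all add: probe_tensor_add_left probe_tensor_add_right)

section \<open>The trajectory of a Gaussian wave packet\<close>

text \<open>The phase e^(-\<i> \<gamma> t (q - \<beta> t b / 2)) of the flow at time t is linear in
  y = q - \<beta> t b and b, so it only lowers the two frequencies of the packet, by \<gamma> t and
  by \<gamma> \<beta> t^2 / 2.\<close>

definition gauss_traj :: "complex \<Rightarrow> real \<Rightarrow> complex \<Rightarrow> real \<Rightarrow> real \<Rightarrow> real \<Rightarrow> real \<Rightarrow> real \<times> real \<Rightarrow> complex" where
  "gauss_traj c u d v \<gamma> \<beta> t x =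
    gauss_fun c (u - \<gamma> * t) (fst x - \<beta> * t * snd x) * gauss_fun d (v - \<gamma> * \<beta> * t\<^sup>2 / 2) (snd x)"

definition gauss_traj_deriv :: "complex \<Rightarrow> real \<Rightarrow> complex \<Rightarrow> real \<Rightarrow> real \<Rightarrow> real \<Rightarrow> real \<Rightarrow> real \<times> real \<Rightarrow> complex" where
  "gauss_traj_deriv c u d v \<gamma> \<beta> t x =
    (complex_of_real (\<beta> * snd x * (fst x - \<beta> * t * snd x))
      - \<i> * complex_of_real (\<beta> * snd x * (u - \<gamma> * t) + \<gamma> * fst x)) * gauss_traj c u d v \<gamma> \<beta> t x"

lemma gauss_traj_has_vector_derivative:
  "((\<lambda>t. gauss_traj c u d v \<gamma> \<beta> t x) has_vector_derivative gauss_traj_deriv c u d v \<gamma> \<beta> t x) (at t)"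
proof -
  define q b where "q = complex_of_real (fst x)" and "b = complex_of_real (snd x)"
  define g \<beta>' u' v' where "g = complex_of_real \<gamma>" and "\<beta>' = complex_of_real \<beta>"
    and "u' = complex_of_real u" and "v' = complex_of_real v"
  define Z where "Z z = (- ((q - \<beta>' * z * b)\<^sup>2 / 2) + \<i> * ((u' - g * z) * (q - \<beta>' * z * b)))
      + (- (b\<^sup>2 / 2) + \<i> * ((v' - g * \<beta>' * z\<^sup>2 / 2) * b))" for z
  have eq: "gauss_traj c u d v \<gamma> \<beta> t x = c * d * exp (Z (complex_of_real t))" for t
    by (simp add: gauss_traj_def gauss_fun_def Z_def exp_add q_def b_def g_def \<beta>'_def u'_def v'_def)
  have "((\<lambda>z. c * d * exp (Z z)) has_field_derivative
      (\<beta>' * b * (q - \<beta>' * z * b) - \<i> * (\<beta>' * b * (u' - g * z) + g * q)) * (c * d * exp (Z z))) (at z)" for z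
  proof -
    have "(Z has_field_derivative (\<beta>' * b * (q - \<beta>' * z * b) - \<i> * (\<beta>' * b * (u' - g * z) + g * q))) (at z)"
      unfolding Z_def by (rule derivative_eq_intros refl | simp)+ (simp add: algebra_simps)
    from DERIV_cmult[OF DERIV_fun_exp[OF this], of "c * d"] show ?thesis
      by (simp only: mult_ac)
  qed
  from has_vector_derivative_real_field[OF this[of "complex_of_real t"]]
  show ?thesis
    unfolding eq gauss_traj_deriv_def by (simp add: q_def b_def g_def \<beta>'_def u'_def)
qed

lemma norm_gauss_traj: "cmod (gauss_traj c u d v \<gamma> \<beta> t x)
    = cmod c * cmod d * (exp (- ((fst x - \<beta> * t * snd x)\<^sup>2 / 2)) * exp (- ((snd x)\<^sup>2 / 2)))"
  by (simp add: gauss_traj_def norm_mult norm_gauss_fun)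

lemma gauss_traj_measurable [measurable]: "gauss_traj c u d v \<gamma> \<beta> t \<in> borel_measurable borel"
  unfolding gauss_traj_def gauss_fun_def borel_prod[symmetric] by measurable

text \<open>One product majorises every monomial in y and b that occurs in the time derivative and
  in the coupling, so a single constant can bound a whole coefficient.\<close>

lemma product_growth:
  "\<bar>b::real\<bar> * \<bar>y\<bar> \<le> (1 + y\<^sup>2) * (1 + b\<^sup>2)" "\<bar>b\<bar> \<le> (1 + y\<^sup>2) * (1 + b\<^sup>2)"
  "\<bar>y\<bar> \<le> (1 + y\<^sup>2) * (1 + b\<^sup>2)" "1 \<le> (1 + y\<^sup>2) * (1 + b\<^sup>2)"
proof -
  have 1: "1 \<le> 1 + y\<^sup>2" "1 \<le> 1 + b\<^sup>2" by simp_all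
  show "\<bar>b\<bar> * \<bar>y\<bar> \<le> (1 + y\<^sup>2) * (1 + b\<^sup>2)"
    using mult_mono[OF abs_le_one_plus_square[of y] abs_le_one_plus_square[of b]] by (simp add: mult.commute)
  show "\<bar>b\<bar> \<le> (1 + y\<^sup>2) * (1 + b\<^sup>2)"
    using mult_mono[OF 1(1) abs_le_one_plus_square[of b]] by simp
  show "\<bar>y\<bar> \<le> (1 + y\<^sup>2) * (1 + b\<^sup>2)"
    using mult_mono[OF abs_le_one_plus_square[of y] 1(2)] by simp
  show "1 \<le> (1 + y\<^sup>2) * (1 + b\<^sup>2)"
    using mult_mono[OF 1] by simp
qed

lemma gauss_traj_mult_le:
  assumes "\<beta> \<ge> 0" "t \<in> {0..1}"
    and "cmod z \<le> K * ((1 + (fst x - \<beta> * t * snd x)\<^sup>2) * (1 + (snd x)\<^sup>2))" "K \<ge> 0"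
  shows "cmod (z * gauss_traj c u d v \<gamma> \<beta> t x) \<le> gauss_envelope (16 * (K * (cmod c * cmod d))) \<beta> x"
proof -
  have "\<bar>\<beta> * t\<bar> \<le> \<beta>" using assms(1,2) by (auto simp: abs_mult intro: mult_left_le)
  from le_gauss_envelope[OF this, of "K * (cmod c * cmod d)" "fst x" "snd x"]
  have "K * (cmod c * cmod d) * (1 + (fst x - \<beta> * t * snd x)\<^sup>2) * (1 + (snd x)\<^sup>2)
      * (exp (- ((fst x - \<beta> * t * snd x)\<^sup>2 / 2)) * exp (- ((snd x)\<^sup>2 / 2))) \<le> gauss_envelope (16 * (K * (cmod c * cmod d))) \<beta> x"
    using assms(4) by simp
  moreover have "cmod (z * gauss_traj c u d v \<gamma> \<beta> t x) \<le> (K * ((1 + (fst x - \<beta> * t * snd x)\<^sup>2) * (1 + (snd x)\<^sup>2)))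
      * (cmod c * cmod d * (exp (- ((fst x - \<beta> * t * snd x)\<^sup>2 / 2)) * exp (- ((snd x)\<^sup>2 / 2))))"
    unfolding norm_mult norm_gauss_traj by (intro mult_right_mono assms(3)) simp
  ultimately show ?thesis by (simp add: mult_ac)
qed

lemma square_integrable_mult_gauss_traj:
  assumes "\<beta> \<ge> 0" "t \<in> {0..1}" "K \<ge> 0"
    and "\<And>x. cmod (z x) \<le> K * ((1 + (fst x - \<beta> * t * snd x)\<^sup>2) * (1 + (snd x)\<^sup>2))"
    and [measurable]: "z \<in> borel_measurable borel"
  shows "square_integrable (\<lambda>x. z x * gauss_traj c u d v \<gamma> \<beta> t x)"
proof (rule square_integrable_bound[OF gauss_envelope_integrable])
  show "AE x in lborel. cmod (z x * gauss_traj c u d v \<gamma> \<beta> t x) \<le> gauss_envelope (16 * (K * (cmod c * cmod d))) \<beta> x"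
    by (intro AE_I2 gauss_traj_mult_le assms)
qed measurable

lemma abs_probe_coordinate_le:
  fixes q b t \<beta> :: real
  assumes "\<beta> \<ge> 0" "t \<in> {0..1}"
  shows "\<bar>q\<bar> \<le> (1 + \<beta>) * ((1 + (q - \<beta> * t * b)\<^sup>2) * (1 + b\<^sup>2))"
proof -
  have "\<bar>q\<bar> \<le> \<bar>q - \<beta> * t * b\<bar> + \<beta> * t * \<bar>b\<bar>"
    using assms abs_triangle_ineq[of "q - \<beta> * t * b" "\<beta> * t * b"] by (simp add: abs_mult)
  also have "\<beta> * t * \<bar>b\<bar> \<le> \<beta> * \<bar>b\<bar>"
    using assms by (intro mult_right_mono) (auto intro: mult_left_le)
  also have "\<bar>q - \<beta> * t * b\<bar> + \<beta> * \<bar>b\<bar> \<le> (1 + (q - \<beta> * t * b)\<^sup>2) * (1 + b\<^sup>2) + \<beta> * ((1 + (q - \<beta> * t * b)\<^sup>2) * (1 + b\<^sup>2))"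
    using assms by (intro add_mono mult_left_mono product_growth) auto
  finally show ?thesis by (simp add: algebra_simps)
qed

lemma gauss_traj_deriv_coefficient_le:
  assumes "\<beta> \<ge> 0" "t \<in> {0..1}"
  shows "cmod (complex_of_real (\<beta> * snd x * (fst x - \<beta> * t * snd x)) - \<i> * complex_of_real (\<beta> * snd x * (u - \<gamma> * t) + \<gamma> * fst x))
    \<le> (\<beta> + \<beta> * (\<bar>u\<bar> + \<bar>\<gamma>\<bar>) + \<bar>\<gamma>\<bar> * (1 + \<beta>)) * ((1 + (fst x - \<beta> * t * snd x)\<^sup>2) * (1 + (snd x)\<^sup>2))"
proof -
  define y where "y = fst x - \<beta> * t * snd x"
  define b where "b = snd x"
  define Q where "Q = (1 + y\<^sup>2) * (1 + b\<^sup>2)"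
  have "cmod (complex_of_real (\<beta> * b * y) - \<i> * complex_of_real (\<beta> * b * (u - \<gamma> * t) + \<gamma> * fst x))
      \<le> \<bar>\<beta> * b * y\<bar> + \<bar>\<beta> * b * (u - \<gamma> * t) + \<gamma> * fst x\<bar>"
    using norm_triangle_ineq4[of "complex_of_real (\<beta> * b * y)" "\<i> * complex_of_real (\<beta> * b * (u - \<gamma> * t) + \<gamma> * fst x)"]
    by (simp only: norm_mult norm_of_real norm_ii mult_1_left)
  also have "\<bar>\<beta> * b * (u - \<gamma> * t) + \<gamma> * fst x\<bar> \<le> \<beta> * (\<bar>u - \<gamma> * t\<bar> * \<bar>b\<bar>) + \<bar>\<gamma>\<bar> * \<bar>fst x\<bar>"
    using abs_triangle_ineq[of "\<beta> * b * (u - \<gamma> * t)" "\<gamma> * fst x"] assms by (simp add: abs_mult mult_ac)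
  also have "\<bar>\<beta> * b * y\<bar> = \<beta> * (\<bar>b\<bar> * \<bar>y\<bar>)" using assms by (simp add: abs_mult)
  also have "\<beta> * (\<bar>b\<bar> * \<bar>y\<bar>) + (\<beta> * (\<bar>u - \<gamma> * t\<bar> * \<bar>b\<bar>) + \<bar>\<gamma>\<bar> * \<bar>fst x\<bar>)
      \<le> \<beta> * Q + (\<beta> * ((\<bar>u\<bar> + \<bar>\<gamma>\<bar>) * Q) + \<bar>\<gamma>\<bar> * ((1 + \<beta>) * Q))"
  proof (intro add_mono mult_left_mono mult_mono)
    show "\<bar>u - \<gamma> * t\<bar> \<le> \<bar>u\<bar> + \<bar>\<gamma>\<bar>"
    proof -
      have "\<bar>\<gamma> * t\<bar> \<le> \<bar>\<gamma>\<bar>" using assms by (auto simp: abs_mult intro: mult_left_le)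
      thus ?thesis by linarith
    qed
    show "\<bar>fst x\<bar> \<le> (1 + \<beta>) * Q"
      unfolding Q_def y_def b_def by (rule abs_probe_coordinate_le[OF assms])
  qed (use assms product_growth[of b y] in \<open>auto simp: Q_def\<close>)
  also have "\<dots> = (\<beta> + \<beta> * (\<bar>u\<bar> + \<bar>\<gamma>\<bar>) + \<bar>\<gamma>\<bar> * (1 + \<beta>)) * Q" by (simp add: algebra_simps)
  finally show ?thesis by (simp only: y_def b_def Q_def)
qed

lemma gauss_traj_schwartz: "schwartz (gauss_traj c u d v \<gamma> \<beta> t)"
proof -
  have "schwartz (\<lambda>x. gauss_deriv c (u - \<gamma> * t) 0 (fst x - \<beta> * t * snd x) * gauss_deriv d (v - \<gamma> * \<beta> * t\<^sup>2 / 2) 0 (snd x))"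
    by (rule schwartz_sheared[of "gauss_deriv c (u - \<gamma> * t)" "gauss_deriv d (v - \<gamma> * \<beta> * t\<^sup>2 / 2)", OF gauss_deriv_has_vector_derivative gauss_deriv_has_vector_derivative
        gauss_deriv_bounded gauss_deriv_bounded])
  thus ?thesis by (simp add: gauss_traj_def[abs_def])
qed

lemma momentum_op_gauss_traj:
  "momentum_op hbar (pointer_op (gauss_traj c u d v \<gamma> \<beta> t)) x
    = (- \<i> * complex_of_real hbar * (complex_of_real (snd x) *
        (\<i> * complex_of_real (u - \<gamma> * t) - complex_of_real (fst x - \<beta> * t * snd x)))) * gauss_traj c u d v \<gamma> \<beta> t x"
proof -
  obtain q b where x: "x = (q, b)" by fastforce
  define u' where "u' = u - \<gamma> * t"
  define g where "g = gauss_fun d (v - \<gamma> * \<beta> * t\<^sup>2 / 2) b"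
  have "((\<lambda>s. s - \<beta> * t * b) has_vector_derivative 1) (at q)"
    unfolding has_real_derivative_iff_has_vector_derivative[symmetric] by (auto intro!: derivative_eq_intros)
  hence "((\<lambda>s. gauss_fun c u' (s - \<beta> * t * b)) has_vector_derivative
      1 *\<^sub>R gauss_deriv c u' (Suc 0) (q - \<beta> * t * b)) (at q)"
    using vector_diff_chain_at[of "\<lambda>s. s - \<beta> * t * b" 1 q "gauss_fun c u'" "gauss_deriv c u' (Suc 0) (q - \<beta> * t * b)"]
      gauss_deriv_has_vector_derivative[of c u' 0 "q - \<beta> * t * b"]
    by (simp add: o_def)
  from has_vector_derivative_mult_right[OF has_vector_derivative_mult_left[OF this, of g], of "complex_of_real b"]
  have "((\<lambda>s. pointer_op (gauss_traj c u d v \<gamma> \<beta> t) (s, b)) has_vector_derivative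
      complex_of_real b * (gauss_deriv c u' (Suc 0) (q - \<beta> * t * b) * g)) (at q)"
    by (simp add: pointer_op_def gauss_traj_def u'_def g_def)
  hence "vector_derivative (\<lambda>s. pointer_op (gauss_traj c u d v \<gamma> \<beta> t) (s, b)) (at q)
      = complex_of_real b * (gauss_deriv c u' (Suc 0) (q - \<beta> * t * b) * g)"
    by (rule vector_derivative_at)
  thus ?thesis
    by (simp add: momentum_op_def x gauss_traj_def gauss_deriv_def u'_def g_def)
qed

lemma in_coupling_graph:
  fixes A :: "'s::{complex_inner, euclidean_space} \<Rightarrow>\<^sub>L 's"
  assumes k: "k \<in> {1..N}" and f: "schwartz f"
  shows "(\<phi> k \<otimes>\<^sub>v L2_of f, \<alpha> *\<^sub>R (A (\<phi> k) \<otimes>\<^sub>v L2_of (position_op f)) +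
      \<beta> *\<^sub>R (\<phi> k \<otimes>\<^sub>v L2_of (momentum_op hbar (pointer_op f)))) \<in> coupling_graph hbar \<alpha> \<beta> N \<phi> A"
proof -
  define F where "F j = (if j = k then f else (\<lambda>x. 0))" for j
  have z: "L2_of (\<lambda>x. 0) = (0 :: (real \<times> real, complex) L2)" by (simp add: zero_L2.abs_eq)
  have p: "position_op (\<lambda>x. 0) = (\<lambda>x. 0)" "momentum_op hbar (pointer_op (\<lambda>x. 0)) = (\<lambda>x. 0)"
    by (auto simp: position_op_def momentum_op_def pointer_op_def fun_eq_iff)
  have 1: "(\<Sum>j=1..N. \<phi> j \<otimes>\<^sub>v L2_of (F j)) = (\<Sum>j=1..N. if j = k then \<phi> k \<otimes>\<^sub>v L2_of f else 0)"
    by (intro sum.cong) (auto simp: F_def z vtensor_bl.zero_right)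
  have 2: "(\<Sum>j=1..N. \<alpha> *\<^sub>R (A (\<phi> j) \<otimes>\<^sub>v L2_of (position_op (F j))) +
      \<beta> *\<^sub>R (\<phi> j \<otimes>\<^sub>v L2_of (momentum_op hbar (pointer_op (F j)))))
    = (\<Sum>j=1..N. if j = k then \<alpha> *\<^sub>R (A (\<phi> k) \<otimes>\<^sub>v L2_of (position_op f)) +
      \<beta> *\<^sub>R (\<phi> k \<otimes>\<^sub>v L2_of (momentum_op hbar (pointer_op f))) else 0)"
    by (intro sum.cong) (auto simp: F_def z p vtensor_bl.zero_right)
  show ?thesis
    unfolding coupling_graph_def
    using f k 1 2 by (intro CollectI exI[of _ F]) (auto simp: F_def schwartz_zero)
qed

lemma evolution_gauss:
  fixes U :: "(real \<times> real, 's::{complex_inner, euclidean_space}) L2 \<Rightarrow>\<^sub>L (real \<times> real, 's) L2"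
    and A :: "'s \<Rightarrow>\<^sub>L 's"
  assumes U: "is_operator_function (closure (coupling_graph hbar \<alpha> \<beta> N \<phi> A))
           (\<lambda>t. exp (- (\<i> / complex_of_real hbar) * complex_of_real t)) U"
    and "hbar > 0" "\<beta> \<ge> 0" and k: "k \<in> {1..N}" and A: "A (\<phi> k) = complex_of_real a *\<^sub>C \<phi> k"
    and \<gamma>: "\<gamma> = \<alpha> * a / hbar"
  shows "U (\<phi> k \<otimes>\<^sub>v L2_of (gauss_traj c u d v \<gamma> \<beta> 0)) = \<phi> k \<otimes>\<^sub>v L2_of (gauss_traj c u d v \<gamma> \<beta> 1)"
proof (rule evolution_unique[OF U \<open>hbar > 0\<close>, where x = "\<lambda>t. \<phi> k \<otimes>\<^sub>v L2_of (gauss_traj c u d v \<gamma> \<beta> t)"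
      and y = "\<lambda>t. \<alpha> *\<^sub>R (A (\<phi> k) \<otimes>\<^sub>v L2_of (position_op (gauss_traj c u d v \<gamma> \<beta> t))) +
      \<beta> *\<^sub>R (\<phi> k \<otimes>\<^sub>v L2_of (momentum_op hbar (pointer_op (gauss_traj c u d v \<gamma> \<beta> t))))"])
  fix t :: real assume t: "t \<in> {0..1}"
  let ?f = "gauss_traj c u d v \<gamma> \<beta>" and ?f' = "gauss_traj_deriv c u d v \<gamma> \<beta>"
  show "(\<phi> k \<otimes>\<^sub>v L2_of (?f t), \<alpha> *\<^sub>R (A (\<phi> k) \<otimes>\<^sub>v L2_of (position_op (?f t))) +
      \<beta> *\<^sub>R (\<phi> k \<otimes>\<^sub>v L2_of (momentum_op hbar (pointer_op (?f t))))) \<in> closure (coupling_graph hbar \<alpha> \<beta> N \<phi> A)"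
    using in_coupling_graph[OF k gauss_traj_schwartz] closure_subset by blast
  note sqI = square_integrable_mult_gauss_traj[OF \<open>\<beta> \<ge> 0\<close>]
  define Q where "Q t x = (1 + (fst x - \<beta> * t * snd x)\<^sup>2) * (1 + (snd x)\<^sup>2)" for t :: real and x :: "real \<times> real"
  have sq: "square_integrable (?f t)" if "t \<in> {0..1}" for t
    using sqI[OF that, of 1 "\<lambda>x. 1"] product_growth(4) by simp
  have sqp: "square_integrable (position_op (?f t))"
  proof -
    have "square_integrable (\<lambda>x. complex_of_real (fst x) * ?f t x)"
      using abs_probe_coordinate_le[OF \<open>\<beta> \<ge> 0\<close> t] \<open>\<beta> \<ge> 0\<close>
      by (intro sqI[OF t, of "1 + \<beta>"]) (auto simp flip: borel_prod)
    thus ?thesis by (simp add: position_op_def case_prod_beta')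
  qed
  have sqm: "square_integrable (momentum_op hbar (pointer_op (?f t)))"
    unfolding momentum_op_gauss_traj[abs_def]
  proof (rule sqI[OF t, of "hbar * (\<bar>u - \<gamma> * t\<bar> + 1)"])
    fix x :: "real \<times> real"
    have "cmod (\<i> * complex_of_real (u - \<gamma> * t) - complex_of_real (fst x - \<beta> * t * snd x))
        \<le> \<bar>u - \<gamma> * t\<bar> + \<bar>fst x - \<beta> * t * snd x\<bar>"
      using norm_triangle_ineq4[of "\<i> * complex_of_real (u - \<gamma> * t)" "complex_of_real (fst x - \<beta> * t * snd x)"]
      by (simp only: norm_mult norm_of_real norm_ii mult_1_left)
    hence "\<bar>snd x\<bar> * cmod (\<i> * complex_of_real (u - \<gamma> * t) - complex_of_real (fst x - \<beta> * t * snd x))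
        \<le> \<bar>u - \<gamma> * t\<bar> * \<bar>snd x\<bar> + \<bar>snd x\<bar> * \<bar>fst x - \<beta> * t * snd x\<bar>"
      using mult_left_mono[of _ _ "\<bar>snd x\<bar>"] by (fastforce simp: algebra_simps)
    also have "\<dots> \<le> \<bar>u - \<gamma> * t\<bar> * Q t x + Q t x"
      unfolding Q_def by (intro add_mono mult_left_mono product_growth) auto
    finally have "hbar * (\<bar>snd x\<bar> * cmod (\<i> * complex_of_real (u - \<gamma> * t) - complex_of_real (fst x - \<beta> * t * snd x)))
        \<le> hbar * ((\<bar>u - \<gamma> * t\<bar> + 1) * Q t x)"
      using \<open>hbar > 0\<close> by (intro mult_left_mono) (auto simp: algebra_simps)
    thus "cmod (- \<i> * complex_of_real hbar * (complex_of_real (snd x) *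
        (\<i> * complex_of_real (u - \<gamma> * t) - complex_of_real (fst x - \<beta> * t * snd x))))
      \<le> hbar * (\<bar>u - \<gamma> * t\<bar> + 1) * ((1 + (fst x - \<beta> * t * snd x)\<^sup>2) * (1 + (snd x)\<^sup>2))"
      using \<open>hbar > 0\<close> by (simp add: norm_mult Q_def mult.assoc del: of_real_diff of_real_mult)
  qed (use \<open>hbar > 0\<close> in \<open>auto simp flip: borel_prod\<close>)
  define K where "K = 16 * ((\<beta> + \<beta> * (\<bar>u\<bar> + \<bar>\<gamma>\<bar>) + \<bar>\<gamma>\<bar> * (1 + \<beta>)) * (cmod c * cmod d))"
  have coef: "cmod (?f' s x) \<le> gauss_envelope K \<beta> x" if "s \<in> {0..1}" for s x
    unfolding gauss_traj_deriv_def K_def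
    using \<open>\<beta> \<ge> 0\<close> by (intro gauss_traj_mult_le gauss_traj_deriv_coefficient_le that) auto
  have sqd: "square_integrable (?f' t)"
  proof (rule square_integrable_bound[OF gauss_envelope_integrable[of K \<beta>]])
    show "?f' t \<in> borel_measurable borel"
      unfolding gauss_traj_deriv_def[abs_def] borel_prod[symmetric]
      using gauss_traj_measurable[of c u d v \<gamma> \<beta> t, folded borel_prod] by measurable
    show "AE x in lborel. cmod (?f' t x) \<le> gauss_envelope K \<beta> x" by (intro AE_I2 coef t)
  qed
  \<comment> \<open>The envelope does not depend on the time in [0, 1], as dominated differentiation
    requires.\<close>
  have "((\<lambda>t. L2_of (?f t)) has_vector_derivative L2_of (?f' t)) (at t within {0..1})"
  proof (rule L2_has_vector_derivative[where w = "gauss_envelope K \<beta>", OF t])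
    show "((\<lambda>s. ?f s x) has_vector_derivative ?f' s x) (at s within {0..1})" for s x
      by (rule has_vector_derivative_at_within[OF gauss_traj_has_vector_derivative])
  qed (fact sq sqd coef gauss_envelope_integrable)+
  from bounded_linear.has_vector_derivative[OF vtensor_bl.bounded_linear_right this]
  have "((\<lambda>t. \<phi> k \<otimes>\<^sub>v L2_of (?f t)) has_vector_derivative \<phi> k \<otimes>\<^sub>v L2_of (?f' t)) (at t within {0..1})" .
  moreover have "\<phi> k \<otimes>\<^sub>v L2_of (?f' t) = (- (\<i> / complex_of_real hbar)) *\<^sub>C (\<alpha> *\<^sub>R (A (\<phi> k) \<otimes>\<^sub>v L2_of (position_op (?f t))) +
      \<beta> *\<^sub>R (\<phi> k \<otimes>\<^sub>v L2_of (momentum_op hbar (pointer_op (?f t)))))"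
  proof -
    have "?f' t = (\<lambda>x. (- (\<i> / complex_of_real hbar) * complex_of_real (\<alpha> * a)) *\<^sub>C position_op (?f t) x
        + (- (\<i> / complex_of_real hbar) * complex_of_real \<beta>) *\<^sub>C momentum_op hbar (pointer_op (?f t)) x)"
    proof
      fix x :: "real \<times> real"
      \<comment> \<open>The Schroedinger equation with the wave packet cancelled: an identity
        between polynomial coefficients.\<close>
      have h: "- (\<i> / complex_of_real hbar) * complex_of_real (\<alpha> * a) * complex_of_real (fst x)
          + - (\<i> / complex_of_real hbar) * complex_of_real \<beta> * (- \<i> * complex_of_real hbar * (complex_of_real (snd x) *
        (\<i> * complex_of_real (u - \<gamma> * t) - complex_of_real (fst x - \<beta> * t * snd x))))
         = complex_of_real (\<beta> * snd x * (fst x - \<beta> * t * snd x)) - \<i> * complex_of_real (\<beta> * snd x * (u - \<gamma> * t) + \<gamma> * fst x)"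
        using \<open>hbar > 0\<close> by (simp add: complex_eq_iff \<gamma>) (simp add: field_simps)
      show "?f' t x = (- (\<i> / complex_of_real hbar) * complex_of_real (\<alpha> * a)) *\<^sub>C position_op (?f t) x
        + (- (\<i> / complex_of_real hbar) * complex_of_real \<beta>) *\<^sub>C momentum_op hbar (pointer_op (?f t)) x"
        unfolding momentum_op_gauss_traj gauss_traj_deriv_def position_op_def scaleC_complex_def case_prod_beta'
          h[symmetric]
        by (simp only: distrib_right mult.assoc prod.collapse)
    qed
    hence "L2_of (?f' t) = (- (\<i> / complex_of_real hbar) * complex_of_real (\<alpha> * a)) *\<^sub>C L2_of (position_op (?f t))
        + (- (\<i> / complex_of_real hbar) * complex_of_real \<beta>) *\<^sub>C L2_of (momentum_op hbar (pointer_op (?f t)))"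
      by (simp only: L2_of_scaleC sqp sqm L2_of_add square_integrable_scaleC)
    thus ?thesis
      by (simp only: A vtensor_add_right vtensor_scaleC_right vtensor_scaleC_left scaleC_add_right
          scaleC_of_real[symmetric] scaleC_scaleC of_real_mult mult.assoc)
  qed
  ultimately show "((\<lambda>t. \<phi> k \<otimes>\<^sub>v L2_of (?f t)) has_vector_derivative
    (- (\<i> / complex_of_real hbar)) *\<^sub>C (\<alpha> *\<^sub>R (A (\<phi> k) \<otimes>\<^sub>v L2_of (position_op (?f t))) +
      \<beta> *\<^sub>R (\<phi> k \<otimes>\<^sub>v L2_of (momentum_op hbar (pointer_op (?f t)))))) (at t within {0..1})"
    by simp
qed

section \<open>The evolution of a product state\<close>

text \<open>For fixed b the shear is a translation in q, so Lebesgue measure is preserved slice by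
  slice.\<close>

lemma distr_shear: "distr lborel lborel (\<lambda>x. (fst x - \<beta> * snd x, snd x)) = (lborel :: (real \<times> real) measure)"
proof (rule measure_eqI)
  fix A assume "A \<in> sets (distr lborel lborel (\<lambda>x. (fst x - \<beta> * snd x, snd x)))"
  hence A': "A \<in> sets borel" by simp
  hence A: "A \<in> sets (borel \<Otimes>\<^sub>M borel :: (real \<times> real) measure)" by (simp only: borel_prod)
  let ?T = "\<lambda>x::real \<times> real. (fst x - \<beta> * snd x, snd x)"
  have [measurable]: "?T \<in> (borel \<Otimes>\<^sub>M borel) \<rightarrow>\<^sub>M (borel \<Otimes>\<^sub>M borel)" by measurable
  have [measurable]: "(indicator A :: real \<times> real \<Rightarrow> ennreal) \<in> borel_measurable (borel \<Otimes>\<^sub>M borel)"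
    using A by simp
  have T: "?T \<in> lborel \<rightarrow>\<^sub>M lborel" unfolding measurable_lborel1 measurable_lborel2 borel_prod[symmetric] by measurable
  have "emeasure (distr lborel lborel ?T) A = (\<integral>\<^sup>+x. indicator A x \<partial>distr lborel lborel ?T)"
    using A' by simp
  also have "\<dots> = (\<integral>\<^sup>+x. indicator A (?T x) \<partial>(lborel \<Otimes>\<^sub>M lborel))"
    unfolding lborel_prod by (rule nn_integral_distr[OF T]) (use A' in simp)
  also have "\<dots> = (\<integral>\<^sup>+b. (\<integral>\<^sup>+q. indicator A (?T (q, b)) \<partial>lborel) \<partial>lborel)"
    by (rule lborel_pair.nn_integral_snd[symmetric]) measurable
  also have "\<dots> = (\<integral>\<^sup>+b. (\<integral>\<^sup>+q. indicator A (q, b) \<partial>lborel) \<partial>lborel)"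
  proof (rule nn_integral_cong)
    fix b :: real
    have "(\<integral>\<^sup>+q. indicator A (q, b) \<partial>lborel) = (\<integral>\<^sup>+q. indicator A (- \<beta> * b + 1 * q, b) \<partial>lborel)"
      by (subst nn_integral_real_affine[of _ 1 "- \<beta> * b"]) auto
    thus "(\<integral>\<^sup>+q. indicator A (?T (q, b)) \<partial>lborel) = (\<integral>\<^sup>+q. indicator A (q, b) \<partial>lborel)" by simp
  qed
  also have "\<dots> = (\<integral>\<^sup>+x. indicator A x \<partial>(lborel \<Otimes>\<^sub>M lborel))"
    by (rule lborel_pair.nn_integral_snd) measurable
  also have "\<dots> = emeasure lborel A" unfolding lborel_prod using A' by simp
  finally show "emeasure (distr lborel lborel ?T) A = emeasure lborel A" .
qed simp

lemma shear_measurable: "(\<lambda>x::real \<times> real. (fst x - \<beta> * snd x, snd x)) \<in> lborel \<rightarrow>\<^sub>M lborel"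
  unfolding measurable_lborel1 measurable_lborel2 borel_prod[symmetric] by measurable

definition shear_fun :: "real \<Rightarrow> real \<Rightarrow> (real \<times> real \<Rightarrow> complex) \<Rightarrow> real \<times> real \<Rightarrow> complex" where
  "shear_fun \<gamma> \<beta> F x = exp (- \<i> * complex_of_real (\<gamma> * (fst x - \<beta> * snd x / 2))) * F (fst x - \<beta> * snd x, snd x)"

lemma norm_shear_fun: "cmod (shear_fun \<gamma> \<beta> F x) = cmod (F (fst x - \<beta> * snd x, snd x))"
  by (simp add: shear_fun_def norm_mult)

lemma
  assumes F: "square_integrable F"
  shows square_integrable_shear_fun: "square_integrable (shear_fun \<gamma> \<beta> F)"
    and norm_L2_of_shear_fun: "norm (L2_of (shear_fun \<gamma> \<beta> F)) = norm (L2_of F)"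
proof -
  let ?T = "\<lambda>x::real \<times> real. (fst x - \<beta> * snd x, snd x)"
  have Fm: "F \<in> borel_measurable lborel" using F by (simp add: square_integrable_def)
  have "(\<lambda>x. exp (- \<i> * complex_of_real (\<gamma> * (fst x - \<beta> * snd x / 2)))) \<in> borel_measurable (borel \<Otimes>\<^sub>M borel)"
    by measurable
  hence m: "shear_fun \<gamma> \<beta> F \<in> borel_measurable lborel"
    unfolding shear_fun_def[abs_def] using measurable_compose[OF shear_measurable Fm, of \<beta>]
    by (intro borel_measurable_times) (simp_all add: borel_prod)
  have "integrable (distr lborel lborel ?T) (\<lambda>x. (cmod (F x))\<^sup>2)"
    unfolding distr_shear using F by (simp add: square_integrable_def)
  hence "integrable lborel (\<lambda>x. (cmod (F (?T x)))\<^sup>2)"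
    by (subst (asm) integrable_distr_eq[OF shear_measurable]) (use Fm in measurable)
  thus sq: "square_integrable (shear_fun \<gamma> \<beta> F)"
    using m by (simp add: square_integrable_def norm_shear_fun)
  have "(\<integral>x. (cmod (F x))\<^sup>2 \<partial>distr lborel lborel ?T) = (\<integral>x. (cmod (F (?T x)))\<^sup>2 \<partial>lborel)"
    by (rule integral_distr[OF shear_measurable]) (use Fm in measurable)
  hence "(norm (L2_of (shear_fun \<gamma> \<beta> F)))\<^sup>2 = (norm (L2_of F))\<^sup>2"
    unfolding distr_shear norm_L2_of[OF sq] norm_L2_of[OF F] by (simp add: norm_shear_fun)
  thus "norm (L2_of (shear_fun \<gamma> \<beta> F)) = norm (L2_of F)" by (simp add: power2_eq_iff_nonneg)
qed

lift_definition shear_op :: "real \<Rightarrow> real \<Rightarrow> (real \<times> real, complex) L2 \<Rightarrow> (real \<times> real, complex) L2"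
  is shear_fun
proof -
  fix \<gamma> \<beta> :: real and F G :: "real \<times> real \<Rightarrow> complex" assume FG: "L2_rel F G"
  have "AE x in distr lborel lborel (\<lambda>x. (fst x - \<beta> * snd x, snd x)). F x = G x"
    unfolding distr_shear using FG by (simp add: L2_rel_def)
  from AE_distrD[OF shear_measurable this]
  have "AE x in lborel. shear_fun \<gamma> \<beta> F x = shear_fun \<gamma> \<beta> G x"
    by eventually_elim (simp add: shear_fun_def)
  thus "L2_rel (shear_fun \<gamma> \<beta> F) (shear_fun \<gamma> \<beta> G)"
    using FG by (simp add: L2_rel_def square_integrable_shear_fun)
qed

lemma shear_op_L2_of: "square_integrable F \<Longrightarrow> shear_op \<gamma> \<beta> (L2_of F) = L2_of (shear_fun \<gamma> \<beta> F)"
  by (rule shear_op.abs_eq) simp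

lemma bounded_linear_shear_op: "bounded_linear (shear_op \<gamma> \<beta>)"
proof (rule bounded_linear_intro[where K = 1])
  show "shear_op \<gamma> \<beta> (F + G) = shear_op \<gamma> \<beta> F + shear_op \<gamma> \<beta> G" for F G
  proof transfer
    fix \<gamma> \<beta> :: real and F G :: "real \<times> real \<Rightarrow> complex"
    assume "L2_rel F F" "L2_rel G G"
    moreover have "shear_fun \<gamma> \<beta> (\<lambda>x. F x + G x) = (\<lambda>x. shear_fun \<gamma> \<beta> F x + shear_fun \<gamma> \<beta> G x)"
      by (simp add: fun_eq_iff shear_fun_def distrib_left)
    ultimately show "L2_rel (shear_fun \<gamma> \<beta> (\<lambda>x. F x + G x)) (\<lambda>x. shear_fun \<gamma> \<beta> F x + shear_fun \<gamma> \<beta> G x)"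
      by (simp add: square_integrable_add square_integrable_shear_fun)
  qed
  show "shear_op \<gamma> \<beta> (r *\<^sub>R F) = r *\<^sub>R shear_op \<gamma> \<beta> F" for r F
  proof transfer
    fix \<gamma> \<beta> r :: real and F :: "real \<times> real \<Rightarrow> complex"
    assume "L2_rel F F"
    moreover have "shear_fun \<gamma> \<beta> (\<lambda>x. r *\<^sub>R F x) = (\<lambda>x. r *\<^sub>R shear_fun \<gamma> \<beta> F x)"
      by (simp add: fun_eq_iff shear_fun_def)
    ultimately show "L2_rel (shear_fun \<gamma> \<beta> (\<lambda>x. r *\<^sub>R F x)) (\<lambda>x. r *\<^sub>R shear_fun \<gamma> \<beta> F x)"
      by (simp add: square_integrable_scaleR square_integrable_shear_fun)
  qed
  show "norm (shear_op \<gamma> \<beta> F) \<le> norm F * 1" for F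
    using norm_L2_of_shear_fun[of "L2_fun F" \<gamma> \<beta>] shear_op_L2_of[of "L2_fun F" \<gamma> \<beta>] by simp
qed

lemma orthonormal_expansion:
  fixes \<phi> :: "'i \<Rightarrow> 's::complex_inner"
  assumes \<phi>: "orthonormal_on I \<phi>" and I: "finite I" and span: "cspan (\<phi> ` I) = UNIV"
  shows "\<psi> = (\<Sum>k\<in>I. cinner (\<phi> k) \<psi> *\<^sub>C \<phi> k)"
proof -
  define d where "d = \<psi> - (\<Sum>k\<in>I. cinner (\<phi> k) \<psi> *\<^sub>C \<phi> k)"
  have orth: "cinner (\<phi> j) d = 0" if "j \<in> I" for j
  proof -
    have "cinner (\<phi> j) (\<Sum>k\<in>I. cinner (\<phi> k) \<psi> *\<^sub>C \<phi> k) = (\<Sum>k\<in>I. if k = j then cinner (\<phi> j) \<psi> else 0)"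
      unfolding cinner.sum_right cinner_scaleC_right
      using \<phi> that by (intro sum.cong) (auto simp: orthonormal_on_def)
    thus ?thesis using I that by (simp add: d_def cinner.diff_right)
  qed
  have "d \<in> cspan (\<phi> ` I)" using span by simp
  then obtain F c where F: "F \<subseteq> \<phi> ` I" "d = (\<Sum>v\<in>F. c v *\<^sub>C v)" by (auto simp: cspan_def)
  have "cinner d d = (\<Sum>v\<in>F. cnj (c v) * cinner v d)"
    by (subst F(2)) (simp add: cinner.sum_left cinner_scaleC_left)
  also have "\<dots> = 0" using F(1) orth by (intro sum.neutral) auto
  finally have "d = 0" by (simp add: cinner_same)
  thus ?thesis by (simp add: d_def)
qed

text \<open>The identity is closed under sums and limits of the state, both sides being bounded and
  real linear in it. Sums reach products of functions in the span of the packets, and density in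
  each of the two factors, with the continuity of the tensor product, reaches every product.\<close>

lemma evolution_product:
  fixes U :: "(real \<times> real, 's::{complex_inner, euclidean_space}) L2 \<Rightarrow>\<^sub>L (real \<times> real, 's) L2"
    and A :: "'s \<Rightarrow>\<^sub>L 's"
  assumes U: "is_operator_function (closure (coupling_graph hbar \<alpha> \<beta> N \<phi> A))
           (\<lambda>t. exp (- (\<i> / complex_of_real hbar) * complex_of_real t)) U"
    and "hbar > 0" "\<beta> \<ge> 0" and k: "k \<in> {1..N}" and A: "A (\<phi> k) = complex_of_real a *\<^sub>C \<phi> k"
  shows "U (\<phi> k \<otimes>\<^sub>v probe_tensor \<Psi> \<Phi>) = \<phi> k \<otimes>\<^sub>v shear_op (\<alpha> * a / hbar) \<beta> (probe_tensor \<Psi> \<Phi>)"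
proof -
  define \<gamma> where "\<gamma> = \<alpha> * a / hbar"
  interpret pt: bounded_bilinear "probe_tensor :: _ \<Rightarrow> (real, complex) L2 \<Rightarrow> _"
    by (rule bounded_bilinear_probe_tensor)
  interpret S: bounded_linear "shear_op \<gamma> \<beta>" by (rule bounded_linear_shear_op)
  define P where "P F \<longleftrightarrow> U (\<phi> k \<otimes>\<^sub>v F) = \<phi> k \<otimes>\<^sub>v shear_op \<gamma> \<beta> F" for F
  have P_add: "P F \<Longrightarrow> P G \<Longrightarrow> P (F + G)" for F G
    by (simp add: P_def vtensor_bl.add_right blinfun.add_right S.add)
  have P_lim: "P F" if "\<And>n. P (f n)" "f \<longlonglongrightarrow> F" for f F
  proof -
    have lim: "(\<lambda>n. U (\<phi> k \<otimes>\<^sub>v f n)) \<longlonglongrightarrow> U (\<phi> k \<otimes>\<^sub>v F)"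
      by (intro bounded_linear.tendsto[OF blinfun.bounded_linear_right]
          bounded_linear.tendsto[OF vtensor_bl.bounded_linear_right] that)
    have "(\<lambda>n. \<phi> k \<otimes>\<^sub>v shear_op \<gamma> \<beta> (f n)) \<longlonglongrightarrow> \<phi> k \<otimes>\<^sub>v shear_op \<gamma> \<beta> F"
      by (intro bounded_linear.tendsto[OF vtensor_bl.bounded_linear_right] S.tendsto that)
    hence "(\<lambda>n. U (\<phi> k \<otimes>\<^sub>v f n)) \<longlonglongrightarrow> \<phi> k \<otimes>\<^sub>v shear_op \<gamma> \<beta> F"
      using that(1) by (simp only: P_def)
    from LIMSEQ_unique[OF lim this] show ?thesis by (simp only: P_def)
  qed
  have packet: "P (probe_tensor (L2_of (gauss_fun c u)) (L2_of (gauss_fun d v)))" for c u d v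
  proof -
    have eq: "probe_tensor (L2_of (gauss_fun c u)) (L2_of (gauss_fun d v)) = L2_of (gauss_traj c u d v \<gamma> \<beta> 0)"
      by (simp add: probe_tensor_L2_of square_integrable_gauss_fun gauss_traj_def[abs_def] scaleC_complex_def)
    have sq: "square_integrable (gauss_traj c u d v \<gamma> \<beta> 0)"
      using square_integrable_probe_tensor[OF square_integrable_gauss_fun square_integrable_gauss_fun, of c u d v]
      by (simp add: gauss_traj_def[abs_def] scaleC_complex_def)
    have "shear_fun \<gamma> \<beta> (gauss_traj c u d v \<gamma> \<beta> 0) x = gauss_traj c u d v \<gamma> \<beta> 1 x" for x
    proof -
      define y b where "y = fst x - \<beta> * snd x" and "b = snd x"
      have h: "fst x - \<beta> * snd x / 2 = y + \<beta> * b / 2" by (simp add: y_def b_def)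
      have "shear_fun \<gamma> \<beta> (gauss_traj c u d v \<gamma> \<beta> 0) x
          = exp (- \<i> * complex_of_real (\<gamma> * (y + \<beta> * b / 2))) * (gauss_fun c u y * gauss_fun d v b)"
        unfolding shear_fun_def h gauss_traj_def by (simp add: y_def b_def)
      also have "exp (- \<i> * complex_of_real (\<gamma> * (y + \<beta> * b / 2))) * (gauss_fun c u y * gauss_fun d v b)
          = gauss_fun c (u - \<gamma>) y * gauss_fun d (v - \<gamma> * \<beta> / 2) b"
        by (simp add: gauss_fun_def exp_add[symmetric] algebra_simps)
      also have "gauss_fun c (u - \<gamma>) y * gauss_fun d (v - \<gamma> * \<beta> / 2) b = gauss_traj c u d v \<gamma> \<beta> 1 x"
        by (simp add: gauss_traj_def y_def b_def)
      finally show ?thesis .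
    qed
    hence "shear_fun \<gamma> \<beta> (gauss_traj c u d v \<gamma> \<beta> 0) = gauss_traj c u d v \<gamma> \<beta> 1" by blast
    thus ?thesis
      unfolding P_def eq shear_op_L2_of[OF sq]
      using evolution_gauss[OF U \<open>hbar > 0\<close> \<open>\<beta> \<ge> 0\<close> k A \<gamma>_def, of c u d v] by simp
  qed
  have span: "P (probe_tensor (L2_of f) (L2_of g))" if "gauss_span f" "gauss_span g" for f g
    using that
  proof (induction arbitrary: g)
    case (gauss c u)
    from gauss.prems show ?case
    proof induction
      case (add g h)
      thus ?case by (simp add: P_add pt.add_right square_integrable_gauss_span flip: L2_of_add)
    qed (rule packet)
  next
    case (add f h)
    thus ?case by (simp add: P_add pt.add_left square_integrable_gauss_span flip: L2_of_add)
  qed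
  have "\<Psi> \<in> closure (L2_of ` Collect gauss_span)" "\<Phi> \<in> closure (L2_of ` Collect gauss_span)"
    by (simp_all add: closure_gauss_span)
  then obtain X Y where X: "\<forall>n. X n \<in> L2_of ` Collect gauss_span" "X \<longlonglongrightarrow> \<Psi>"
    and Y: "\<forall>n. Y n \<in> L2_of ` Collect gauss_span" "Y \<longlonglongrightarrow> \<Phi>" unfolding closure_sequential by blast
  have "P (probe_tensor (X n) (Y n))" for n
    using X(1)[rule_format, of n] Y(1)[rule_format, of n] span by auto
  from P_lim[OF this pt.tendsto[OF X(2) Y(2)]] show ?thesis by (simp add: P_def \<gamma>_def)
qed

text \<open>By its type \<open>U\<close> commutes only with real scalars. The complex coefficients
  of the system state are therefore moved into the probe vector before \<open>U\<close> is applied;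
  there they later join the band function.\<close>

lemma evolution_state:
  fixes U :: "(real \<times> real, 's::{complex_inner, euclidean_space}) L2 \<Rightarrow>\<^sub>L (real \<times> real, 's) L2"
    and A :: "'s \<Rightarrow>\<^sub>L 's" and \<phi> :: "nat \<Rightarrow> 's"
  assumes U: "is_operator_function (closure (coupling_graph hbar \<alpha> \<beta> N \<phi> A))
           (\<lambda>t. exp (- (\<i> / complex_of_real hbar) * complex_of_real t)) U"
    and "hbar > 0" "\<beta> \<ge> 0" and A: "\<And>k. k \<in> {1..N} \<Longrightarrow> A (\<phi> k) = complex_of_real (a k) *\<^sub>C \<phi> k"
    and \<phi>: "orthonormal_on {1..N} \<phi>" "cspan (\<phi> ` {1..N}) = UNIV"
  shows "U (probe_tensor \<Psi> (\<psi> \<otimes>\<^sub>v \<Phi>))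
    = (\<Sum>k=1..N. \<phi> k \<otimes>\<^sub>v shear_op (\<alpha> * a k / hbar) \<beta> (probe_tensor (cinner (\<phi> k) \<psi> *\<^sub>C \<Psi>) \<Phi>))"
proof -
  have "probe_tensor \<Psi> (\<psi> \<otimes>\<^sub>v \<Phi>) = (\<Sum>k=1..N. cinner (\<phi> k) \<psi> *\<^sub>C \<phi> k) \<otimes>\<^sub>v probe_tensor \<Psi> \<Phi>"
    using orthonormal_expansion[OF \<phi>(1) _ \<phi>(2), of \<psi>] by (simp add: probe_tensor_vtensor)
  also have "\<dots> = (\<Sum>k=1..N. \<phi> k \<otimes>\<^sub>v probe_tensor (cinner (\<phi> k) \<psi> *\<^sub>C \<Psi>) \<Phi>)"
    by (simp add: vtensor_bl.sum_left vtensor_scaleC_left probe_tensor_scaleC_left vtensor_scaleC_right)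
  finally show ?thesis
    using evolution_product[OF U \<open>hbar > 0\<close> \<open>\<beta> \<ge> 0\<close> _ A] by (simp add: blinfun.sum_right)
qed

section \<open>Trace-norm integrals of rank-one operators\<close>

lemma bessel_finite:
  fixes e :: "nat \<Rightarrow> 'h::complex_inner"
  assumes e: "orthonormal_on {..<n} e"
  shows "(\<Sum>i<n. (cmod (cinner (e i) u))\<^sup>2) \<le> (norm u)\<^sup>2"
proof -
  define p where "p = (\<Sum>i<n. cinner (e i) u *\<^sub>C e i)"
  have orth: "cinner (e i) (u - p) = 0" if "i < n" for i
  proof -
    have "cinner (e i) p = (\<Sum>j<n. if j = i then cinner (e i) u else 0)"
      unfolding p_def cinner.sum_right cinner_scaleC_right
      using e that by (intro sum.cong) (auto simp: orthonormal_on_def)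
    thus ?thesis using that by (simp add: cinner.diff_right)
  qed
  have "cinner p (u - p) = 0"
    by (subst p_def) (simp add: cinner.sum_left cinner_scaleC_left orth)
  hence "orthogonal p (u - p)" by (simp add: orthogonal_def inner_eq_0_cinner)
  from norm_add_Pythagorean[OF this] have "(norm p)\<^sup>2 \<le> (norm u)\<^sup>2" by simp
  moreover have "(norm p)\<^sup>2 = (\<Sum>i<n. (norm (cinner (e i) u *\<^sub>C e i))\<^sup>2)"
    unfolding p_def using e
    by (intro norm_sum_Pythagorean_cinner) (auto simp: cinner_scaleC_left cinner_scaleC_right orthonormal_on_def)
  moreover have "norm (e i) = 1" if "i < n" for i
  proof -
    have "cinner (e i) (e i) = 1" using e that by (simp add: orthonormal_on_def)
    hence "inner (e i) (e i) = 1" by (simp add: cinner_same)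
    thus ?thesis by (simp add: norm_eq_sqrt_inner)
  qed
  ultimately show ?thesis by (simp add: norm_scaleC)
qed

lemma trace_norm_le_iff:
  fixes T :: "'a::complex_inner \<Rightarrow>\<^sub>L 'a"
  shows "trace_norm T \<le> c \<longleftrightarrow> (\<forall>(n::nat) e f. orthonormal_on {..<n} e \<longrightarrow> orthonormal_on {..<n} f \<longrightarrow>
    ennreal (\<Sum>i<n. cmod (cinner (e i) (T (f i)))) \<le> c)"
  unfolding trace_norm_def by (subst SUP_le_iff) auto

lemma sum_le_trace_norm:
  fixes T :: "'a::complex_inner \<Rightarrow>\<^sub>L 'a"
  shows "orthonormal_on {..<n::nat} e \<Longrightarrow> orthonormal_on {..<n} f \<Longrightarrow>
    ennreal (\<Sum>i<n. cmod (cinner (e i) (T (f i)))) \<le> trace_norm T"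
  using trace_norm_le_iff[of T "trace_norm T"] by blast

lemma trace_norm_add_le:
  fixes S T :: "'a::complex_inner \<Rightarrow>\<^sub>L 'a"
  shows "trace_norm (S + T) \<le> trace_norm S + trace_norm T"
  unfolding trace_norm_le_iff
proof (intro allI impI)
  fix n and e f :: "nat \<Rightarrow> 'a" assume ef: "orthonormal_on {..<n} e" "orthonormal_on {..<n} f"
  have "(\<Sum>i<n. cmod (cinner (e i) ((S + T) (f i))))
      \<le> (\<Sum>i<n. cmod (cinner (e i) (S (f i)))) + (\<Sum>i<n. cmod (cinner (e i) (T (f i))))"
    unfolding sum.distrib[symmetric] blinfun.add_left cinner.add_right
    by (intro sum_mono norm_triangle_ineq)
  hence "ennreal (\<Sum>i<n. cmod (cinner (e i) ((S + T) (f i))))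
      \<le> ennreal (\<Sum>i<n. cmod (cinner (e i) (S (f i)))) + ennreal (\<Sum>i<n. cmod (cinner (e i) (T (f i))))"
    by (subst ennreal_plus[symmetric]) (auto intro: ennreal_leI sum_nonneg)
  also have "\<dots> \<le> trace_norm S + trace_norm T" by (intro add_mono sum_le_trace_norm ef)
  finally show "ennreal (\<Sum>i<n. cmod (cinner (e i) ((S + T) (f i)))) \<le> trace_norm S + trace_norm T" .
qed

text \<open>Cauchy-Schwarz separates the two orthonormal systems and Bessel's inequality bounds each
  factor.\<close>

lemma trace_norm_scaleR_ketbra_le: "trace_norm (r *\<^sub>R ketbra u v) \<le> ennreal (\<bar>r\<bar> * (norm u * norm v))"
  unfolding trace_norm_le_iff
proof (intro allI impI ennreal_leI)
  fix n and e f :: "nat \<Rightarrow> 'a" assume e: "orthonormal_on {..<n} e" and f: "orthonormal_on {..<n} f"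
  have "(\<Sum>i<n. cmod (cinner (e i) ((r *\<^sub>R ketbra u v) (f i))))
      = \<bar>r\<bar> * (\<Sum>i<n. \<bar>cmod (cinner (e i) u)\<bar> * \<bar>cmod (cinner (f i) v)\<bar>)"
    by (simp add: blinfun.scaleR_left ketbra.rep_eq cinner.scaleR_right cinner_scaleC_right norm_mult
        sum_distrib_left cinner_commute[of v] mult_ac)
  also have "\<dots> \<le> \<bar>r\<bar> * (L2_set (\<lambda>i. cmod (cinner (e i) u)) {..<n} * L2_set (\<lambda>i. cmod (cinner (f i) v)) {..<n})"
    by (intro mult_left_mono L2_set_mult_ineq) auto
  also have "\<dots> \<le> \<bar>r\<bar> * (norm u * norm v)"
    unfolding L2_set_def
    by (intro mult_left_mono mult_mono real_le_lsqrt bessel_finite e f sum_nonneg real_sqrt_ge_zero) auto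
  finally show "(\<Sum>i<n. cmod (cinner (e i) ((r *\<^sub>R ketbra u v) (f i)))) \<le> \<bar>r\<bar> * (norm u * norm v)" .
qed

text \<open>Changing one of the two vectors at a time makes the rank-one projector depend Lipschitz
  continuously on its vector in trace norm, on bounded sets.\<close>

lemma ketbra_diff:
  "ketbra u u - ketbra v v = 1 *\<^sub>R ketbra (u - v) u + 1 *\<^sub>R ketbra v (u - v)"
  by (rule blinfun_eqI)
     (simp add: blinfun.diff_left blinfun.add_left ketbra.rep_eq scaleC.diff_right scaleC.diff_left cinner.diff_left)

lemma trace_norm_weighted_ketbra_diff_le:
  assumes "norm u \<le> 1" "norm v \<le> 1"
  shows "trace_norm (r *\<^sub>R ketbra u u - s *\<^sub>R ketbra v v) \<le> ennreal (\<bar>r - s\<bar> + \<bar>s\<bar> * (2 * norm (u - v)))"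
proof -
  have "r *\<^sub>R ketbra u u - s *\<^sub>R ketbra v v = (r - s) *\<^sub>R ketbra u u + (s *\<^sub>R ketbra (u - v) u + s *\<^sub>R ketbra v (u - v))"
    using arg_cong[OF ketbra_diff[of u v], of "\<lambda>T. s *\<^sub>R T"] by (simp add: algebra_simps)
  also have "trace_norm \<dots> \<le> trace_norm ((r - s) *\<^sub>R ketbra u u) + (trace_norm (s *\<^sub>R ketbra (u - v) u) + trace_norm (s *\<^sub>R ketbra v (u - v)))"
    by (intro order_trans[OF trace_norm_add_le] add_mono order_refl trace_norm_add_le)
  also have "\<dots> \<le> ennreal (\<bar>r - s\<bar> * (norm u * norm u)) + (ennreal (\<bar>s\<bar> * (norm (u - v) * norm u)) + ennreal (\<bar>s\<bar> * (norm v * norm (u - v))))"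
    by (intro add_mono trace_norm_scaleR_ketbra_le)
  also have "\<dots> = ennreal (\<bar>r - s\<bar> * (norm u * norm u) + (\<bar>s\<bar> * (norm (u - v) * norm u) + \<bar>s\<bar> * (norm v * norm (u - v))))"
    by simp
  also have "\<dots> \<le> ennreal (\<bar>r - s\<bar> * 1 + (\<bar>s\<bar> * (norm (u - v) * 1) + \<bar>s\<bar> * (1 * norm (u - v))))"
    using assms by (intro ennreal_leI add_mono mult_left_mono mult_right_mono mult_le_one) auto
  finally show ?thesis by (simp add: algebra_simps)
qed

lemma complex_linear_ketbra: "complex_linear (ketbra u v)"
  by (simp add: complex_linear_def ketbra.rep_eq cinner_scaleC_right scaleC_scaleC)

lemma trace_class_scaleR_ketbra: "trace_class (r *\<^sub>R ketbra u v)"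
proof -
  have "complex_linear (r *\<^sub>R ketbra u v)"
    using complex_linear_ketbra[of u v]
    by (simp add: complex_linear_def blinfun.scaleR_left scaleC_scaleC mult.commute flip: scaleC_of_real)
  moreover have "trace_norm (r *\<^sub>R ketbra u v) < \<infinity>"
    using trace_norm_scaleR_ketbra_le[of r u v] by (rule order.strict_trans1) simp
  ultimately show ?thesis by (simp add: trace_class_def)
qed

text \<open>The candidate \<open>I\<close> is known only through its matrix elements. The
  approximating simple functions take their weight from a simple approximation of \<open>g\<close>
  and freeze the vector on a grid. Their trace-norm error is dominated by the measurable scalar
  function \<open>h n\<close>, and the required limits reduce to those of \<open>h n\<close> and of
  its integral.\<close>

lemma has_trace_norm_integral_rank_one:
  fixes \<xi> :: "real \<Rightarrow> 'h::complex_inner" and I :: "'h \<Rightarrow>\<^sub>L 'h"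
  assumes g: "integrable lborel g" and \<xi>: "continuous_on UNIV \<xi>" "\<And>p. norm (\<xi> p) \<le> 1"
    and I: "\<And>u v. cinner u (I v) = (\<integral>p. g p *\<^sub>R (cinner u (\<xi> p) * cinner (\<xi> p) v) \<partial>lborel)"
  shows "has_trace_norm_integral lborel (\<lambda>p. g p *\<^sub>R ketbra (\<xi> p) (\<xi> p)) I"
proof -
  have gm [measurable]: "g \<in> borel_measurable borel" using g by (auto dest: borel_measurable_integrable)
  obtain G where G: "\<And>n. simple_function borel (G n)" and G_lim: "\<And>p. (\<lambda>n. G n p) \<longlonglongrightarrow> g p"
    and G_le: "\<And>n p. \<bar>G n p\<bar> \<le> 2 * \<bar>g p\<bar>"
    using borel_measurable_implies_sequence_metric[OF gm, of 0] by auto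
  have [measurable]: "G n \<in> borel_measurable borel" for n by (rule borel_measurable_simple_function[OF G])
  define B where "B n = {- real n..<real n}" for n
  define a where "a n p = indicator (B n) p * G n p" for n p
  \<comment> \<open>The grid index of \<open>p\<close> for the mesh \<open>1 / Suc n\<close>; the
    default 0 outside the bounded set \<open>B n\<close> leaves only finitely many values.\<close>
  define J where "J n p = (if p \<in> B n then \<lfloor>real (Suc n) * p\<rfloor> else 0)" for n p
  define d where "d n j = of_int j / real (Suc n)" for n and j :: int
  define s where "s n p = a n p *\<^sub>R ketbra (\<xi> (d n (J n p))) (\<xi> (d n (J n p)))" for n p
  define h where "h n p = \<bar>g p - a n p\<bar> + \<bar>a n p\<bar> * (2 * norm (\<xi> p - \<xi> (d n (J n p))))" for n p
  have [measurable]: "B n \<in> sets borel" for n by (simp add: B_def)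
  have simple_a: "simple_function lborel (a n)" for n
    unfolding a_def by (intro simple_function_mult simple_function_indicator) (use G[of n] in \<open>auto simp: simple_function_def\<close>)
  have J_meas [measurable]: "J n \<in> borel \<rightarrow>\<^sub>M count_space UNIV" for n
    unfolding J_def by measurable
  have simple_J: "simple_function lborel (J n)" for n
    unfolding simple_function_eq_measurable
  proof
    have "J n p \<in> {- int (Suc n * n)..int (Suc n * n)}" for p
    proof (cases "p \<in> B n")
      case True
      hence "real (Suc n) * - real n \<le> real (Suc n) * p" "real (Suc n) * p \<le> real (Suc n) * real n"
        unfolding B_def by (simp_all only: atLeastLessThan_iff mult_left_mono less_imp_le of_nat_0_le_iff)
      hence "of_int (- int (Suc n * n)) \<le> real (Suc n) * p" "real (Suc n) * p \<le> of_int (int (Suc n * n))"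
        by (simp_all only: of_int_minus of_int_mult of_int_of_nat_eq of_nat_mult mult_minus_right)
      hence "- int (Suc n * n) \<le> \<lfloor>real (Suc n) * p\<rfloor>" "\<lfloor>real (Suc n) * p\<rfloor> \<le> int (Suc n * n)"
        by (simp_all only: le_floor_iff) (metis floor_mono floor_of_int)
      thus ?thesis using True by (simp add: J_def)
    next
      case False
      have "0 \<le> int (Suc n * n)" by (rule of_nat_0_le_iff)
      thus ?thesis using False by (simp only: J_def if_False atLeastAtMost_iff neg_le_0_iff_le simp_thms)
    qed
    hence "J n ` space lborel \<subseteq> {- int (Suc n * n)..int (Suc n * n)}" by blast
    thus "finite (J n ` space lborel)" by (rule finite_subset) simp
  qed simp
  have simple_s: "simple_function lborel (s n)" for n
    unfolding s_def
    by (rule simple_function_compose2[OF simple_a simple_J, where h = "\<lambda>r j. r *\<^sub>R ketbra (\<xi> (d n j)) (\<xi> (d n j))"])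
  have sbi: "Bochner_Integration.simple_bochner_integrable lborel (s n)" for n
  proof (rule simple_bochner_integrable.intros[OF simple_s])
    have "emeasure lborel {p \<in> space lborel. s n p \<noteq> 0} \<le> emeasure lborel (B n)"
      by (intro emeasure_mono) (auto simp: s_def a_def indicator_def split: if_splits)
    also have "\<dots> < \<infinity>" by (simp add: B_def)
    finally show "emeasure lborel {p \<in> space lborel. s n p \<noteq> 0} \<noteq> \<infinity>" by simp
  qed
  have h_bound: "trace_norm (g p *\<^sub>R ketbra (\<xi> p) (\<xi> p) - s n p) \<le> ennreal (h n p)" for n p
    unfolding s_def h_def by (intro trace_norm_weighted_ketbra_diff_le \<xi>)
  have h_meas [measurable]: "h n \<in> borel_measurable borel" for n
  proof -
    have "(\<lambda>p. norm (\<xi> p - \<xi> (d n (J n p)))) \<in> borel_measurable borel"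
    proof (rule measurable_compose_countable[OF _ J_meas])
      show "(\<lambda>p. norm (\<xi> p - \<xi> (d n j))) \<in> borel_measurable borel" for j
        by (intro borel_measurable_continuous_onI continuous_intros \<xi>)
    qed
    thus ?thesis unfolding h_def a_def by measurable
  qed
  have h_nonneg: "h n p \<ge> 0" for n p by (simp add: h_def)
  have a_le: "\<bar>a n p\<bar> \<le> 2 * \<bar>g p\<bar>" for n p using G_le[of n p] by (auto simp: a_def indicator_def)
  \<comment> \<open>11 = 3 + 8: the difference of the weights is at most 3 |g|, and two vectors of
    norm at most 1 have distance at most 2, so the second term is at most 2 |g| times 4.\<close>
  have h_le: "h n p \<le> 11 * \<bar>g p\<bar>" for n p
  proof -
    have "norm (\<xi> p - \<xi> (d n (J n p))) \<le> 2"
      using norm_triangle_ineq4[of "\<xi> p" "\<xi> (d n (J n p))"] \<xi>(2)[of p] \<xi>(2)[of "d n (J n p)"] by linarith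
    hence "\<bar>a n p\<bar> * (2 * norm (\<xi> p - \<xi> (d n (J n p)))) \<le> 2 * \<bar>g p\<bar> * 4"
      using a_le[of n p] by (intro mult_mono) auto
    thus ?thesis using a_le[of n p] by (simp add: h_def)
  qed
  have h_lim: "(\<lambda>n. h n p) \<longlonglongrightarrow> 0" for p
  proof -
    obtain N where N: "real N > \<bar>p\<bar>" using reals_Archimedean2 by blast
    have ev: "\<forall>\<^sub>F n in sequentially. p \<in> B n"
      using eventually_ge_at_top[of N] by eventually_elim (use N in \<open>auto simp: B_def\<close>)
    have a_lim: "(\<lambda>n. a n p) \<longlonglongrightarrow> g p"
      by (rule Lim_transform_eventually[OF G_lim[of p]]) (use ev in eventually_elim, simp add: a_def)
    have "(\<lambda>n. d n (J n p) - p) \<longlonglongrightarrow> 0"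
    proof (rule Lim_null_comparison)
      show "\<forall>\<^sub>F n in sequentially. norm (d n (J n p) - p) \<le> 1 / real (Suc n)"
        using ev
      proof eventually_elim
        fix n assume "p \<in> B n"
        hence J: "J n p = \<lfloor>real (Suc n) * p\<rfloor>" by (simp add: J_def)
        have "\<bar>of_int \<lfloor>real (Suc n) * p\<rfloor> - real (Suc n) * p\<bar> \<le> 1" by linarith
        hence "\<bar>of_int \<lfloor>real (Suc n) * p\<rfloor> - real (Suc n) * p\<bar> / real (Suc n) \<le> 1 / real (Suc n)"
          by (intro divide_right_mono) auto
        moreover have "d n (J n p) - p = (of_int \<lfloor>real (Suc n) * p\<rfloor> - real (Suc n) * p) / real (Suc n)"
          by (simp add: d_def J diff_divide_distrib del: of_nat_Suc)
        ultimately show "norm (d n (J n p) - p) \<le> 1 / real (Suc n)" by (simp del: of_nat_Suc)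
      qed
    qed (rule LIMSEQ_Suc[OF lim_1_over_n])
    hence "(\<lambda>n. d n (J n p)) \<longlonglongrightarrow> p" by (rule LIM_zero_cancel)
    hence \<xi>_lim: "(\<lambda>n. \<xi> (d n (J n p))) \<longlonglongrightarrow> \<xi> p"
      using \<xi>(1) by (intro continuous_on_tendsto_compose[of UNIV \<xi>]) auto
    have "(\<lambda>n. h n p) \<longlonglongrightarrow> \<bar>g p - g p\<bar> + \<bar>g p\<bar> * (2 * norm (\<xi> p - \<xi> p))"
      unfolding h_def by (intro tendsto_intros a_lim \<xi>_lim)
    thus ?thesis by simp
  qed
  have h_int: "integrable lborel (h n)" for n
  proof (rule Bochner_Integration.integrable_bound)
    show "integrable lborel (\<lambda>p. 11 * \<bar>g p\<bar>)" using g by simp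
    show "AE p in lborel. norm (h n p) \<le> norm (11 * \<bar>g p\<bar>)"
      using h_le h_nonneg by (intro AE_I2) (simp add: abs_of_nonneg)
  qed simp
  have "(\<lambda>n. \<integral>p. h n p \<partial>lborel) \<longlonglongrightarrow> (\<integral>p. 0 \<partial>(lborel :: real measure))"
  proof (rule integral_dominated_convergence)
    show "integrable lborel (\<lambda>p. 11 * \<bar>g p\<bar>)" using g by simp
    show "AE p in lborel. norm (h n p) \<le> 11 * \<bar>g p\<bar>" for n
      using h_le h_nonneg by (intro AE_I2) (simp add: abs_of_nonneg)
  qed (use h_lim in auto)
  hence h_int_lim: "(\<lambda>n. ennreal (\<integral>p. h n p \<partial>lborel)) \<longlonglongrightarrow> 0"
    using tendsto_ennrealI by fastforce
  have nn: "(\<integral>\<^sup>+p. ennreal (h n p) \<partial>lborel) = ennreal (\<integral>p. h n p \<partial>lborel)" for n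
    by (rule nn_integral_eq_integral[OF h_int]) (simp add: h_nonneg)
  \<comment> \<open>The trace norm is a supremum over finite systems; for each of them the sum of
    moduli is moved under the integral, where \<open>h n\<close> bounds it.\<close>
  have diff_le: "trace_norm (I - Bochner_Integration.simple_bochner_integral lborel (s n)) \<le> ennreal (\<integral>p. h n p \<partial>lborel)" for n
    unfolding trace_norm_le_iff
  proof (intro allI impI ennreal_leI)
    fix m and e f :: "nat \<Rightarrow> 'h" assume ef: "orthonormal_on {..<m} e" "orthonormal_on {..<m} f"
    let ?S = "Bochner_Integration.simple_bochner_integral lborel (s n)"
    let ?D = "\<lambda>p. g p *\<^sub>R ketbra (\<xi> p) (\<xi> p) - s n p"
    have D: "integrable lborel (\<lambda>p. cinner u (?D p v)) \<and> cinner u ((I - ?S) v) = (\<integral>p. cinner u (?D p v) \<partial>lborel)" for u v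
    proof -
      have bl: "bounded_linear (\<lambda>T::'h \<Rightarrow>\<^sub>L 'h. cinner u (T v))"
        by (rule bounded_linear_compose[OF cinner.bounded_linear_right blinfun.bounded_linear_left])
      have "Bochner_Integration.simple_bochner_integrable lborel (\<lambda>p. cinner u (s n p v))"
        by (rule simple_bochner_integrable_compose2[OF _ sbi sbi, where p = "\<lambda>T T'. cinner u (T v)"])
           (simp add: cinner.zero_right)
      from has_bochner_integral_simple_bochner_integrable[OF this]
      have s_int: "has_bochner_integral lborel (\<lambda>p. cinner u (s n p v)) (cinner u (?S v))"
        using simple_bochner_integral_linear[OF bounded_linear.linear[OF bl] sbi[of n]] by simp
      have cont: "continuous_on UNIV (\<lambda>p. cinner u (\<xi> p) * cinner (\<xi> p) v)"
        by (intro continuous_intros cinner.continuous_on \<xi>)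
      have g_int: "integrable lborel (\<lambda>p. g p *\<^sub>R (cinner u (\<xi> p) * cinner (\<xi> p) v))"
      proof (rule Bochner_Integration.integrable_bound)
        show "integrable lborel (\<lambda>p. g p * (norm u * norm v))" using g by simp
        have "cmod (cinner u (\<xi> p) * cinner (\<xi> p) v) \<le> norm u * norm v" for p
        proof -
          have "cmod (cinner u (\<xi> p)) \<le> norm u * 1"
            by (rule order_trans[OF norm_cinner_le mult_left_mono[OF \<xi>(2)]]) simp
          moreover have "cmod (cinner (\<xi> p) v) \<le> 1 * norm v"
            by (rule order_trans[OF norm_cinner_le mult_right_mono[OF \<xi>(2)]]) simp
          ultimately show ?thesis unfolding norm_mult by (intro mult_mono) auto
        qed
        thus "AE p in lborel. norm (g p *\<^sub>R (cinner u (\<xi> p) * cinner (\<xi> p) v)) \<le> norm (g p * (norm u * norm v))"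
          by (intro AE_I2) (simp add: abs_mult mult_left_mono)
      qed (use borel_measurable_continuous_onI[OF cont] in measurable)
      have eq: "cinner u (?D p v) = g p *\<^sub>R (cinner u (\<xi> p) * cinner (\<xi> p) v) - cinner u (s n p v)" for p
        by (simp add: blinfun.diff_left blinfun.scaleR_left ketbra.rep_eq cinner.diff_right
            cinner.scaleR_right cinner_scaleC_right mult.commute)
      show ?thesis
        unfolding eq using g_int s_int
        by (simp add: has_bochner_integral_iff blinfun.diff_left cinner.diff_right I)
    qed
    have "(\<Sum>i<m. cmod (cinner (e i) ((I - ?S) (f i)))) \<le> (\<Sum>i<m. \<integral>p. cmod (cinner (e i) (?D p (f i))) \<partial>lborel)"
      using D by (intro sum_mono) (simp add: integral_norm_bound)
    also have "\<dots> = (\<integral>p. (\<Sum>i<m. cmod (cinner (e i) (?D p (f i)))) \<partial>lborel)"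
      using D by (intro Bochner_Integration.integral_sum[symmetric]) auto
    also have "\<dots> \<le> (\<integral>p. h n p \<partial>lborel)"
    proof (rule integral_mono)
      show "integrable lborel (\<lambda>p. \<Sum>i<m. cmod (cinner (e i) (?D p (f i))))"
        using D by (intro Bochner_Integration.integrable_sum) auto
      show "(\<Sum>i<m. cmod (cinner (e i) (?D p (f i)))) \<le> h n p" for p
        using order_trans[OF sum_le_trace_norm[OF ef] h_bound] h_nonneg by (simp add: ennreal_le_iff)
    qed (rule h_int)
    finally show "(\<Sum>i<m. cmod (cinner (e i) ((I - ?S) (f i)))) \<le> (\<integral>p. h n p \<partial>lborel)" .
  qed
  show ?thesis
    unfolding has_trace_norm_integral_def
  proof (intro exI[of _ s] conjI allI ballI)
    show "trace_class (s n p)" for n p unfolding s_def by (rule trace_class_scaleR_ketbra)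
    show "AE p in lborel. (\<lambda>n. trace_norm (g p *\<^sub>R ketbra (\<xi> p) (\<xi> p) - s n p)) \<longlonglongrightarrow> 0"
    proof (rule AE_I2)
      fix p
      have e: "(\<lambda>n. ennreal (h n p)) \<longlonglongrightarrow> 0" using tendsto_ennrealI[OF h_lim[of p]] by simp
      show "(\<lambda>n. trace_norm (g p *\<^sub>R ketbra (\<xi> p) (\<xi> p) - s n p)) \<longlonglongrightarrow> 0"
        by (rule tendsto_sandwich[OF _ _ tendsto_const e]) (simp_all add: h_bound)
    qed
    show "(\<lambda>n. \<integral>\<^sup>+p. trace_norm (g p *\<^sub>R ketbra (\<xi> p) (\<xi> p) - s n p) \<partial>lborel) \<longlonglongrightarrow> 0"
    proof (rule tendsto_sandwich[OF _ _ tendsto_const h_int_lim])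
      show "\<forall>\<^sub>F n in sequentially. (\<integral>\<^sup>+p. trace_norm (g p *\<^sub>R ketbra (\<xi> p) (\<xi> p) - s n p) \<partial>lborel) \<le> ennreal (\<integral>p. h n p \<partial>lborel)"
        unfolding nn[symmetric] by (intro always_eventually allI nn_integral_mono h_bound)
    qed simp
    show "(\<lambda>n. trace_norm (I - Bochner_Integration.simple_bochner_integral lborel (s n))) \<longlonglongrightarrow> 0"
      by (rule tendsto_sandwich[OF _ _ tendsto_const h_int_lim]) (simp_all add: diff_le)
  qed (rule sbi)
qed

section \<open>The conditional pointer states\<close>

lemma exp_pointer_L2_of:
  assumes "square_integrable f"
  shows "exp_pointer \<theta> (L2_of f) = L2_of (\<lambda>b. iexp (\<theta> * b) * f b)"
  unfolding exp_pointer.rep_eq by (rule exp_pointer_fun.abs_eq) (simp add: assms)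

lemma square_integrable_exp_mult:
  "square_integrable f \<Longrightarrow> square_integrable (\<lambda>b. iexp (\<theta> * b) * f b)"
  by (auto simp: square_integrable_def norm_mult simp del: of_real_mult)

lemma exp_pointer_L2_fun:
  "exp_pointer \<theta> \<Phi> = L2_of (\<lambda>b. iexp (\<theta> * b) * L2_fun \<Phi> b)"
  using exp_pointer_L2_of[of "L2_fun \<Phi>"] by simp

lemma norm_exp_pointer: "norm (exp_pointer \<theta> \<Phi>) = norm \<Phi>"
proof -
  have "(norm (exp_pointer \<theta> \<Phi>))\<^sup>2 = (norm \<Phi>)\<^sup>2"
    unfolding exp_pointer_L2_fun norm_L2[of \<Phi>]
    by (subst norm_L2_of) (simp_all add: square_integrable_exp_mult norm_mult del: of_real_mult)
  thus ?thesis by (simp add: power2_eq_iff_nonneg)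
qed

lemma integrable_cnj_mult: "integrable lborel (\<lambda>b. cnj (L2_fun u b) * L2_fun \<Phi> b)"
  using square_integrable_cinner[of "L2_fun u" "L2_fun \<Phi>"] by (simp add: cinner_complex_def)

lemma cinner_exp_pointer:
  "cinner u (exp_pointer \<theta> \<Phi>)
    = (\<integral>b. iexp (\<theta> * b) * (cnj (L2_fun u b) * L2_fun \<Phi> b) \<partial>lborel)"
proof -
  have "cinner (L2_of (L2_fun u)) (exp_pointer \<theta> \<Phi>)
      = (\<integral>b. cinner (L2_fun u b) (iexp (\<theta> * b) * L2_fun \<Phi> b) \<partial>lborel)"
    unfolding exp_pointer_L2_fun by (rule cinner_L2_of) (simp_all only: square_integrable_exp_mult square_integrable_L2_fun)
  thus ?thesis by (simp add: cinner_complex_def mult.left_commute del: of_real_mult)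
qed

lemma exp_pointer_adjoint: "cinner \<Phi> (exp_pointer (- \<theta>) w) = cinner (exp_pointer \<theta> \<Phi>) w"
proof -
  have "cinner (exp_pointer \<theta> \<Phi>) w = cnj (cinner w (exp_pointer \<theta> \<Phi>))" by (rule cinner_commute)
  also have "\<dots> = (\<integral>b. cnj (iexp (\<theta> * b) * (cnj (L2_fun w b) * L2_fun \<Phi> b)) \<partial>lborel)"
    unfolding cinner_exp_pointer by (rule Bochner_Integration.integral_cnj[symmetric])
  also have "\<dots> = cinner \<Phi> (exp_pointer (- \<theta>) w)"
    unfolding cinner_exp_pointer
    by (intro Bochner_Integration.integral_cong refl) (simp add: exp_cnj mult_ac)
  finally show ?thesis ..
qed

text \<open>Unlike real linearity this is not part of the type; it follows because the adjoint is an
  operator of the same form.\<close>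

lemma exp_pointer_scaleC: "exp_pointer \<theta> (c *\<^sub>C \<Phi>) = c *\<^sub>C exp_pointer \<theta> \<Phi>"
proof (rule cinner_eqI)
  fix u
  have "cinner u (exp_pointer \<theta> (c *\<^sub>C \<Phi>)) = cinner (exp_pointer (- \<theta>) u) (c *\<^sub>C \<Phi>)"
    using exp_pointer_adjoint[of u "- \<theta>"] by simp
  also have "\<dots> = c * cinner (exp_pointer (- \<theta>) u) \<Phi>" by (rule cinner_scaleC_right)
  also have "cinner (exp_pointer (- \<theta>) u) \<Phi> = cinner u (exp_pointer \<theta> \<Phi>)"
    using exp_pointer_adjoint[of u "- \<theta>" \<Phi>] by simp
  finally show "cinner u (exp_pointer \<theta> (c *\<^sub>C \<Phi>)) = cinner u (c *\<^sub>C exp_pointer \<theta> \<Phi>)"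
    by (simp add: cinner_scaleC_right)
qed

lemma exp_pointer_conjugate_ketbra:
  "exp_pointer \<theta> o\<^sub>L ketbra \<Phi> \<Phi> o\<^sub>L exp_pointer (- \<theta>) = ketbra (exp_pointer \<theta> \<Phi>) (exp_pointer \<theta> \<Phi>)"
  by (rule blinfun_eqI) (simp add: ketbra.rep_eq exp_pointer_scaleC exp_pointer_adjoint)

text \<open>Strong continuity: for each fixed \<Phi> the phases converge pointwise and |\<Phi>| is a
  majorant.\<close>

lemma continuous_exp_pointer:
  assumes \<theta>: "continuous_on UNIV \<theta>"
  shows "continuous_on UNIV (\<lambda>p::real. exp_pointer (\<theta> p) \<Phi>)"
proof (rule continuous_on_sequentiallyI)
  fix X :: "nat \<Rightarrow> real" and p assume X: "X \<longlonglongrightarrow> p"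
  have "(\<lambda>n. \<theta> (X n)) \<longlonglongrightarrow> \<theta> p"
    using \<theta> X by (intro continuous_on_tendsto_compose[of UNIV \<theta>]) auto
  thus "(\<lambda>n. exp_pointer (\<theta> (X n)) \<Phi>) \<longlonglongrightarrow> exp_pointer (\<theta> p) \<Phi>"
    unfolding exp_pointer_L2_fun
  proof (intro L2_dominated_convergence)
    assume lim: "(\<lambda>n. \<theta> (X n)) \<longlonglongrightarrow> \<theta> p"
    show "integrable lborel (\<lambda>b. (cmod (L2_fun \<Phi> b))\<^sup>2)"
      using square_integrable_L2_fun[of \<Phi>] by (simp add: square_integrable_def)
    show "AE b in lborel. (\<lambda>n. iexp (\<theta> (X n) * b) * L2_fun \<Phi> b)
        \<longlonglongrightarrow> iexp (\<theta> p * b) * L2_fun \<Phi> b"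
      by (intro AE_I2 tendsto_intros lim)
  qed (auto simp: norm_mult simp del: of_real_mult)
qed

text \<open>The phases act by multiplication in b, so the weak integral applied to \<open>v\<close>
  is \<Phi> times a bounded function of b. This gives the operator by scalar integrals only, and
  Fubini confirms its matrix elements.\<close>

lemma rank_one_mixture_exists:
  fixes g \<theta> :: "real \<Rightarrow> real"
  assumes g: "integrable lborel g" and \<theta>: "continuous_on UNIV \<theta>"
  shows "\<exists>I :: (real, complex) L2 \<Rightarrow>\<^sub>L (real, complex) L2. complex_linear I \<and>
    (\<forall>u v. cinner u (I v) = (\<integral>p. g p *\<^sub>R (cinner u (exp_pointer (\<theta> p) \<Phi>) * cinner (exp_pointer (\<theta> p) \<Phi>) v) \<partial>lborel))"
proof -
  let ?\<xi> = "\<lambda>p. exp_pointer (\<theta> p) \<Phi>"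
  have [measurable]: "g \<in> borel_measurable borel" "\<theta> \<in> borel_measurable borel"
    using g \<theta> by (auto dest: borel_measurable_integrable intro: borel_measurable_continuous_onI)
  define k where "k v p = complex_of_real (g p) * cinner (?\<xi> p) v" for v p
  have cont: "continuous_on UNIV (\<lambda>p. cinner (?\<xi> p) v)" for v
    by (intro cinner.continuous_on continuous_exp_pointer \<theta> continuous_on_const)
  have km [measurable]: "k v \<in> borel_measurable borel" for v
    unfolding k_def using borel_measurable_continuous_onI[OF cont[of v]] by measurable
  have k_le: "cmod (k v p) \<le> (norm \<Phi> * norm v) * \<bar>g p\<bar>" for v p
    using mult_left_mono[OF norm_cinner_le[of "?\<xi> p" v], of "\<bar>g p\<bar>"]
    by (simp add: k_def norm_mult norm_exp_pointer mult_ac)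
  have k_int: "integrable lborel (k v)" for v
    by (rule Bochner_Integration.integrable_bound[of _ "\<lambda>p. (norm \<Phi> * norm v) * \<bar>g p\<bar>"])
       (use g k_le in \<open>auto simp: abs_mult\<close>)
  \<comment> \<open>The multiplier: the average of the phases e^(\<i> \<theta>(p) b) with the weight
    \<open>g\<close> and the overlap of \<open>v\<close> with the rotated vector.\<close>
  define m where "m v b = (\<integral>p. iexp (\<theta> p * b) * k v p \<partial>lborel)" for v b
  have [measurable]: "m v \<in> borel_measurable borel" for v unfolding m_def by measurable
  define C where "C = (\<integral>p. \<bar>g p\<bar> \<partial>lborel)"
  have "C \<ge> 0" by (simp add: C_def)
  have m_le: "cmod (m v b) \<le> C * (norm \<Phi> * norm v)" for v b
  proof -
    have "cmod (m v b) \<le> (\<integral>p. cmod (iexp (\<theta> p * b) * k v p) \<partial>lborel)"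
      unfolding m_def by (rule integral_norm_bound)
    also have "\<dots> = (\<integral>p. cmod (k v p) \<partial>lborel)" by (simp add: norm_mult del: of_real_mult)
    also have "\<dots> \<le> (\<integral>p. (norm \<Phi> * norm v) * \<bar>g p\<bar> \<partial>lborel)"
      using k_int g by (intro integral_mono k_le) auto
    finally show ?thesis by (simp add: C_def mult.commute)
  qed
  have sq: "square_integrable (\<lambda>b. m v b * L2_fun \<Phi> b)" for v
  proof (rule square_integrable_bound)
    have "integrable lborel (\<lambda>b. (C * (norm \<Phi> * norm v))\<^sup>2 * (cmod (L2_fun \<Phi> b))\<^sup>2)"
      using square_integrable_L2_fun[of \<Phi>] by (simp add: square_integrable_def)
    thus "integrable lborel (\<lambda>b. (C * (norm \<Phi> * norm v) * cmod (L2_fun \<Phi> b))\<^sup>2)"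
      by (simp add: power_mult_distrib)
    show "AE b in lborel. cmod (m v b * L2_fun \<Phi> b) \<le> C * (norm \<Phi> * norm v) * cmod (L2_fun \<Phi> b)"
      unfolding norm_mult by (intro AE_I2 mult_right_mono m_le) simp
  qed measurable
  define R where "R v = L2_of (\<lambda>b. m v b * L2_fun \<Phi> b)" for v
  have weak: "cinner u (R v) = (\<integral>p. g p *\<^sub>R (cinner u (?\<xi> p) * cinner (?\<xi> p) v) \<partial>lborel)" for u v
  proof -
    have "cinner (L2_of (L2_fun u)) (R v) = (\<integral>b. cinner (L2_fun u b) (m v b * L2_fun \<Phi> b) \<partial>lborel)"
      unfolding R_def by (rule cinner_L2_of) (simp_all add: sq)
    also have "\<dots> = (\<integral>b. m v b * (cnj (L2_fun u b) * L2_fun \<Phi> b) \<partial>lborel)"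
      by (simp add: cinner_complex_def mult.left_commute)
    also have "\<dots> = (\<integral>b. (\<integral>p. iexp (\<theta> p * b) * (k v p * (cnj (L2_fun u b) * L2_fun \<Phi> b)) \<partial>lborel) \<partial>lborel)"
      unfolding m_def by (subst integral_mult_left_zero[symmetric]) (simp only: mult.assoc)
    also have "\<dots> = (\<integral>p. (\<integral>b. iexp (\<theta> p * b) * (k v p * (cnj (L2_fun u b) * L2_fun \<Phi> b)) \<partial>lborel) \<partial>lborel)"
    proof (rule lborel_pair.Fubini_integral)
      have "integrable (lborel \<Otimes>\<^sub>M lborel) (\<lambda>(p, b). (\<lambda>(p, b). iexp (\<theta> p * b)) (p, b) * (k v p * (cnj (L2_fun u b) * L2_fun \<Phi> b)))"
        by (rule integrable_pair_mult_bounded[OF k_int integrable_cnj_mult]) (auto simp del: of_real_mult)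
      thus "integrable (lborel \<Otimes>\<^sub>M lborel) (\<lambda>(p, b). iexp (\<theta> p * b) * (k v p * (cnj (L2_fun u b) * L2_fun \<Phi> b)))"
        by simp
    qed
    also have "\<dots> = (\<integral>p. g p *\<^sub>R (cinner u (?\<xi> p) * cinner (?\<xi> p) v) \<partial>lborel)"
    proof (rule Bochner_Integration.integral_cong[OF refl])
      fix p
      have "(\<integral>b. iexp (\<theta> p * b) * (k v p * (cnj (L2_fun u b) * L2_fun \<Phi> b)) \<partial>lborel)
          = (\<integral>b. k v p * (iexp (\<theta> p * b) * (cnj (L2_fun u b) * L2_fun \<Phi> b)) \<partial>lborel)"
        by (simp only: mult.left_commute)
      also have "\<dots> = k v p * cinner u (?\<xi> p)"
        unfolding cinner_exp_pointer by (rule integral_mult_right_zero)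
      finally show "(\<integral>b. iexp (\<theta> p * b) * (k v p * (cnj (L2_fun u b) * L2_fun \<Phi> b)) \<partial>lborel)
          = g p *\<^sub>R (cinner u (?\<xi> p) * cinner (?\<xi> p) v)"
        by (simp add: k_def scaleR_conv_of_real mult_ac)
    qed
    finally show ?thesis by simp
  qed
  have int: "integrable lborel (\<lambda>p. g p *\<^sub>R (cinner u (?\<xi> p) * cinner (?\<xi> p) v))" for u v
  proof -
    have "integrable lborel (\<lambda>p. cinner u (?\<xi> p) * k v p)"
    proof (rule Bochner_Integration.integrable_bound)
      show "integrable lborel (\<lambda>p. (norm u * norm \<Phi>) * cmod (k v p))" using k_int[of v] by simp
      have "continuous_on UNIV (\<lambda>p. cinner u (?\<xi> p))"
        by (intro cinner.continuous_on continuous_exp_pointer \<theta> continuous_on_const)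
      from borel_measurable_continuous_onI[OF this] km[of v]
      show "(\<lambda>p. cinner u (?\<xi> p) * k v p) \<in> borel_measurable lborel"
        unfolding measurable_lborel2 measurable_lborel1 by (rule borel_measurable_times)
      show "AE p in lborel. norm (cinner u (?\<xi> p) * k v p) \<le> norm ((norm u * norm \<Phi>) * cmod (k v p))"
        using norm_cinner_le[of u "?\<xi> _"] by (intro AE_I2) (simp add: norm_mult norm_exp_pointer abs_mult mult_right_mono)
    qed
    thus ?thesis by (simp add: k_def scaleR_conv_of_real mult_ac)
  qed
  have bl: "bounded_linear R"
  proof (rule bounded_linear_intro[where K = "C * norm \<Phi> * norm \<Phi>"])
    show "R (v + w) = R v + R w" for v w
    proof (rule cinner_eqI)
      fix u
      show "cinner u (R (v + w)) = cinner u (R v + R w)"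
        using int[of u v] int[of u w] by (simp add: weak cinner_add_right distrib_left scaleR_add_right)
    qed
    show "R (r *\<^sub>R v) = r *\<^sub>R R v" for r v
    proof (rule cinner_eqI)
      fix u
      show "cinner u (R (r *\<^sub>R v)) = cinner u (r *\<^sub>R R v)"
        by (simp only: weak cinner.scaleR_right mult_scaleR_right scaleR_left_commute[of "g _" r] integral_scaleR_right)
    qed
    show "norm (R v) \<le> norm v * (C * norm \<Phi> * norm \<Phi>)" for v
    proof -
      have "(norm (R v))\<^sup>2 \<le> (\<integral>b. (C * (norm \<Phi> * norm v))\<^sup>2 * (cmod (L2_fun \<Phi> b))\<^sup>2 \<partial>lborel)"
        unfolding R_def norm_L2_of[OF sq]
      proof (rule integral_mono)
        show "integrable lborel (\<lambda>b. (cmod (m v b * L2_fun \<Phi> b))\<^sup>2)" using sq by (simp add: square_integrable_def)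
        show "integrable lborel (\<lambda>b. (C * (norm \<Phi> * norm v))\<^sup>2 * (cmod (L2_fun \<Phi> b))\<^sup>2)"
          using square_integrable_L2_fun[of \<Phi>] by (simp add: square_integrable_def)
        show "(cmod (m v b * L2_fun \<Phi> b))\<^sup>2 \<le> (C * (norm \<Phi> * norm v))\<^sup>2 * (cmod (L2_fun \<Phi> b))\<^sup>2" for b
          unfolding norm_mult power_mult_distrib[of "cmod (m v b)"] by (intro mult_right_mono power_mono m_le) auto
      qed
      also have "\<dots> = (C * (norm \<Phi> * norm v) * norm \<Phi>)\<^sup>2" by (simp add: norm_L2 power_mult_distrib)
      finally have "norm (R v) \<le> C * (norm \<Phi> * norm v) * norm \<Phi>"
        by (rule power2_le_imp_le) (simp add: \<open>C \<ge> 0\<close>)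
      thus ?thesis by (simp add: mult_ac)
    qed
  qed
  have "R (c *\<^sub>C v) = c *\<^sub>C R v" for c v
  proof (rule cinner_eqI)
    fix u
    have "g p *\<^sub>R (cinner u (?\<xi> p) * (c * cinner (?\<xi> p) v)) = c * (g p *\<^sub>R (cinner u (?\<xi> p) * cinner (?\<xi> p) v))" for p
      by (simp add: scaleR_conv_of_real mult_ac)
    thus "cinner u (R (c *\<^sub>C v)) = cinner u (c *\<^sub>C R v)"
      by (simp only: weak cinner_scaleC_right integral_mult_right_zero)
  qed
  thus ?thesis
    using weak by (intro exI[of _ "Blinfun R"]) (simp add: complex_linear_def bounded_linear_Blinfun_apply bl)
qed

section \<open>Components with respect to the system\<close>

text \<open>Contraction with the bra of \<open>w\<close> over the system factor, that is, the
  adjoint of the map \<open>vtensor w\<close>.\<close>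

definition component :: "'s::{complex_inner, euclidean_space} \<Rightarrow> ('x::euclidean_space, 's) L2 \<Rightarrow> ('x, complex) L2" where
  "component w u = L2_of (\<lambda>b. cinner w (L2_fun u b))"

lemma square_integrable_component:
  assumes u: "square_integrable u"
  shows "square_integrable (\<lambda>b. cinner w (u b))"
proof (rule square_integrable_bound)
  have "integrable lborel (\<lambda>b. (norm w)\<^sup>2 * (norm (u b))\<^sup>2)" using u by (simp add: square_integrable_def)
  thus "integrable lborel (\<lambda>b. (norm w * norm (u b))\<^sup>2)" by (simp add: power_mult_distrib)
  have "continuous_on UNIV (\<lambda>x. cinner w x)" by (intro cinner.continuous_on continuous_intros)
  thus "(\<lambda>b. cinner w (u b)) \<in> borel_measurable borel"
    using u by (intro measurable_compose[OF square_integrable_measurable[OF u] borel_measurable_continuous_onI])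
qed (simp add: norm_cinner_le)

lemma component_L2_of:
  assumes "square_integrable u"
  shows "component w (L2_of u) = L2_of (\<lambda>b. cinner w (u b))"
  unfolding component_def
proof (rule L2_of_eqI)
  show "AE b in lborel. cinner w (L2_fun (L2_of u) b) = cinner w (u b)"
    using L2_fun_L2_of[OF assms] by eventually_elim simp
qed (simp_all add: square_integrable_component assms)

lemma cinner_vtensor_left: "cinner (w \<otimes>\<^sub>v f) u = cinner f (component w u)"
proof -
  define F U where "F = L2_fun f" and "U = L2_fun u"
  have sq: "square_integrable F" "square_integrable U" by (simp_all add: F_def U_def)
  have "cinner (w \<otimes>\<^sub>v L2_of F) (L2_of U) = cinner (L2_of F) (component w (L2_of U))"
    by (simp add: vtensor_L2_of component_L2_of cinner_L2_of sq square_integrable_vtensor square_integrable_component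
        cinner_scaleC_left cinner_complex_def)
  thus ?thesis by (simp add: F_def U_def)
qed

lemma cinner_vtensor_right: "cinner u (w \<otimes>\<^sub>v f) = cinner (component w u) f"
  using cinner_vtensor_left[of w f u] by (metis cinner_commute)

lemma component_add: "component w (u + v) = component w u + component w v"
  by (rule cinner_eqI) (simp add: cinner_add_right flip: cinner_vtensor_left)

lemma component_scaleR: "component w (r *\<^sub>R u) = r *\<^sub>R component w u"
  by (rule cinner_eqI) (simp add: cinner.scaleR_right flip: cinner_vtensor_left)

lemma norm_component_le: "norm (component w u) \<le> norm u * norm w"
proof (cases "component w u = 0")
  case False
  have "complex_of_real ((norm (component w u))\<^sup>2) = cinner (component w u) (component w u)"
    by (simp add: cinner_same power2_norm_eq_inner)
  also have "\<dots> = cinner (w \<otimes>\<^sub>v component w u) u" by (simp add: cinner_vtensor_left)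
  finally have "(norm (component w u))\<^sup>2 = cmod (cinner (w \<otimes>\<^sub>v component w u) u)"
    by (metis abs_of_nonneg norm_of_real zero_le_power2)
  also have "\<dots> \<le> (norm w * norm (component w u)) * norm u"
    using norm_cinner_le[of "w \<otimes>\<^sub>v component w u" u] by (simp add: norm_vtensor)
  finally have "norm (component w u) * norm (component w u) \<le> norm (component w u) * (norm u * norm w)"
    by (simp add: power2_eq_square mult_ac)
  thus ?thesis using False by simp
qed simp

lemma component_vtensor: "component w (u \<otimes>\<^sub>v f) = cinner w u *\<^sub>C f"
proof (rule cinner_eqI)
  fix g
  have "cinner (w \<otimes>\<^sub>v L2_of (L2_fun g)) (u \<otimes>\<^sub>v L2_of (L2_fun f)) = cinner w u * cinner (L2_of (L2_fun g)) (L2_of (L2_fun f))"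
    unfolding vtensor_L2_of[OF square_integrable_L2_fun]
    by (simp only: cinner_L2_of square_integrable_vtensor square_integrable_L2_fun cinner_scaleC_left cinner_scaleC_right
        cinner_complex_def integral_mult_right_zero[symmetric]) (simp add: mult_ac)
  thus "cinner g (component w (u \<otimes>\<^sub>v f)) = cinner g (cinner w u *\<^sub>C f)"
    by (simp add: cinner_vtensor_left[symmetric] cinner_scaleC_right)
qed

lemma component_expansion:
  fixes \<phi> :: "'i \<Rightarrow> 's::{complex_inner, euclidean_space}"
  assumes \<phi>: "orthonormal_on I \<phi>" "finite I" "cspan (\<phi> ` I) = UNIV"
  shows "u = (\<Sum>k\<in>I. \<phi> k \<otimes>\<^sub>v component (\<phi> k) u)"
proof -
  have sq: "square_integrable (\<lambda>b. cinner (\<phi> k) (L2_fun u b))" for k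
    by (intro square_integrable_component square_integrable_L2_fun)
  have "(\<Sum>k\<in>I. \<phi> k \<otimes>\<^sub>v component (\<phi> k) u) = L2_of (\<lambda>b. \<Sum>k\<in>I. cinner (\<phi> k) (L2_fun u b) *\<^sub>C \<phi> k)"
    by (simp add: component_def vtensor_L2_of sq L2_of_sum square_integrable_vtensor)
  also have "(\<lambda>b. \<Sum>k\<in>I. cinner (\<phi> k) (L2_fun u b) *\<^sub>C \<phi> k) = L2_fun u"
    using orthonormal_expansion[OF \<phi>] by (intro ext) metis
  finally show ?thesis by simp
qed

text \<open>The explicit map satisfies the defining equation because \<open>R\<close> lets the
  complex number \<open>cinner w u\<close> pass. It is the only solution since every vector is a
  finite sum of product vectors along the basis \<open>\<phi>\<close>.\<close>

lemma op_tensor_ketbra: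
  fixes \<phi> :: "'i \<Rightarrow> 's::{complex_inner, euclidean_space}"
    and R :: "('x::euclidean_space, complex) L2 \<Rightarrow>\<^sub>L ('x, complex) L2" and w :: 's
  assumes \<phi>: "orthonormal_on I \<phi>" "finite I" "cspan (\<phi> ` I) = UNIV" and R: "complex_linear R"
  shows "op_tensor (ketbra w w) R u = w \<otimes>\<^sub>v R (component w u)"
proof -
  let ?f = "\<lambda>u. w \<otimes>\<^sub>v R (component w u)"
  have bl: "bounded_linear ?f"
    by (intro bounded_linear_compose[OF vtensor_bl.bounded_linear_right]
        bounded_linear_compose[OF blinfun.bounded_linear_right]
        bounded_linear_intro[where K = "norm w"] component_add component_scaleR norm_component_le)
  have "op_tensor (ketbra w w) R = Blinfun ?f"
    unfolding op_tensor_def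
  proof (rule the_equality)
    show T: "\<forall>u f. Blinfun ?f (u \<otimes>\<^sub>v f) = ketbra w w u \<otimes>\<^sub>v R f"
      using R by (simp add: bounded_linear_Blinfun_apply[OF bl] component_vtensor complex_linear_def
          ketbra.rep_eq vtensor_scaleC_left vtensor_scaleC_right)
    fix T' :: "('x, 's) L2 \<Rightarrow>\<^sub>L ('x, 's) L2" assume T': "\<forall>u f. T' (u \<otimes>\<^sub>v f) = ketbra w w u \<otimes>\<^sub>v R f"
    show "T' = Blinfun ?f"
    proof (rule blinfun_eqI)
      fix v
      have "T' (\<Sum>k\<in>I. \<phi> k \<otimes>\<^sub>v component (\<phi> k) v) = Blinfun ?f (\<Sum>k\<in>I. \<phi> k \<otimes>\<^sub>v component (\<phi> k) v)"
        by (simp only: blinfun.sum_right T T')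
      thus "T' v = Blinfun ?f v" using component_expansion[OF \<phi>, of v] by simp
    qed
  qed
  thus ?thesis by (simp add: bounded_linear_Blinfun_apply[OF bl])
qed

text \<open>Uniqueness in the definite description requires that some orthonormal basis exists, as
  otherwise its condition would be vacuous; the Fourier basis of period 1 is a witness.\<close>

lemma partial_trace_eqI:
  fixes T :: "(real \<times> real, 's::{complex_inner, euclidean_space}) L2 \<Rightarrow>\<^sub>L (real \<times> real, 's) L2"
    and R :: "(real, 's) L2 \<Rightarrow>\<^sub>L (real, 's) L2"
  assumes "\<And>\<E> u v. orthonormal_basis \<E> \<Longrightarrow>
    ((\<lambda>e. cinner (probe_tensor e u) (T (probe_tensor e v))) has_sum cinner u (R v)) \<E>"
  shows "partial_trace T = R"
  unfolding partial_trace_def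
proof (rule the_equality)
  show "\<forall>\<E> u v. orthonormal_basis \<E> \<longrightarrow>
     ((\<lambda>e. cinner (probe_tensor e u) (T (probe_tensor e v))) has_sum cinner u (R v)) \<E>"
    using assms by blast
  fix R' :: "(real, 's) L2 \<Rightarrow>\<^sub>L (real, 's) L2" assume R': "\<forall>\<E> u v. orthonormal_basis \<E> \<longrightarrow>
     ((\<lambda>e. cinner (probe_tensor e u) (T (probe_tensor e v))) has_sum cinner u (R' v)) \<E>"
  have B: "orthonormal_basis (fourier_basis 1)" by (rule orthonormal_basis_fourier) simp
  show "R' = R"
  proof (rule blinfun_eq_cinnerI)
    fix u v
    show "cinner u (R' v) = cinner u (R v)"
      using has_sum_unique[OF R'[rule_format, OF B, of u v] assms[OF B, of u v]] .
  qed
qed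

section \<open>The contracted final state\<close>

text \<open>Once the probe is written as a Fourier integral, the integral over b becomes the matrix
  element of a pointer phase, and what remains in q is a Fourier integral with its frequencies
  shifted by \<gamma>. The matrix element is bounded and continuous in k, so band limitation
  survives.\<close>

lemma cinner_shear_product:
  assumes g: "band_fun \<kappa> g"
    and h: "h = (\<lambda>k. g k * cinner f (exp_pointer (\<gamma> * \<beta> / 2 - \<beta> * k) \<Phi>))"
  shows "band_fun (\<kappa> + \<bar>\<gamma>\<bar>) (\<lambda>k. h (k + \<gamma>))"
    and "cinner (probe_tensor e f) (shear_op \<gamma> \<beta> (probe_tensor (L2_of (fourier_integral g)) \<Phi>))
      = cinner e (L2_of (fourier_integral (\<lambda>k. h (k + \<gamma>))))"
proof -
  define w where "w k = cinner f (exp_pointer (\<gamma> * \<beta> / 2 - \<beta> * k) \<Phi>)" for k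
  have hw: "h k = g k * w k" for k by (simp add: h w_def)
  have gsq: "square_integrable g" using g by (simp add: band_fun_def)
  have [measurable]: "g \<in> borel_measurable borel" using gsq by (rule square_integrable_measurable)
  have "continuous_on UNIV w"
    unfolding w_def by (intro cinner.continuous_on continuous_on_const continuous_exp_pointer continuous_intros)
  hence wm [measurable]: "w \<in> borel_measurable borel" by (rule borel_measurable_continuous_onI)
  have w_le: "cmod (w k) \<le> norm f * norm \<Phi>" for k
    using norm_cinner_le[of f "exp_pointer (\<gamma> * \<beta> / 2 - \<beta> * k) \<Phi>"] by (simp add: w_def norm_exp_pointer)
  have hm [measurable]: "h \<in> borel_measurable borel" unfolding hw[abs_def] by measurable
  have hsq: "square_integrable h"
  proof (rule square_integrable_bound)
    have "integrable lborel (\<lambda>k. (norm f * norm \<Phi>)\<^sup>2 * (cmod (g k))\<^sup>2)"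
      using gsq by (simp add: square_integrable_def)
    thus "integrable lborel (\<lambda>k. (norm f * norm \<Phi> * cmod (g k))\<^sup>2)" by (simp add: power_mult_distrib)
    show "AE k in lborel. cmod (h k) \<le> norm f * norm \<Phi> * cmod (g k)"
      using mult_right_mono[OF w_le, of "cmod (g _)"] by (intro AE_I2) (simp add: hw norm_mult mult.commute)
  qed measurable
  have "integrable lborel (\<lambda>k. (\<lambda>k. (cmod (h k))\<^sup>2) (\<gamma> + 1 * k))"
    using hsq by (intro lborel_integrable_real_affine) (auto simp: square_integrable_def)
  hence "square_integrable (\<lambda>k. h (k + \<gamma>))"
    by (simp add: square_integrable_def add.commute)
  thus band: "band_fun (\<kappa> + \<bar>\<gamma>\<bar>) (\<lambda>k. h (k + \<gamma>))"
    using g by (auto simp: band_fun_def hw)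
  let ?H = "fourier_integral (\<lambda>k. h (k + \<gamma>))"
  have Hsq: "square_integrable ?H" by (rule square_integrable_fourier_integral[OF band])
  have Fsq: "square_integrable (fourier_integral g)" by (rule square_integrable_fourier_integral[OF g])
  define r where "r b = cnj (L2_fun f b) * L2_fun \<Phi> b" for b
  have r_int: "integrable lborel r" unfolding r_def by (rule integrable_cnj_mult)
  have inner: "(\<integral>b. r b * (exp (- \<i> * complex_of_real (\<gamma> * (q - \<beta> * b / 2))) * fourier_integral g (q - \<beta> * b)) \<partial>lborel) = ?H q" for q
  proof -
    \<comment> \<open>The phases of the shear and of the Fourier integral combined: linear in b with
      the pointer angle as slope, and linear in q with the shifted frequency k - \<gamma>.\<close>
    define ph where "ph k b = q * (k - \<gamma>) + (\<gamma> * \<beta> / 2 - \<beta> * k) * b" for k b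
    have phase: "exp (- \<i> * complex_of_real (\<gamma> * (q - \<beta> * b / 2))) * iexp ((q - \<beta> * b) * k)
        = iexp (ph k b)" for k b
      by (simp add: ph_def exp_add[symmetric] algebra_simps)
    have "r b * (exp (- \<i> * complex_of_real (\<gamma> * (q - \<beta> * b / 2))) * fourier_integral g (q - \<beta> * b))
        = (\<integral>k. iexp (ph k b) * (g k * r b) \<partial>lborel)" for b
    proof -
      have "r b * (exp (- \<i> * complex_of_real (\<gamma> * (q - \<beta> * b / 2))) * fourier_integral g (q - \<beta> * b))
          = (\<integral>k. (r b * exp (- \<i> * complex_of_real (\<gamma> * (q - \<beta> * b / 2)))) * (iexp ((q - \<beta> * b) * k) * g k) \<partial>lborel)"
        unfolding fourier_integral_def by (simp only: integral_mult_right_zero mult.assoc)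
      also have "\<dots> = (\<integral>k. iexp (ph k b) * (g k * r b) \<partial>lborel)"
        unfolding phase[symmetric] by (simp only: mult_ac)
      finally show ?thesis .
    qed
    hence "(\<integral>b. r b * (exp (- \<i> * complex_of_real (\<gamma> * (q - \<beta> * b / 2))) * fourier_integral g (q - \<beta> * b)) \<partial>lborel)
        = (\<integral>b. (\<integral>k. iexp (ph k b) * (g k * r b) \<partial>lborel) \<partial>lborel)" by (simp only:)
    also have "\<dots> = (\<integral>k. (\<integral>b. iexp (ph k b) * (g k * r b) \<partial>lborel) \<partial>lborel)"
    proof (rule lborel_pair.Fubini_integral)
      have "integrable (lborel \<Otimes>\<^sub>M lborel) (\<lambda>(k, b). (\<lambda>(k, b). iexp (ph k b)) (k, b) * (g k * r b))"
        by (rule integrable_pair_mult_bounded[OF band_fun_integrable[OF g] r_int])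
           (auto simp: ph_def simp del: of_real_mult of_real_add)
      thus "integrable (lborel \<Otimes>\<^sub>M lborel) (\<lambda>(k, b). iexp (ph k b) * (g k * r b))" by simp
    qed
    also have "\<dots> = (\<integral>k. exp (- \<i> * complex_of_real (q * \<gamma>)) * (iexp (q * k) * h k) \<partial>lborel)"
    proof (rule Bochner_Integration.integral_cong[OF refl])
      fix k
      have "iexp (ph k b) = (exp (- \<i> * complex_of_real (q * \<gamma>)) * iexp (q * k))
          * iexp ((\<gamma> * \<beta> / 2 - \<beta> * k) * b)" for b
        by (simp add: ph_def exp_add[symmetric] algebra_simps)
      hence "(\<integral>b. iexp (ph k b) * (g k * r b) \<partial>lborel)
          = (\<integral>b. (exp (- \<i> * complex_of_real (q * \<gamma>)) * iexp (q * k) * g k)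
            * (iexp ((\<gamma> * \<beta> / 2 - \<beta> * k) * b) * r b) \<partial>lborel)"
        by (simp only: mult_ac)
      also have "\<dots> = (exp (- \<i> * complex_of_real (q * \<gamma>)) * iexp (q * k) * g k) * w k"
        unfolding w_def cinner_exp_pointer r_def by (rule integral_mult_right_zero)
      finally show "(\<integral>b. iexp (ph k b) * (g k * r b) \<partial>lborel)
          = exp (- \<i> * complex_of_real (q * \<gamma>)) * (iexp (q * k) * h k)"
        by (simp only: hw mult.assoc)
    qed
    also have "\<dots> = exp (- \<i> * complex_of_real (q * \<gamma>)) * fourier_integral h q"
      unfolding fourier_integral_def by (rule integral_mult_right_zero)
    also have "\<dots> = ?H q" using fourier_integral_shift[of h "- \<gamma>" q] by simp
    finally show ?thesis .
  qed
  define F where "F x = fourier_integral g (fst x) *\<^sub>C L2_fun \<Phi> (snd x)" for x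
  have sqF: "square_integrable F"
    unfolding F_def by (rule square_integrable_probe_tensor[OF Fsq square_integrable_L2_fun])
  define E where "E x = L2_fun e (fst x) *\<^sub>C L2_fun f (snd x)" for x
  have sqE: "square_integrable E"
    unfolding E_def by (rule square_integrable_probe_tensor) simp_all
  have Feq: "probe_tensor (L2_of (fourier_integral g)) \<Phi> = L2_of F"
    using probe_tensor_L2_of[OF Fsq square_integrable_L2_fun[of \<Phi>]] by (simp add: F_def[abs_def])
  have Eeq: "probe_tensor e f = L2_of E"
    using probe_tensor_L2_of[of "L2_fun e" "L2_fun f"] by (simp add: E_def[abs_def])
  have "cinner (probe_tensor e f) (shear_op \<gamma> \<beta> (probe_tensor (L2_of (fourier_integral g)) \<Phi>))
      = (\<integral>x. cinner (E x) (shear_fun \<gamma> \<beta> F x) \<partial>lborel)"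
    unfolding Feq Eeq shear_op_L2_of[OF sqF]
    by (rule cinner_L2_of[OF sqE square_integrable_shear_fun[OF sqF]])
  also have "\<dots> = (\<integral>q. (\<integral>b. cinner (E (q, b)) (shear_fun \<gamma> \<beta> F (q, b)) \<partial>lborel) \<partial>lborel)"
    unfolding lborel_prod[symmetric]
    by (rule lborel_pair.integral_fst'[symmetric])
       (unfold lborel_prod, rule square_integrable_cinner[OF sqE square_integrable_shear_fun[OF sqF]])
  also have "\<dots> = (\<integral>q. cinner (L2_fun e q) (?H q) \<partial>lborel)"
  proof (rule Bochner_Integration.integral_cong[OF refl])
    fix q
    have "cinner (E (q, b)) (shear_fun \<gamma> \<beta> F (q, b)) = cnj (L2_fun e q) *
        (r b * (exp (- \<i> * complex_of_real (\<gamma> * (q - \<beta> * b / 2))) * fourier_integral g (q - \<beta> * b)))" for b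
      unfolding E_def F_def shear_fun_def scaleC_complex_def cinner_complex_def fst_conv snd_conv r_def complex_cnj_mult
      by (simp only: mult_ac)
    hence "(\<integral>b. cinner (E (q, b)) (shear_fun \<gamma> \<beta> F (q, b)) \<partial>lborel) = cnj (L2_fun e q) *
        (\<integral>b. r b * (exp (- \<i> * complex_of_real (\<gamma> * (q - \<beta> * b / 2))) * fourier_integral g (q - \<beta> * b)) \<partial>lborel)"
      by (simp only: integral_mult_right_zero)
    thus "(\<integral>b. cinner (E (q, b)) (shear_fun \<gamma> \<beta> F (q, b)) \<partial>lborel) = cinner (L2_fun e q) (?H q)"
      by (simp only: inner cinner_complex_def)
  qed
  also have "\<dots> = cinner (L2_of (L2_fun e)) (L2_of ?H)"
    by (rule cinner_L2_of[symmetric]) (simp_all add: Hsq)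
  finally show "cinner (probe_tensor e f) (shear_op \<gamma> \<beta> (probe_tensor (L2_of (fourier_integral g)) \<Phi>))
      = cinner e (L2_of ?H)" by simp
qed

lemma cinner_probe_tensor_vtensor:
  "cinner (probe_tensor e u) (w \<otimes>\<^sub>v S) = cinner (probe_tensor e (component w u)) S"
proof -
  define E U F where "E = L2_fun e" and "U = L2_fun u" and "F = L2_fun S"
  have sq: "square_integrable E" "square_integrable U" "square_integrable F" by (simp_all add: E_def U_def F_def)
  have comp: "component w (probe_tensor (L2_of E) (L2_of U)) = probe_tensor (L2_of E) (component w (L2_of U))"
    by (simp add: component_L2_of probe_tensor_L2_of sq square_integrable_probe_tensor square_integrable_component
        cinner_scaleC_right scaleC_complex_def)
  have "cinner (probe_tensor e u) (w \<otimes>\<^sub>v S) = cinner (component w (probe_tensor e u)) S"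
    by (rule cinner_vtensor_right)
  thus ?thesis using comp by (simp add: E_def U_def)
qed

section \<open>Superpositions of band-limited functions\<close>

lemma fourier_integral_L2_sum:
  assumes "\<And>k. k \<in> I \<Longrightarrow> band_fun \<kappa> (G k)"
  shows "(\<Sum>k\<in>I. L2_of (fourier_integral (G k))) = L2_of (fourier_integral (\<lambda>x. \<Sum>k\<in>I. G k x))"
proof -
  have "fourier_integral (\<lambda>x. \<Sum>k\<in>I. G k x) = (\<lambda>x. \<Sum>k\<in>I. fourier_integral (G k) x)"
    unfolding fourier_integral_def sum_distrib_left
    using assms band_fun_integrable by (intro ext Bochner_Integration.integral_sum integrable_exp_mult) blast
  thus ?thesis by (simp add: L2_of_sum square_integrable_fourier_integral[OF assms])
qed

lemma band_fun_mono: "band_fun \<kappa> g \<Longrightarrow> \<kappa> \<le> \<kappa>' \<Longrightarrow> band_fun \<kappa>' g"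
  by (auto simp: band_fun_def)

lemma band_fun_sum: "(\<And>k. k \<in> I \<Longrightarrow> band_fun \<kappa> (G k)) \<Longrightarrow> band_fun \<kappa> (\<lambda>x. \<Sum>k\<in>I. G k x)"
  by (auto simp: band_fun_def square_integrable_sum intro!: sum.neutral)

lemma cinner_sum_disjoint_support:
  assumes I: "finite I" and sq: "\<And>k. k \<in> I \<Longrightarrow> square_integrable (F k)" "\<And>k. k \<in> I \<Longrightarrow> square_integrable (G k)"
    and disj: "\<And>k l x. k \<in> I \<Longrightarrow> l \<in> I \<Longrightarrow> k \<noteq> l \<Longrightarrow> F k x = 0 \<or> G l x = (0::complex)"
  shows "cinner (L2_of (\<lambda>x. \<Sum>k\<in>I. F k x)) (L2_of (\<lambda>x. \<Sum>k\<in>I. G k x)) = (\<Sum>k\<in>I. cinner (L2_of (F k)) (L2_of (G k)))"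
proof -
  have "cinner (\<Sum>k\<in>I. F k x) (\<Sum>k\<in>I. G k x) = (\<Sum>k\<in>I. cinner (F k x) (G k x))" for x
  proof -
    have "cinner (F k x) (\<Sum>l\<in>I. G l x) = cinner (F k x) (G k x)" if "k \<in> I" for k
    proof -
      have "cinner (F k x) (\<Sum>l\<in>I. G l x) = (\<Sum>l\<in>I. if l = k then cinner (F k x) (G k x) else 0)"
        unfolding cinner.sum_right using disj[OF that, of _ x]
        by (intro sum.cong refl) (force simp: cinner_complex_def)
      thus ?thesis using I that by simp
    qed
    thus ?thesis by (simp add: cinner.sum_left)
  qed
  thus ?thesis
    using sq by (simp add: cinner_L2_of square_integrable_sum square_integrable_cinner)
qed

section \<open>The reduced state of system and pointer\<close>

theorem mainTheorem1:
  fixes A :: "'s::{complex_inner, euclidean_space} \<Rightarrow>\<^sub>L 's"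
    and \<phi> :: "nat \<Rightarrow> 's" and a :: "nat \<Rightarrow> real" and N :: nat
    and \<psi>0 :: 's and \<Psi> \<Phi>0 :: "(real, complex) L2"
    and hbar lam \<alpha> \<beta> a0 \<kappa>0 :: real
    and U :: "(real \<times> real, 's) L2 \<Rightarrow>\<^sub>L (real \<times> real, 's) L2"
    and \<Psi>f :: "(real \<times> real, 's) L2"
  assumes "N \<ge> 2"
    and "orthonormal_on {1..N} \<phi>" and "cspan (\<phi> ` {1..N}) = UNIV"
    and "complex_linear A" and "self_adjoint A"
    and "\<And>k. k \<in> {1..N} \<Longrightarrow> A (\<phi> k) = complex_of_real (a k) *\<^sub>C \<phi> k"
    and "inj_on a {1..N}"
    and "a0 = Min {a k - a l | k l. k \<in> {1..N} \<and> l \<in> {1..N} \<and> a k > a l}"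
    and "norm \<psi>0 = 1" and "norm \<Psi> = 1" and "norm \<Phi>0 = 1"
    and "hbar > 0" and "lam > 0" and "\<alpha> > 0" and "\<beta> = 2 * lam / \<alpha>"
    and "is_operator_function (closure (coupling_graph hbar \<alpha> \<beta> N \<phi> A))
           (\<lambda>t. exp (- (\<i> / complex_of_real hbar) * complex_of_real t)) U"
    and "\<Psi>f = U (probe_tensor \<Psi> (\<psi>0 \<otimes>\<^sub>v \<Phi>0))"
    and "momentum_limited \<kappa>0 \<Psi>"
    and "\<alpha> > 2 * hbar * \<kappa>0 / a0"
  shows "\<exists>\<rho> :: nat \<Rightarrow> ((real, complex) L2 \<Rightarrow>\<^sub>L (real, complex) L2).
    (\<forall>k\<in>{1..N}. has_trace_norm_integral lborel
       (\<lambda>p. (cmod (L2_fun (momentum_wavefunction hbar \<Psi>) p))\<^sup>2 *\<^sub>R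
         (exp_pointer ((lam * a k - \<beta> * p) / hbar) o\<^sub>L ketbra \<Phi>0 \<Phi>0 o\<^sub>L
          exp_pointer (- ((lam * a k - \<beta> * p) / hbar))))
       (\<rho> k)) \<and>
    partial_trace (ketbra \<Psi>f \<Psi>f) =
      (\<Sum>k=1..N. (cmod (cinner (\<phi> k) \<psi>0))\<^sup>2 *\<^sub>R op_tensor (ketbra (\<phi> k) (\<phi> k)) (\<rho> k))"
proof -
  note hbar = assms(12) and \<phi> = assms(2,3) and A = assms(6)
  have "\<beta> \<ge> 0" using assms(13-15) by simp
  obtain g where g: "band_fun \<kappa>0 g" and \<Psi>g: "AE x in lborel. L2_fun \<Psi> x = fourier_integral g x"
    using momentum_limitedE[OF assms(18)] .
  have \<Psi>: "\<Psi> = L2_of (fourier_integral g)"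
    using L2_of_eqI[OF square_integrable_L2_fun square_integrable_fourier_integral[OF g] \<Psi>g] by simp
  define \<gamma> where "\<gamma> k = \<alpha> * a k / hbar" for k
  define c where "c k = cinner (\<phi> k) \<psi>0" for k
  define \<theta> where "\<theta> k p = (lam * a k - \<beta> * p) / hbar" for k p
  define \<xi> where "\<xi> k p = exp_pointer (\<theta> k p) \<Phi>0" for k p
  define D where "D p = (cmod (L2_fun (momentum_wavefunction hbar \<Psi>) p))\<^sup>2" for p
  have D_int: "integrable lborel D"
    using square_integrable_L2_fun[of "momentum_wavefunction hbar \<Psi>"] by (simp add: square_integrable_def D_def[abs_def])
  have [measurable]: "D \<in> borel_measurable borel" using D_int by (auto dest: borel_measurable_integrable)
  have gm [measurable]: "g \<in> borel_measurable borel" by (rule band_fun_measurable[OF g])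
  have \<theta>_cont: "continuous_on UNIV (\<theta> k)" for k
    unfolding \<theta>_def using hbar by (intro continuous_intros) auto
  have \<xi>_cont: "continuous_on UNIV (\<xi> k)" for k
    unfolding \<xi>_def by (rule continuous_exp_pointer[OF \<theta>_cont])
  \<comment> \<open>Here \<open>\<rho>\<close> is fixed by its matrix elements;
    \<open>trace_int\<close> identifies it with the trace-norm integral.\<close>
  obtain \<rho> where \<rho>_lin: "\<And>k. complex_linear (\<rho> k)"
    and \<rho>: "\<And>k u v. cinner u (\<rho> k v) = (\<integral>p. D p *\<^sub>R (cinner u (\<xi> k p) * cinner (\<xi> k p) v) \<partial>lborel)"
    using rank_one_mixture_exists[OF D_int \<theta>_cont, of _ \<Phi>0] unfolding \<xi>_def by metis
  have trace_int: "has_trace_norm_integral lborel (\<lambda>p. D p *\<^sub>R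
         (exp_pointer ((lam * a k - \<beta> * p) / hbar) o\<^sub>L ketbra \<Phi>0 \<Phi>0 o\<^sub>L
          exp_pointer (- ((lam * a k - \<beta> * p) / hbar)))) (\<rho> k)" for k
    unfolding exp_pointer_conjugate_ketbra
    using has_trace_norm_integral_rank_one[OF D_int \<xi>_cont, of k "\<rho> k"] \<rho>[of _ k] assms(11)
    by (simp add: \<xi>_def \<theta>_def norm_exp_pointer)
  have D_eq: "AE p in lborel. D p = (2 * pi / hbar) * (cmod (g (p / hbar)))\<^sup>2"
    unfolding D_def momentum_wavefunction_band(2)[OF hbar g \<Psi>g]
    using L2_fun_L2_of[OF momentum_wavefunction_band(1)[OF hbar g \<Psi>g]]
    by eventually_elim (use hbar in \<open>simp add: norm_mult power_mult_distrib\<close>)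
  \<comment> \<open>In the wave number x = p / hbar the momentum density becomes 2 pi |g|^2: the
    Jacobian cancels the hbar in \<open>D_eq\<close>.\<close>
  have \<rho>_band: "cinner u (\<rho> k v)
      = (2 * pi) *\<^sub>R (\<integral>x. (cmod (g x))\<^sup>2 *\<^sub>R (cinner u (\<xi> k (hbar * x)) * cinner (\<xi> k (hbar * x)) v) \<partial>lborel)" for k u v
  proof -
    have [measurable]: "(\<lambda>p. cinner u (\<xi> k p) * cinner (\<xi> k p) v) \<in> borel_measurable borel"
      by (intro borel_measurable_continuous_onI continuous_intros cinner.continuous_on \<xi>_cont)
    have "cinner u (\<rho> k v) = (\<integral>p. ((2 * pi / hbar) * (cmod (g (p / hbar)))\<^sup>2) *\<^sub>R (cinner u (\<xi> k p) * cinner (\<xi> k p) v) \<partial>lborel)"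
      unfolding \<rho>
    proof (rule integral_cong_AE)
      show "AE p in lborel. D p *\<^sub>R (cinner u (\<xi> k p) * cinner (\<xi> k p) v)
          = ((2 * pi / hbar) * (cmod (g (p / hbar)))\<^sup>2) *\<^sub>R (cinner u (\<xi> k p) * cinner (\<xi> k p) v)"
        using D_eq by eventually_elim simp
    qed measurable
    also have "\<dots> = hbar *\<^sub>R (\<integral>x. ((2 * pi / hbar) * (cmod (g x))\<^sup>2) *\<^sub>R (cinner u (\<xi> k (hbar * x)) * cinner (\<xi> k (hbar * x)) v) \<partial>lborel)"
      using hbar
      by (subst lborel_integral_real_affine[of hbar _ 0]) simp_all
    also have "\<dots> = hbar *\<^sub>R (2 * pi / hbar) *\<^sub>R (\<integral>x. (cmod (g x))\<^sup>2 *\<^sub>R (cinner u (\<xi> k (hbar * x)) * cinner (\<xi> k (hbar * x)) v) \<partial>lborel)"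
      unfolding scaleR_scaleR[symmetric, of "2 * pi / hbar"] integral_scaleR_right ..
    finally show ?thesis using hbar by simp
  qed
  \<comment> \<open>The wave-number amplitude that the k-th branch contributes to the contraction of
    the final state with \<open>u\<close>.\<close>
  define G where "G k u x = c k * (g (x + \<gamma> k) * cinner (component (\<phi> k) u) (\<xi> k (hbar * (x + \<gamma> k))))" for k u x
  \<comment> \<open>One band for all branches, as Plancherel's identity for their sum
    requires.\<close>
  define K where "K = \<kappa>0 + (\<Sum>k=1..N. \<bar>\<gamma> k\<bar>)"
  \<comment> \<open>This is where \<beta> = 2 lam / \<alpha> enters:
    \<open>\<gamma> k * \<beta> / 2\<close> equals \<open>lam * a k / hbar\<close>, so the phase of
    the sheared state turns into the pointer angle of \<open>\<rho> k\<close> at momentum hbar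
    x.\<close>
  have \<gamma>\<beta>: "\<gamma> k * \<beta> / 2 - \<beta> * x = \<theta> k (hbar * x)" for k x
    using hbar assms(14,15) by (simp add: \<gamma>_def \<theta>_def field_simps)
  have G_band: "band_fun K (G k u)"
    and G_cinner: "cinner (probe_tensor e (component (\<phi> k) u)) (shear_op (\<gamma> k) \<beta> (probe_tensor (c k *\<^sub>C \<Psi>) \<Phi>0))
      = cinner e (L2_of (fourier_integral (G k u)))" if k: "k \<in> {1..N}" for k u e
  proof -
    define h where "h = (\<lambda>x. (c k * g x) * cinner (component (\<phi> k) u) (exp_pointer (\<gamma> k * \<beta> / 2 - \<beta> * x) \<Phi>0))"
    have Gh: "G k u = (\<lambda>x. h (x + \<gamma> k))"
      by (simp add: G_def[abs_def] h_def \<gamma>\<beta> \<xi>_def mult.assoc)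
    note sh = cinner_shear_product[OF band_fun_mult[OF g, of "c k"] h_def]
    have "\<bar>\<gamma> k\<bar> \<le> (\<Sum>k=1..N. \<bar>\<gamma> k\<bar>)" using k by (intro member_le_sum) auto
    thus "band_fun K (G k u)"
      unfolding Gh by (intro band_fun_mono[OF sh(1)]) (simp add: K_def)
    have "c k *\<^sub>C \<Psi> = L2_of (fourier_integral (\<lambda>x. c k * g x))"
      unfolding \<Psi> fourier_integral_mult[abs_def]
      by (simp add: L2_of_scaleC square_integrable_fourier_integral[OF g] scaleC_complex_def)
    thus "cinner (probe_tensor e (component (\<phi> k) u)) (shear_op (\<gamma> k) \<beta> (probe_tensor (c k *\<^sub>C \<Psi>) \<Phi>0))
      = cinner e (L2_of (fourier_integral (G k u)))" unfolding Gh using sh(2) by simp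
  qed
  have G_sq: "square_integrable (G k u)" if "k \<in> {1..N}" for k u
    using G_band[OF that] by (simp add: band_fun_def)
  \<comment> \<open>The probe vector left over when the final state is contracted with
    \<open>u\<close>; all matrix elements of the partial trace are pairings of such vectors.\<close>
  define X where "X u = L2_of (fourier_integral (\<lambda>x. \<Sum>k=1..N. G k u x))" for u
  have \<Psi>f: "\<Psi>f = (\<Sum>k=1..N. \<phi> k \<otimes>\<^sub>v shear_op (\<gamma> k) \<beta> (probe_tensor (c k *\<^sub>C \<Psi>) \<Phi>0))"
    unfolding assms(17) \<gamma>_def c_def
    by (rule evolution_state[OF assms(16) hbar \<open>\<beta> \<ge> 0\<close> A \<phi>])
  have contraction: "cinner (probe_tensor e u) \<Psi>f = cinner e (X u)" for e u
  proof -
    have "cinner (probe_tensor e u) \<Psi>f = (\<Sum>k=1..N. cinner e (L2_of (fourier_integral (G k u))))"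
      unfolding \<Psi>f cinner.sum_right cinner_probe_tensor_vtensor by (intro sum.cong refl G_cinner)
    also have "\<dots> = cinner e (X u)"
      unfolding X_def cinner.sum_right[symmetric]
      by (rule arg_cong[OF fourier_integral_L2_sum[OF G_band]])
    finally show ?thesis .
  qed
  have gap: "2 * \<kappa>0 < \<bar>\<gamma> k - \<gamma> l\<bar>" if kl: "k \<in> {1..N}" "l \<in> {1..N}" "k \<noteq> l" for k l
  proof -
    let ?S = "{a k - a l | k l. k \<in> {1..N} \<and> l \<in> {1..N} \<and> a k > a l}"
    have "?S \<subseteq> (\<lambda>(k, l). a k - a l) ` ({1..N} \<times> {1..N})" by auto
    hence fin: "finite ?S" by (rule finite_subset) auto
    have "a k \<noteq> a l" using kl assms(7) by (auto dest: inj_onD)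
    have mem: "\<bar>a k - a l\<bar> \<in> ?S"
    proof (cases "a k > a l")
      case True
      hence "\<bar>a k - a l\<bar> = a k - a l" by simp
      thus ?thesis using True kl by blast
    next
      case False
      hence "\<bar>a k - a l\<bar> = a l - a k" "a l > a k" using \<open>a k \<noteq> a l\<close> by auto
      thus ?thesis using kl by blast
    qed
    \<comment> \<open>The pair \<open>k\<close>, \<open>l\<close> shows that the set is nonempty, so
      its minimum is attained and hence positive.\<close>
    hence "a0 \<in> ?S" unfolding assms(8) using fin by (intro Min_in) auto
    hence "a0 > 0" by auto
    have "2 * hbar * \<kappa>0 < \<alpha> * a0" using assms(19) \<open>a0 > 0\<close> by (simp add: pos_divide_less_eq)
    also have "\<dots> \<le> \<alpha> * \<bar>a k - a l\<bar>"
      using fin mem assms(14) unfolding assms(8) by (intro mult_left_mono Min_le) auto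
    finally have "2 * \<kappa>0 < \<alpha> * \<bar>a k - a l\<bar> / hbar" using hbar by (simp add: pos_less_divide_eq mult_ac)
    also have "\<dots> = \<bar>\<gamma> k - \<gamma> l\<bar>"
      using hbar assms(14) by (simp add: \<gamma>_def abs_mult abs_divide flip: diff_divide_distrib right_diff_distrib)
    finally show ?thesis .
  qed
  \<comment> \<open>Two points of modulus less than \<kappa>0 are less than 2 \<kappa>0 apart,
    contrary to the gap between the shifts.\<close>
  have disj: "G k v x = 0 \<or> G l u x = 0" if kl: "k \<in> {1..N}" "l \<in> {1..N}" "k \<noteq> l" for k l u v x
  proof (rule ccontr)
    assume "\<not> (G k v x = 0 \<or> G l u x = 0)"
    hence "g (x + \<gamma> k) \<noteq> 0" "g (x + \<gamma> l) \<noteq> 0" by (auto simp: G_def)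
    hence "\<bar>x + \<gamma> k\<bar> < \<kappa>0" "\<bar>x + \<gamma> l\<bar> < \<kappa>0" using g by (auto simp: band_fun_def not_le[symmetric])
    with gap[OF kl] show False by linarith
  qed
  \<comment> \<open>Translating by \<open>\<gamma> k\<close> undoes the shift of the branch. The
    amplitude \<open>G k u\<close> is antilinear in \<open>u\<close>, hence \<open>u\<close> and
    \<open>v\<close> change places on the right-hand side.\<close>
  have diag: "cinner (L2_of (G k v)) (L2_of (G k u)) * (2 * pi)
      = (cmod (c k))\<^sup>2 *\<^sub>R cinner (component (\<phi> k) u) (\<rho> k (component (\<phi> k) v))" if k: "k \<in> {1..N}" for k u v
  proof -
    let ?F = "\<lambda>x. (cmod (g x))\<^sup>2 *\<^sub>R (cinner (component (\<phi> k) u) (\<xi> k (hbar * x)) * cinner (\<xi> k (hbar * x)) (component (\<phi> k) v))"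
    have "cinner (G k v x) (G k u x) = (cmod (c k))\<^sup>2 *\<^sub>R ?F (\<gamma> k + 1 * x)" for x
    proof -
      define z1 z2 y where "z1 = cinner (component (\<phi> k) v) (\<xi> k (hbar * (x + \<gamma> k)))"
        and "z2 = cinner (component (\<phi> k) u) (\<xi> k (hbar * (x + \<gamma> k)))" and "y = g (x + \<gamma> k)"
      have "cinner (G k v x) (G k u x) = (c k * cnj (c k)) * ((y * cnj y) * (z2 * cnj z1))"
        by (simp add: G_def cinner_complex_def z1_def[symmetric] z2_def[symmetric] y_def[symmetric] mult_ac)
      also have "\<dots> = (cmod (c k))\<^sup>2 *\<^sub>R ((cmod y)\<^sup>2 *\<^sub>R (z2 * cnj z1))"
        by (simp only: complex_norm_square[symmetric] scaleR_conv_of_real of_real_power)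
      also have "cnj z1 = cinner (\<xi> k (hbar * (x + \<gamma> k))) (component (\<phi> k) v)"
        unfolding z1_def by (rule cinner_commute[symmetric])
      finally show ?thesis by (simp add: z2_def y_def add.commute)
    qed
    hence "cinner (L2_of (G k v)) (L2_of (G k u)) = (cmod (c k))\<^sup>2 *\<^sub>R (\<integral>x. ?F (\<gamma> k + 1 * x) \<partial>lborel)"
      by (simp only: cinner_L2_of[OF G_sq[OF k] G_sq[OF k]] integral_scaleR_right)
    also have "(\<integral>x. ?F (\<gamma> k + 1 * x) \<partial>lborel) = (\<integral>x. ?F x \<partial>lborel)"
      using lborel_integral_real_affine[of 1 ?F "\<gamma> k"] by simp
    finally show ?thesis unfolding \<rho>_band by (simp add: scaleR_conv_of_real mult_ac)
  qed
  define R where "R = (\<Sum>k=1..N. (cmod (cinner (\<phi> k) \<psi>0))\<^sup>2 *\<^sub>R op_tensor (ketbra (\<phi> k) (\<phi> k)) (\<rho> k))"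
  have R: "cinner (X v) (X u) = cinner u (R v)" for u v
  proof -
    have "cinner (X v) (X u) = 2 * pi * cinner (L2_of (\<lambda>x. \<Sum>k=1..N. G k v x)) (L2_of (\<lambda>x. \<Sum>k=1..N. G k u x))"
      unfolding X_def by (intro plancherel_band_cinner[of K] band_fun_sum G_band)
    also have "\<dots> = 2 * pi * (\<Sum>k=1..N. cinner (L2_of (G k v)) (L2_of (G k u)))"
      by (subst cinner_sum_disjoint_support) (simp_all add: G_sq disj)
    also have "\<dots> = (\<Sum>k=1..N. cinner (L2_of (G k v)) (L2_of (G k u)) * (2 * pi))"
      by (simp add: sum_distrib_left mult_ac)
    also have "\<dots> = (\<Sum>k=1..N. (cmod (c k))\<^sup>2 *\<^sub>R cinner (component (\<phi> k) u) (\<rho> k (component (\<phi> k) v)))"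
      by (intro sum.cong refl diag)
    also have "\<dots> = cinner u (R v)"
      by (simp add: R_def c_def blinfun.sum_left blinfun.scaleR_left cinner.sum_right cinner.scaleR_right
          op_tensor_ketbra[OF \<phi>(1) _ \<phi>(2) \<rho>_lin] cinner_vtensor_right scaleR_conv_of_real)
    finally show ?thesis .
  qed
  have "partial_trace (ketbra \<Psi>f \<Psi>f) = R"
  proof (rule partial_trace_eqI)
    fix \<E> :: "(real, complex) L2 set" and u v :: "(real, 's) L2" assume \<E>: "orthonormal_basis \<E>"
    have "cinner (probe_tensor e u) (ketbra \<Psi>f \<Psi>f (probe_tensor e v)) = cinner (X v) e * cinner e (X u)" for e
      using contraction[of e v] contraction[of e u]
      by (simp add: ketbra.rep_eq cinner_scaleC_right cinner_commute[of \<Psi>f] cinner_commute[of "X v"])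
    \<comment> \<open>Parseval in the probe space, for an arbitrary orthonormal basis, sums the
      matrix elements to the pairing of \<open>X v\<close> with \<open>X u\<close>.\<close>
    thus "((\<lambda>e. cinner (probe_tensor e u) (ketbra \<Psi>f \<Psi>f (probe_tensor e v))) has_sum cinner u (R v)) \<E>"
      using parseval_has_sum[OF \<E>, of "X v" "X u"] by (simp add: R)
  qed
  thus ?thesis using trace_int unfolding D_def R_def by blast
qed

end
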